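(* There are isomorphisms of categories $$\mathbf{Coalg}(V_\wedge)\cong\mathbf{ResACDL},\qquad\mathbf{Comon}\cong\mathbf{DerACDL},\qquad\mathbf{RelComon}\cong\mathbf{RelDerACDL}.$$ Here $\mathbf{Coalg}(V_\wedge)$ is the category of prime-counital $V_\wedge$-coalgebras and pure morphisms; $\mathbf{ResACDL}$ the category of prime-unital residuation ACDLs and residuation morphisms; $\mathbf{Comon}$ the full subcategory of $\mathbf{Coalg}(V_\wedge)$ on comonoids; $\mathbf{DerACDL}$ the full subcategory of $\mathbf{ResACDL}$ on derivation ACDLs; $\mathbf{RelComon}$ the category of comonoids and corelational morphisms; and $\mathbf{RelDerACDL}$ the category of derivation ACDLs and corelational residuation morphisms.
   Context: Lattices: an ACDL is an algebraic, completely distributive (complete) lattice; $\mathbf{ACDL}$ has as morphisms maps preserving all joins and meets. $p$ is completely join-prime if $p\le\bigvee A$ implies $p\le a$ for some $a\in A$; $\mathcal JD$ is the set of such elements. $D\otimes_CE$ (resp. $D\boxtimes_CE$) is the tensor product representing maps preserving all joins (resp. all meets) in each variable. For ACDLs both are coproducts $D+E$ in $\mathbf{ACDL}$, with injections $d\mapsto d\otimes1,\ e\mapsto1\otimes e$ (resp. $d\mapsto d\boxtimes0,\ e\mapsto0\boxtimes e$); $\omega\colon D\otimes_CE\cong D\boxtimes_CE$ is the unique isomorphism compatible with injections. Coalgebras: a $V_\wedge$-coalgebra is an ACDL $C$ with an all-meet-preserving map $\bar\gamma\colon C\to C\boxtimes_CC$; write $\gamma=\omega^{-1}\bar\gamma$.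 It is prime-counital if equipped with $\epsilon\in\mathbf{ACDL}(C,2)$ with $(\epsilon\boxtimes_C\mathrm{id})\bar\gamma=\mathrm{id}=(\mathrm{id}\boxtimes_C\epsilon)\bar\gamma$ (identifying $2\boxtimes_CC\cong C\cong C\boxtimes_C2$), and coassociative if $(\bar\gamma\boxtimes_C\mathrm{id})\bar\gamma=(\mathrm{id}\boxtimes_C\bar\gamma)\bar\gamma$. A pure morphism is $f\in\mathbf{ACDL}(C,C')$ with $(f\boxtimes_Cf)\bar\gamma=\bar\gamma'f$ and $\epsilon=\epsilon'f$. A comonoid is a coassociative prime-counital $V_\wedge$-coalgebra whose $\gamma$ also preserves all joins. A corelational morphism $\rho\colon C\to C'$ of comonoids is an all-join-preserving map with $\rho(1)=1$, $(\rho\otimes_C\rho)\gamma\le\gamma'\rho$, $\epsilon\le\epsilon'\rho$ pointwise. Residuation ACDLs: an ACDL $R$ with operations $\backslash,/\colon R\times R\to R$ such that $x\backslash(-)$, $(-)/y$ preserve all meets, $(-)\backslash z$, $z/(-)$ turn all joins into meets, and $b\le a\backslash c\iff a\le c/b$. Prime-unital: there is a completely join-prime $e$ with $e\backslash z=z=z/e$ for all $z$. Associative: $x\backslash(z/y)=(x\backslash z)/y$. Pure: for all $p\in\mathcal JR$, $p\backslash(-)$ and $(-)/p$ preserve all joins. A derivation ACDL is a pure, associative, prime-unital residuation ACDL. A residuation morphism $f\colon R\to S$ (units $e,e'$) is an $\mathbf{ACDL}$-morphism with: (Forth) $f(x\backslash z)\le f(x)\backslash f(z)$ and $f(z/x)\le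 f(z)/f(x)$; (Back) for all $y\in S,z\in R$ there is $x\in R$ with $y\le f(x)$ and $y\backslash f(z)=f(x\backslash z)$; (Back') for all $y\in S,z\in R$ there is $x\in R$ with $y\le f(x)$ and $f(z)/y=f(z/x)$; (Unit) $e\le x\iff e'\le f(x)$ for all $x$. A corelational residuation morphism $\rho\colon R\to S$ preserves all joins and the top element and satisfies $\rho(x\backslash z)\le\rho(x)\backslash\rho(z)$ and $e'\le\rho(e)$. *)

theory Defs
  imports "HOL-Algebra.Complete_Lattice" "HOL-Library.FuncSet"
begin

section \<open>Categories\<close>

record ('o, 'm) category =
  Obj :: "'o set"
  Hom :: "'o \<Rightarrow> 'o \<Rightarrow> 'm set"
  Ident :: "'o \<Rightarrow> 'm"
  Comp :: "'o \<Rightarrow> 'o \<Rightarrow> 'o \<Rightarrow> 'm \<Rightarrow> 'm \<Rightarrow> 'm"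

text \<open>
  Hom-sets are indexed by source and target and need not be disjoint, so composition carries
  the three objects involved: \<open>Comp \<C> A B C g f\<close> is \<open>g \<circ> f\<close> for \<open>f : A \<rightarrow> B\<close> and \<open>g : B \<rightarrow> C\<close>.
\<close>

definition is_category :: "('o, 'm) category \<Rightarrow> bool" where
  "is_category \<C> \<longleftrightarrow>
     (\<forall>A\<in>Obj \<C>. Ident \<C> A \<in> Hom \<C> A A) \<and>
     (\<forall>A\<in>Obj \<C>. \<forall>B\<in>Obj \<C>. \<forall>C\<in>Obj \<C>. \<forall>f\<in>Hom \<C> A B. \<forall>g\<in>Hom \<C> B C.
        Comp \<C> A B C g f \<in> Hom \<C> A C) \<and>
     (\<forall>A\<in>Obj \<C>. \<forall>B\<in>Obj \<C>. \<forall>f\<in>Hom \<C> A B.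
        Comp \<C> A A B f (Ident \<C> A) = f \<and> Comp \<C> A B B (Ident \<C> B) f = f) \<and>
     (\<forall>A\<in>Obj \<C>. \<forall>B\<in>Obj \<C>. \<forall>C\<in>Obj \<C>. \<forall>D\<in>Obj \<C>.
        \<forall>f\<in>Hom \<C> A B. \<forall>g\<in>Hom \<C> B C. \<forall>h\<in>Hom \<C> C D.
        Comp \<C> A C D h (Comp \<C> A B C g f) = Comp \<C> A B D (Comp \<C> B C D h g) f)"

definition is_functor ::
  "('o, 'm) category \<Rightarrow> ('p, 'n) category \<Rightarrow> ('o \<Rightarrow> 'p) \<Rightarrow> ('o \<Rightarrow> 'o \<Rightarrow> 'm \<Rightarrow> 'n) \<Rightarrow> bool" where
  "is_functor \<C> \<D> F\<^sub>o F\<^sub>m \<longleftrightarrow>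
     (\<forall>A\<in>Obj \<C>. F\<^sub>o A \<in> Obj \<D>) \<and>
     (\<forall>A\<in>Obj \<C>. \<forall>B\<in>Obj \<C>. \<forall>f\<in>Hom \<C> A B. F\<^sub>m A B f \<in> Hom \<D> (F\<^sub>o A) (F\<^sub>o B)) \<and>
     (\<forall>A\<in>Obj \<C>. F\<^sub>m A A (Ident \<C> A) = Ident \<D> (F\<^sub>o A)) \<and>
     (\<forall>A\<in>Obj \<C>. \<forall>B\<in>Obj \<C>. \<forall>C\<in>Obj \<C>. \<forall>f\<in>Hom \<C> A B. \<forall>g\<in>Hom \<C> B C.
        F\<^sub>m A C (Comp \<C> A B C g f) = Comp \<D> (F\<^sub>o A) (F\<^sub>o B) (F\<^sub>o C) (F\<^sub>m B C g) (F\<^sub>m A B f))"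

definition isomorphic_categories :: "('o, 'm) category \<Rightarrow> ('p, 'n) category \<Rightarrow> bool" where
  "isomorphic_categories \<C> \<D> \<longleftrightarrow> is_category \<C> \<and> is_category \<D> \<and>
     (\<exists>F\<^sub>o F\<^sub>m G\<^sub>o G\<^sub>m. is_functor \<C> \<D> F\<^sub>o F\<^sub>m \<and> is_functor \<D> \<C> G\<^sub>o G\<^sub>m \<and>
        (\<forall>A\<in>Obj \<C>. G\<^sub>o (F\<^sub>o A) = A) \<and>
        (\<forall>A\<in>Obj \<C>. \<forall>B\<in>Obj \<C>. \<forall>f\<in>Hom \<C> A B. G\<^sub>m (F\<^sub>o A) (F\<^sub>o B) (F\<^sub>m A B f) = f) \<and>
        (\<forall>X\<in>Obj \<D>. F\<^sub>o (G\<^sub>o X) = X) \<and>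
        (\<forall>X\<in>Obj \<D>. \<forall>Y\<in>Obj \<D>. \<forall>g\<in>Hom \<D> X Y. F\<^sub>m (G\<^sub>o X) (G\<^sub>o Y) (G\<^sub>m X Y g) = g))"

definition full_subcategory :: "('o, 'm) category \<Rightarrow> ('o \<Rightarrow> bool) \<Rightarrow> ('o, 'm) category" where
  "full_subcategory \<C> P = \<C>\<lparr>Obj := {A \<in> Obj \<C>. P A}\<rparr>"


section \<open>Algebraic completely distributive lattices\<close>

definition compact_element :: "('a, 'z) gorder_scheme \<Rightarrow> 'a \<Rightarrow> bool" where
  "compact_element L k \<longleftrightarrow> k \<in> carrier L \<and>
     (\<forall>A \<subseteq> carrier L. k \<sqsubseteq>\<^bsub>L\<^esub> \<Squnion>\<^bsub>L\<^esub>A \<longrightarrow> (\<exists>F \<subseteq> A. finite F \<and> k \<sqsubseteq>\<^bsub>L\<^esub> \<Squnion>\<^bsub>L\<^esub>F))"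

definition algebraic_lattice :: "('a, 'z) gorder_scheme \<Rightarrow> bool" where
  "algebraic_lattice L \<longleftrightarrow> complete_lattice L \<and>
     (\<forall>x\<in>carrier L. x = \<Squnion>\<^bsub>L\<^esub>{k. compact_element L k \<and> k \<sqsubseteq>\<^bsub>L\<^esub> x})"

text \<open>The law is the one of the type class \<^class>\<open>complete_distrib_lattice\<close>, relativised to the carrier.\<close>

definition completely_distributive :: "('a, 'z) gorder_scheme \<Rightarrow> bool" where
  "completely_distributive L \<longleftrightarrow> complete_lattice L \<and>
     (\<forall>\<A> \<subseteq> Pow (carrier L).
        \<Sqinter>\<^bsub>L\<^esub>((\<lambda>A. \<Squnion>\<^bsub>L\<^esub>A) ` \<A>) = \<Squnion>\<^bsub>L\<^esub>((\<lambda>B. \<Sqinter>\<^bsub>L\<^esub>B) ` {f ` \<A> |f. \<forall>A\<in>\<A>. f A \<in> A}))"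

definition acdl :: "('a, 'z) gorder_scheme \<Rightarrow> bool" where
  "acdl L \<longleftrightarrow> algebraic_lattice L \<and> completely_distributive L"

text \<open>
  The order component of a \<^typ>\<open>'a gorder\<close> is unconstrained outside the carrier. For objects of
  categories it is required to be a relation on the carrier, so that two objects are equal
  exactly if they are the same mathematical structure. For the same reason all maps and operations
  that are components of objects or morphisms are extensional, i.e. elements of \<open>\<rightarrow>\<^sub>E\<close>.
  The categories below have as objects all structures whose carrier is a subset of the type \<open>'a\<close>,
  which is arbitrary and plays the role of the universe of sets.
\<close>

definition order_on_carrier :: "('a, 'z) gorder_scheme \<Rightarrow> bool" where
  "order_on_carrier L \<longleftrightarrow> (\<forall>x y. x \<sqsubseteq>\<^bsub>L\<^esub> y \<longrightarrow> x \<in> carrier L \<and> y \<in> carrier L)"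

definition completely_join_prime :: "('a, 'z) gorder_scheme \<Rightarrow> 'a \<Rightarrow> bool" where
  "completely_join_prime L p \<longleftrightarrow> p \<in> carrier L \<and>
     (\<forall>A \<subseteq> carrier L. p \<sqsubseteq>\<^bsub>L\<^esub> \<Squnion>\<^bsub>L\<^esub>A \<longrightarrow> (\<exists>a\<in>A. p \<sqsubseteq>\<^bsub>L\<^esub> a))"

definition acdl_hom :: "('a, 'y) gorder_scheme \<Rightarrow> ('b, 'z) gorder_scheme \<Rightarrow> ('a \<Rightarrow> 'b) set" where
  "acdl_hom L M = {f \<in> carrier L \<rightarrow>\<^sub>E carrier M. sup_pres L M f \<and> inf_pres L M f}"

definition two :: "bool gorder" where
  "two = \<lparr>carrier = UNIV, eq = (=), le = (\<le>)\<rparr>"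


section \<open>Tensor products of complete lattices\<close>

text \<open>
  The tensor product for maps preserving all joins in each variable is realised by the sets \<open>U\<close> of
  pairs whose membership predicate turns joins in each variable into meets of truth values. In
  particular (\<open>A = {}\<close>, \<open>A = {a, b}\<close>) such sets contain all pairs with a bottom component and are
  down-closed. The universal properties of \<open>tensor\<close> and of its dual are \<open>tensor_universal\<close> and
  \<open>box_universal\<close> below.
\<close>

definition tensor :: "('a, 'y) gorder_scheme \<Rightarrow> ('b, 'z) gorder_scheme \<Rightarrow> ('a \<times> 'b) set gorder" where
  "tensor D E = \<lparr>
     carrier = {U. U \<subseteq> carrier D \<times> carrier E \<and>
       (\<forall>A \<subseteq> carrier D. \<forall>e\<in>carrier E. (\<Squnion>\<^bsub>D\<^esub>A, e) \<in> U \<longleftrightarrow> (\<forall>a\<in>A. (a, e) \<in> U)) \<and>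
       (\<forall>d\<in>carrier D. \<forall>B \<subseteq> carrier E. (d, \<Squnion>\<^bsub>E\<^esub>B) \<in> U \<longleftrightarrow> (\<forall>b\<in>B. (d, b) \<in> U))},
     eq = (=), le = (\<subseteq>)\<rparr>"

definition pure_tensor ::
  "('a, 'y) gorder_scheme \<Rightarrow> ('b, 'z) gorder_scheme \<Rightarrow> 'a \<Rightarrow> 'b \<Rightarrow> ('a \<times> 'b) set" where
  "pure_tensor D E d e = \<Inter>{U \<in> carrier (tensor D E). (d, e) \<in> U}"

definition bi_sup_pres ::
  "('a, 'x) gorder_scheme \<Rightarrow> ('b, 'y) gorder_scheme \<Rightarrow> ('c, 'z) gorder_scheme \<Rightarrow>
   ('a \<Rightarrow> 'b \<Rightarrow> 'c) \<Rightarrow> bool" where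
  "bi_sup_pres D E L h \<longleftrightarrow>
     (\<forall>d\<in>carrier D. \<forall>e\<in>carrier E. h d e \<in> carrier L) \<and>
     (\<forall>e\<in>carrier E. sup_pres D L (\<lambda>d. h d e)) \<and> (\<forall>d\<in>carrier D. sup_pres E L (h d))"

definition bi_inf_pres ::
  "('a, 'x) gorder_scheme \<Rightarrow> ('b, 'y) gorder_scheme \<Rightarrow> ('c, 'z) gorder_scheme \<Rightarrow>
   ('a \<Rightarrow> 'b \<Rightarrow> 'c) \<Rightarrow> bool" where
  "bi_inf_pres D E L h \<longleftrightarrow>
     (\<forall>d\<in>carrier D. \<forall>e\<in>carrier E. h d e \<in> carrier L) \<and>
     (\<forall>e\<in>carrier E. inf_pres D L (\<lambda>d. h d e)) \<and> (\<forall>d\<in>carrier D. inf_pres E L (h d))"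

text \<open>
  \<open>tensor_lift L h\<close> is the join-preserving extension of \<open>h\<close> along \<open>(d, e) \<mapsto> d \<otimes> e\<close>, see the lemma
  \<open>tensor_universal\<close>.
\<close>

definition tensor_lift :: "('c, 'z) gorder_scheme \<Rightarrow> ('a \<Rightarrow> 'b \<Rightarrow> 'c) \<Rightarrow> ('a \<times> 'b) set \<Rightarrow> 'c" where
  "tensor_lift L h U = \<Squnion>\<^bsub>L\<^esub>{h d e |d e. (d, e) \<in> U}"

lemma sup_le_iff:
  assumes "complete_lattice L" "A \<subseteq> carrier L" "s \<in> carrier L"
  shows "\<Squnion>\<^bsub>L\<^esub>A \<sqsubseteq>\<^bsub>L\<^esub> s \<longleftrightarrow> (\<forall>a\<in>A. a \<sqsubseteq>\<^bsub>L\<^esub> s)"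
proof -
  interpret L: complete_lattice L by fact
  show ?thesis
    using assms(2,3) L.sup_upper L.sup_least L.sup_closed L.le_trans by (meson subsetD)
qed

lemma eq_by_upper_bounds:
  assumes "complete_lattice L" "x \<in> carrier L" "y \<in> carrier L"
    and "\<And>s. s \<in> carrier L \<Longrightarrow> x \<sqsubseteq>\<^bsub>L\<^esub> s \<longleftrightarrow> y \<sqsubseteq>\<^bsub>L\<^esub> s"
  shows "x = y"
proof -
  interpret L: complete_lattice L by fact
  show ?thesis using assms(2-4) L.le_refl L.le_antisym by blast
qed

lemma le_tensor [simp]: "U \<sqsubseteq>\<^bsub>tensor D E\<^esub> V \<longleftrightarrow> U \<subseteq> V"
  by (simp add: tensor_def)

lemma complete_lattice_dual_iff: "complete_lattice (inv_gorder L) \<longleftrightarrow> complete_lattice L"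
proof -
  have "partial_order (inv_gorder L) \<longleftrightarrow> partial_order L" by (rule dual_order_iff)
  then show ?thesis
    unfolding complete_lattice_def complete_lattice_axioms_def by auto
qed

lemma complete_lattice_tensor:
  assumes "complete_lattice D" "complete_lattice E"
  shows "complete_lattice (tensor D E)"
proof -
  interpret D: complete_lattice D by fact
  interpret E: complete_lattice E by fact
  interpret T: partial_order "tensor D E"
    by unfold_locales (auto simp: tensor_def)
  show ?thesis
  proof (rule T.complete_lattice_criterion1)
    have "carrier D \<times> carrier E \<in> carrier (tensor D E)"
      unfolding tensor_def by auto
    then show "\<exists>g. greatest (tensor D E) g (carrier (tensor D E))"
      by (intro exI[of _ "carrier D \<times> carrier E"]) (auto simp: greatest_def tensor_def)
  next
    fix \<U> assume \<U>: "\<U> \<subseteq> carrier (tensor D E)" "\<U> \<noteq> {}"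
    have *: "U \<subseteq> carrier D \<times> carrier E"
      "\<And>A e. A \<subseteq> carrier D \<Longrightarrow> e \<in> carrier E \<Longrightarrow> (\<Squnion>\<^bsub>D\<^esub>A, e) \<in> U \<longleftrightarrow> (\<forall>a\<in>A. (a, e) \<in> U)"
      "\<And>B d. d \<in> carrier D \<Longrightarrow> B \<subseteq> carrier E \<Longrightarrow> (d, \<Squnion>\<^bsub>E\<^esub>B) \<in> U \<longleftrightarrow> (\<forall>b\<in>B. (d, b) \<in> U)"
      if "U \<in> \<U>" for U
      using that \<U>(1) by (auto simp: tensor_def)
    have "\<Inter>\<U> \<in> carrier (tensor D E)"
      unfolding tensor_def using *(1) \<U>(2) by (simp add: *(2,3)) blast
    then show "\<exists>i. is_glb (tensor D E) i \<U>"
      using \<U> by (intro exI[of _ "\<Inter>\<U>"] greatest_LowerI) (auto simp: Lower_def)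
  qed
qed

lemma
  assumes "complete_lattice D" "complete_lattice E" "d \<in> carrier D" "e \<in> carrier E"
  shows pure_tensor_closed: "pure_tensor D E d e \<in> carrier (tensor D E)"
    and pure_tensor_le_iff:
      "U \<in> carrier (tensor D E) \<Longrightarrow> pure_tensor D E d e \<subseteq> U \<longleftrightarrow> (d, e) \<in> U"
proof -
  interpret T: complete_lattice "tensor D E" using assms by (rule_tac complete_lattice_tensor)
  let ?\<U> = "{U \<in> carrier (tensor D E). (d, e) \<in> U}"
  interpret D: complete_lattice D by fact
  interpret E: complete_lattice E by fact
  have full: "carrier D \<times> carrier E \<in> ?\<U>"
    using assms unfolding tensor_def by auto
  have "U \<subseteq> carrier D \<times> carrier E"
      "\<And>A e. A \<subseteq> carrier D \<Longrightarrow> e \<in> carrier E \<Longrightarrow> (\<Squnion>\<^bsub>D\<^esub>A, e) \<in> U \<longleftrightarrow> (\<forall>a\<in>A. (a, e) \<in> U)"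
      "\<And>B d. d \<in> carrier D \<Longrightarrow> B \<subseteq> carrier E \<Longrightarrow> (d, \<Squnion>\<^bsub>E\<^esub>B) \<in> U \<longleftrightarrow> (\<forall>b\<in>B. (d, b) \<in> U)"
      if "U \<in> ?\<U>" for U
      using that by (auto simp: tensor_def)
  note * = this
  have "\<Inter>?\<U> \<in> carrier (tensor D E)"
  proof -
    have "\<Inter>?\<U> \<subseteq> carrier D \<times> carrier E" using full by blast
    moreover have "(\<Squnion>\<^bsub>D\<^esub>A, y) \<in> \<Inter>?\<U> \<longleftrightarrow> (\<forall>a\<in>A. (a, y) \<in> \<Inter>?\<U>)"
      if "A \<subseteq> carrier D" "y \<in> carrier E" for A y
      using *(2)[OF _ that] by blast
    moreover have "(x, \<Squnion>\<^bsub>E\<^esub>B) \<in> \<Inter>?\<U> \<longleftrightarrow> (\<forall>b\<in>B. (x, b) \<in> \<Inter>?\<U>)"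
      if "x \<in> carrier D" "B \<subseteq> carrier E" for B x
      using *(3)[OF _ that] by blast
    ultimately show ?thesis by (subst tensor_def) simp
  qed
  then show "pure_tensor D E d e \<in> carrier (tensor D E)" by (simp add: pure_tensor_def)
  show "pure_tensor D E d e \<subseteq> U \<longleftrightarrow> (d, e) \<in> U" if "U \<in> carrier (tensor D E)"
    using that unfolding pure_tensor_def by blast
qed

lemma bi_sup_pres_pure_tensor:
  assumes D: "complete_lattice D" and E: "complete_lattice E"
  shows "bi_sup_pres D E (tensor D E) (pure_tensor D E)"
proof -
  interpret D: complete_lattice D by fact
  interpret E: complete_lattice E by fact
  have T: "complete_lattice (tensor D E)" using D E by (rule complete_lattice_tensor)
  interpret T: complete_lattice "tensor D E" by (rule T)
  note cl = pure_tensor_closed[OF D E] and le = pure_tensor_le_iff[OF D E]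
  have "pure_tensor D E (\<Squnion>\<^bsub>D\<^esub>A) e = \<Squnion>\<^bsub>tensor D E\<^esub>((\<lambda>d. pure_tensor D E d e) ` A)"
    if "A \<subseteq> carrier D" "e \<in> carrier E" for A e
  proof (rule eq_by_upper_bounds[OF T])
    fix U assume U: "U \<in> carrier (tensor D E)"
    have "(\<lambda>d. pure_tensor D E d e) ` A \<subseteq> carrier (tensor D E)" using cl that by blast
    note s = sup_le_iff[OF T this U]
    have "(\<Squnion>\<^bsub>D\<^esub>A, e) \<in> U \<longleftrightarrow> (\<forall>a\<in>A. (a, e) \<in> U)" using U that by (simp add: tensor_def)
    then show "pure_tensor D E (\<Squnion>\<^bsub>D\<^esub>A) e \<sqsubseteq>\<^bsub>tensor D E\<^esub> U \<longleftrightarrow>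
      \<Squnion>\<^bsub>tensor D E\<^esub>((\<lambda>d. pure_tensor D E d e) ` A) \<sqsubseteq>\<^bsub>tensor D E\<^esub> U"
      using s le[OF _ that(2) U] that D.sup_closed by (simp add: subset_iff)
  qed (use that cl in \<open>auto intro!: T.sup_closed\<close>)
  moreover have "pure_tensor D E d (\<Squnion>\<^bsub>E\<^esub>B) = \<Squnion>\<^bsub>tensor D E\<^esub>(pure_tensor D E d ` B)"
    if "d \<in> carrier D" "B \<subseteq> carrier E" for B d
  proof (rule eq_by_upper_bounds[OF T])
    fix U assume U: "U \<in> carrier (tensor D E)"
    have "pure_tensor D E d ` B \<subseteq> carrier (tensor D E)" using cl that by blast
    note s = sup_le_iff[OF T this U]
    have "(d, \<Squnion>\<^bsub>E\<^esub>B) \<in> U \<longleftrightarrow> (\<forall>b\<in>B. (d, b) \<in> U)" using U that by (simp add: tensor_def)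
    then show "pure_tensor D E d (\<Squnion>\<^bsub>E\<^esub>B) \<sqsubseteq>\<^bsub>tensor D E\<^esub> U \<longleftrightarrow>
      \<Squnion>\<^bsub>tensor D E\<^esub>(pure_tensor D E d ` B) \<sqsubseteq>\<^bsub>tensor D E\<^esub> U"
      using s le[OF that(1) _ U] that E.sup_closed by (simp add: subset_iff)
  qed (use that cl in \<open>auto intro!: T.sup_closed\<close>)
  ultimately show ?thesis
    using D E T cl by (simp add: bi_sup_pres_def sup_pres_def)
qed

lemma tensor_eq_sup_pure:
  assumes D: "complete_lattice D" and E: "complete_lattice E" and U: "U \<in> carrier (tensor D E)"
  shows "U = \<Squnion>\<^bsub>tensor D E\<^esub>{pure_tensor D E d e |d e. (d, e) \<in> U}"
proof (rule eq_by_upper_bounds)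
  show T: "complete_lattice (tensor D E)" using D E by (rule complete_lattice_tensor)
  interpret T: complete_lattice "tensor D E" by (rule T)
  have UD: "d \<in> carrier D" "e \<in> carrier E" if "(d, e) \<in> U" for d e
    using U that by (auto simp: tensor_def)
  then have sub: "{pure_tensor D E d e |d e. (d, e) \<in> U} \<subseteq> carrier (tensor D E)"
    using pure_tensor_closed[OF D E] by blast
  then show "\<Squnion>\<^bsub>tensor D E\<^esub>{pure_tensor D E d e |d e. (d, e) \<in> U} \<in> carrier (tensor D E)"
    by (rule T.sup_closed)
  fix V assume V: "V \<in> carrier (tensor D E)"
  have "U \<subseteq> V \<longleftrightarrow> (\<forall>d e. (d, e) \<in> U \<longrightarrow> pure_tensor D E d e \<subseteq> V)"
    using pure_tensor_le_iff[OF D E _ _ V] UD by (auto simp: subset_iff)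
  then show "U \<sqsubseteq>\<^bsub>tensor D E\<^esub> V \<longleftrightarrow>
      \<Squnion>\<^bsub>tensor D E\<^esub>{pure_tensor D E d e |d e. (d, e) \<in> U} \<sqsubseteq>\<^bsub>tensor D E\<^esub> V"
    using sup_le_iff[OF T sub V] by auto
qed (rule U)

lemma tensor_universal:
  assumes D: "complete_lattice D" and E: "complete_lattice E" and L: "complete_lattice L"
    and h: "bi_sup_pres D E L h"
  shows "k \<in> carrier (tensor D E) \<rightarrow>\<^sub>E carrier L \<and> sup_pres (tensor D E) L k \<and>
      (\<forall>d\<in>carrier D. \<forall>e\<in>carrier E. k (pure_tensor D E d e) = h d e) \<longleftrightarrow>
    k = restrict (tensor_lift L h) (carrier (tensor D E))"
    (is "?ext k \<longleftrightarrow> k = ?k")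
proof -
  interpret D: complete_lattice D by fact
  interpret E: complete_lattice E by fact
  interpret L: complete_lattice L by fact
  have T: "complete_lattice (tensor D E)" using D E by (rule complete_lattice_tensor)
  interpret T: complete_lattice "tensor D E" by (rule T)
  have hc: "h d e \<in> carrier L" if "d \<in> carrier D" "e \<in> carrier E" for d e
    using h that by (simp add: bi_sup_pres_def)
  have UD: "d \<in> carrier D" "e \<in> carrier E" if "(d, e) \<in> U" "U \<in> carrier (tensor D E)" for d e U
    using that by (auto simp: tensor_def)
  have sub: "{h d e |d e. (d, e) \<in> U} \<subseteq> carrier L" if "U \<in> carrier (tensor D E)" for U
    using that UD hc by blast
  have lc: "tensor_lift L h U \<in> carrier L" if "U \<in> carrier (tensor D E)" for U
    unfolding tensor_lift_def using sub[OF that] by (rule L.sup_closed)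
  define K where "K s = {(d, e). d \<in> carrier D \<and> e \<in> carrier E \<and> h d e \<sqsubseteq>\<^bsub>L\<^esub> s}" for s
  have K: "K s \<in> carrier (tensor D E)" if s: "s \<in> carrier L" for s
  proof -
    have "h (\<Squnion>\<^bsub>D\<^esub>A) e \<sqsubseteq>\<^bsub>L\<^esub> s \<longleftrightarrow> (\<forall>a\<in>A. h a e \<sqsubseteq>\<^bsub>L\<^esub> s)"
      if "A \<subseteq> carrier D" "e \<in> carrier E" for A e
    proof -
      have "h (\<Squnion>\<^bsub>D\<^esub>A) e = \<Squnion>\<^bsub>L\<^esub>((\<lambda>a. h a e) ` A)"
        using h that by (simp add: bi_sup_pres_def sup_pres_def)
      moreover have "(\<lambda>a. h a e) ` A \<subseteq> carrier L" using hc that by blast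
      ultimately show ?thesis using sup_le_iff[OF L _ s] by simp
    qed
    moreover have "h d (\<Squnion>\<^bsub>E\<^esub>B) \<sqsubseteq>\<^bsub>L\<^esub> s \<longleftrightarrow> (\<forall>b\<in>B. h d b \<sqsubseteq>\<^bsub>L\<^esub> s)"
      if "d \<in> carrier D" "B \<subseteq> carrier E" for B d
    proof -
      have "h d (\<Squnion>\<^bsub>E\<^esub>B) = \<Squnion>\<^bsub>L\<^esub>(h d ` B)"
        using h that by (simp add: bi_sup_pres_def sup_pres_def)
      moreover have "h d ` B \<subseteq> carrier L" using hc that by blast
      ultimately show ?thesis using sup_le_iff[OF L _ s] by simp
    qed
    moreover have "\<Squnion>\<^bsub>D\<^esub>A \<in> carrier D" if "A \<subseteq> carrier D" for A
      using that by (rule D.sup_closed)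
    moreover have "\<Squnion>\<^bsub>E\<^esub>B \<in> carrier E" if "B \<subseteq> carrier E" for B
      using that by (rule E.sup_closed)
    ultimately show ?thesis unfolding tensor_def K_def by auto
  qed
  have le: "tensor_lift L h U \<sqsubseteq>\<^bsub>L\<^esub> s \<longleftrightarrow> U \<subseteq> K s"
    if "U \<in> carrier (tensor D E)" "s \<in> carrier L" for U s
  proof -
    have "(\<forall>x\<in>{h d e |d e. (d, e) \<in> U}. x \<sqsubseteq>\<^bsub>L\<^esub> s) \<longleftrightarrow> (\<forall>d e. (d, e) \<in> U \<longrightarrow> h d e \<sqsubseteq>\<^bsub>L\<^esub> s)"
      by blast
    also have "\<dots> \<longleftrightarrow> U \<subseteq> K s"
      unfolding K_def using UD[OF _ that(1)] by blast
    finally show ?thesis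
      unfolding tensor_lift_def sup_le_iff[OF L sub[OF that(1)] that(2)] .
  qed
  have "?ext ?k"
  proof (intro conjI ballI)
    show "?k \<in> carrier (tensor D E) \<rightarrow>\<^sub>E carrier L" using lc by auto
    show "sup_pres (tensor D E) L ?k"
      unfolding sup_pres_def
    proof (intro conjI allI impI)
      fix \<U> assume \<U>: "\<U> \<subseteq> carrier (tensor D E)"
      then have img: "?k ` \<U> \<subseteq> carrier L" using lc by auto
      have c: "\<Squnion>\<^bsub>tensor D E\<^esub>\<U> \<in> carrier (tensor D E)" using \<U> by (rule T.sup_closed)
      show "?k (\<Squnion>\<^bsub>tensor D E\<^esub>\<U>) = \<Squnion>\<^bsub>L\<^esub>(?k ` \<U>)"
      proof (rule eq_by_upper_bounds[OF L])
        fix s assume s: "s \<in> carrier L"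
        have "?k (\<Squnion>\<^bsub>tensor D E\<^esub>\<U>) \<sqsubseteq>\<^bsub>L\<^esub> s \<longleftrightarrow> (\<forall>U\<in>\<U>. U \<subseteq> K s)"
          using c le[OF c s] sup_le_iff[OF T \<U> K[OF s]] by simp
        also have "\<dots> \<longleftrightarrow> (\<forall>U\<in>\<U>. ?k U \<sqsubseteq>\<^bsub>L\<^esub> s)" using \<U> le[OF _ s] by auto
        finally show "?k (\<Squnion>\<^bsub>tensor D E\<^esub>\<U>) \<sqsubseteq>\<^bsub>L\<^esub> s \<longleftrightarrow> \<Squnion>\<^bsub>L\<^esub>(?k ` \<U>) \<sqsubseteq>\<^bsub>L\<^esub> s"
          unfolding sup_le_iff[OF L img s] by blast
      qed (use c lc img L.sup_closed in auto)
    qed (rule T L)+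
    fix d e assume de: "d \<in> carrier D" "e \<in> carrier E"
    note p = pure_tensor_closed[OF D E de]
    have "tensor_lift L h (pure_tensor D E d e) = h d e"
      by (rule eq_by_upper_bounds[OF L lc[OF p] hc[OF de]])
        (use le[OF p] pure_tensor_le_iff[OF D E de K] de in \<open>simp add: K_def\<close>)
    with p show "?k (pure_tensor D E d e) = h d e" by simp
  qed
  moreover have "k = ?k" if k: "?ext k"
  proof
    fix U
    show "k U = ?k U"
    proof (cases "U \<in> carrier (tensor D E)")
      case True
      let ?P = "{pure_tensor D E d e |d e. (d, e) \<in> U}"
      have "?P \<subseteq> carrier (tensor D E)" using pure_tensor_closed[OF D E] UD[OF _ True] by blast
      then have "k (\<Squnion>\<^bsub>tensor D E\<^esub>?P) = \<Squnion>\<^bsub>L\<^esub>(k ` ?P)" using k by (simp add: sup_pres_def)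
      moreover have "k ` ?P = {h d e |d e. (d, e) \<in> U}"
        using k UD[OF _ True] by (auto simp: image_iff) metis+
      ultimately show ?thesis
        using tensor_eq_sup_pure[OF D E True] True by (simp add: tensor_lift_def)
    next
      case False
      with k show ?thesis by (auto simp: PiE_def extensional_def)
    qed
  qed
  ultimately show ?thesis by blast
qed

lemma sup_pres_dual: "sup_pres (inv_gorder L) (inv_gorder M) f \<longleftrightarrow> inf_pres L M f"
  by (simp add: sup_pres_def inf_pres_def complete_lattice_dual_iff)

lemma bi_sup_pres_dual:
  "bi_sup_pres (inv_gorder D) (inv_gorder E) (inv_gorder L) h \<longleftrightarrow> bi_inf_pres D E L h"
  by (simp add: bi_sup_pres_def bi_inf_pres_def sup_pres_dual)

definition tensor_map ::
  "('c, 'y) gorder_scheme \<Rightarrow> ('d, 'z) gorder_scheme \<Rightarrow> ('a \<Rightarrow> 'c) \<Rightarrow> ('b \<Rightarrow> 'd) \<Rightarrow>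
   ('a \<times> 'b) set \<Rightarrow> ('c \<times> 'd) set" where
  "tensor_map D' E' f g = tensor_lift (tensor D' E') (\<lambda>d e. pure_tensor D' E' (f d) (g e))"

text \<open>The associativity isomorphism \<open>(a \<otimes> b) \<otimes> c \<mapsto> a \<otimes> (b \<otimes> c)\<close>.\<close>

definition tensor_assoc ::
  "('a, 'x) gorder_scheme \<Rightarrow> ('b, 'y) gorder_scheme \<Rightarrow> ('c, 'z) gorder_scheme \<Rightarrow>
   (('a \<times> 'b) set \<times> 'c) set \<Rightarrow> ('a \<times> ('b \<times> 'c) set) set" where
  "tensor_assoc D E F =
     (let EF = tensor E F; DEF = tensor D EF in
      tensor_lift DEF (\<lambda>W c. tensor_lift DEF (\<lambda>a b. pure_tensor D EF a (pure_tensor E F b c)) W))"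

text \<open>
  The tensor product for maps preserving all meets in each variable is the order dual. The type of
  its elements is the same, but its top element is the smallest of the sets representing its elements.
\<close>

definition box :: "('a, 'y) gorder_scheme \<Rightarrow> ('b, 'z) gorder_scheme \<Rightarrow> ('a \<times> 'b) set gorder" where
  "box D E = inv_gorder (tensor (inv_gorder D) (inv_gorder E))"

definition pure_box ::
  "('a, 'y) gorder_scheme \<Rightarrow> ('b, 'z) gorder_scheme \<Rightarrow> 'a \<Rightarrow> 'b \<Rightarrow> ('a \<times> 'b) set" where
  "pure_box D E = pure_tensor (inv_gorder D) (inv_gorder E)"

lemma inv_gorder_box: "inv_gorder (box D E) = tensor (inv_gorder D) (inv_gorder E)"
  unfolding box_def by (rule inv_gorder_inv)

lemma carrier_box: "carrier (box D E) = carrier (tensor (inv_gorder D) (inv_gorder E))"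
  by (simp add: box_def)

lemma bi_inf_pres_pure_box:
  assumes "complete_lattice D" "complete_lattice E"
  shows "bi_inf_pres D E (box D E) (pure_box D E)"
  unfolding bi_sup_pres_dual[symmetric] inv_gorder_box pure_box_def
  by (rule bi_sup_pres_pure_tensor) (use assms in \<open>simp_all add: complete_lattice_dual_iff\<close>)

lemma box_universal:
  assumes D: "complete_lattice D" and E: "complete_lattice E" and L: "complete_lattice L"
    and h: "bi_inf_pres D E L h"
  shows "k \<in> carrier (box D E) \<rightarrow>\<^sub>E carrier L \<and> inf_pres (box D E) L k \<and>
      (\<forall>d\<in>carrier D. \<forall>e\<in>carrier E. k (pure_box D E d e) = h d e) \<longleftrightarrow>
    k = restrict (tensor_lift (inv_gorder L) h) (carrier (box D E))"
  using tensor_universal[of "inv_gorder D" "inv_gorder E" "inv_gorder L" h k] assms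
  unfolding sup_pres_dual[symmetric] inv_gorder_box
  unfolding carrier_box pure_box_def bi_sup_pres_dual complete_lattice_dual_iff
  by simp

definition box_map ::
  "('c, 'y) gorder_scheme \<Rightarrow> ('d, 'z) gorder_scheme \<Rightarrow> ('a \<Rightarrow> 'c) \<Rightarrow> ('b \<Rightarrow> 'd) \<Rightarrow>
   ('a \<times> 'b) set \<Rightarrow> ('c \<times> 'd) set" where
  "box_map D' E' = tensor_map (inv_gorder D') (inv_gorder E')"

definition box_assoc ::
  "('a, 'x) gorder_scheme \<Rightarrow> ('b, 'y) gorder_scheme \<Rightarrow> ('c, 'z) gorder_scheme \<Rightarrow>
   (('a \<times> 'b) set \<times> 'c) set \<Rightarrow> ('a \<times> ('b \<times> 'c) set) set" where
  "box_assoc D E F = tensor_assoc (inv_gorder D) (inv_gorder E) (inv_gorder F)"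

definition omega ::
  "('a, 'y) gorder_scheme \<Rightarrow> ('b, 'z) gorder_scheme \<Rightarrow> ('a \<times> 'b) set \<Rightarrow> ('a \<times> 'b) set" where
  "omega D E = (THE w. w \<in> acdl_hom (tensor D E) (box D E) \<and>
     bij_betw w (carrier (tensor D E)) (carrier (box D E)) \<and>
     (\<forall>d\<in>carrier D. w (pure_tensor D E d \<top>\<^bsub>E\<^esub>) = pure_box D E d \<bottom>\<^bsub>E\<^esub>) \<and>
     (\<forall>e\<in>carrier E. w (pure_tensor D E \<top>\<^bsub>D\<^esub> e) = pure_box D E \<bottom>\<^bsub>D\<^esub> e))"


section \<open>Coalgebras\<close>

record 'a coalgebra = "'a gorder" +
  comult :: "'a \<Rightarrow> ('a \<times> 'a) set"
  counit :: "'a \<Rightarrow> bool"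

text \<open>\<open>comult\<close> is the structure map into \<^const>\<open>box\<close>; \<open>tcomult\<close> is its transport into \<^const>\<open>tensor\<close>.\<close>

definition tcomult :: "'a coalgebra \<Rightarrow> 'a \<Rightarrow> ('a \<times> 'a) set" where
  "tcomult C = (\<lambda>x\<in>carrier C. inv_into (carrier (tensor C C)) (omega C C) (comult C x))"

definition V_coalgebra :: "'a coalgebra \<Rightarrow> bool" where
  "V_coalgebra C \<longleftrightarrow> acdl C \<and> order_on_carrier C \<and>
     comult C \<in> carrier C \<rightarrow>\<^sub>E carrier (box C C) \<and> inf_pres C (box C C) (comult C)"

text \<open>
  In the counit laws, \<open>C\<close> is identified with \<open>2 \<boxtimes> C\<close> and \<open>C \<boxtimes> 2\<close> through the coproduct injections
  \<open>c \<mapsto> 0 \<boxtimes> c\<close> and \<open>c \<mapsto> c \<boxtimes> 0\<close>.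
\<close>

definition prime_counital :: "'a coalgebra \<Rightarrow> bool" where
  "prime_counital C \<longleftrightarrow> counit C \<in> acdl_hom C two \<and>
     (\<forall>x\<in>carrier C. box_map two C (counit C) id (comult C x) = pure_box two C \<bottom>\<^bsub>two\<^esub> x) \<and>
     (\<forall>x\<in>carrier C. box_map C two id (counit C) (comult C x) = pure_box C two x \<bottom>\<^bsub>two\<^esub>)"

definition coassociative :: "'a coalgebra \<Rightarrow> bool" where
  "coassociative C \<longleftrightarrow> (\<forall>x\<in>carrier C.
     box_assoc C C C (box_map (box C C) C (comult C) id (comult C x)) =
     box_map C (box C C) id (comult C) (comult C x))"

definition comonoid :: "'a coalgebra \<Rightarrow> bool" where
  "comonoid C \<longleftrightarrow> V_coalgebra C \<and> prime_counital C \<and> coassociative C \<and>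
     sup_pres C (tensor C C) (tcomult C)"

definition pure_morphism :: "'a coalgebra \<Rightarrow> 'a coalgebra \<Rightarrow> ('a \<Rightarrow> 'a) \<Rightarrow> bool" where
  "pure_morphism C C' f \<longleftrightarrow> f \<in> acdl_hom C C' \<and>
     (\<forall>x\<in>carrier C. box_map C' C' f f (comult C x) = comult C' (f x)) \<and>
     (\<forall>x\<in>carrier C. counit C x = counit C' (f x))"

definition corel_morphism :: "'a coalgebra \<Rightarrow> 'a coalgebra \<Rightarrow> ('a \<Rightarrow> 'a) \<Rightarrow> bool" where
  "corel_morphism C C' \<rho> \<longleftrightarrow> \<rho> \<in> carrier C \<rightarrow>\<^sub>E carrier C' \<and> sup_pres C C' \<rho> \<and> \<rho> \<top>\<^bsub>C\<^esub> = \<top>\<^bsub>C'\<^esub> \<and>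
     (\<forall>x\<in>carrier C. tensor_map C' C' \<rho> \<rho> (tcomult C x) \<sqsubseteq>\<^bsub>tensor C' C'\<^esub> tcomult C' (\<rho> x)) \<and>
     (\<forall>x\<in>carrier C. counit C x \<sqsubseteq>\<^bsub>two\<^esub> counit C' (\<rho> x))"

definition Coalg :: "('a coalgebra, 'a \<Rightarrow> 'a) category" where
  "Coalg = \<lparr>Obj = {C. V_coalgebra C \<and> prime_counital C},
     Hom = (\<lambda>C C'. {f. pure_morphism C C' f}),
     Ident = (\<lambda>C. restrict id (carrier C)),
     Comp = (\<lambda>C C' C'' g f. compose (carrier C) g f)\<rparr>"

definition Comon :: "('a coalgebra, 'a \<Rightarrow> 'a) category" where
  "Comon = full_subcategory Coalg comonoid"

definition RelComon :: "('a coalgebra, 'a \<Rightarrow> 'a) category" where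
  "RelComon = \<lparr>Obj = {C. comonoid C},
     Hom = (\<lambda>C C'. {\<rho>. corel_morphism C C' \<rho>}),
     Ident = (\<lambda>C. restrict id (carrier C)),
     Comp = (\<lambda>C C' C'' g f. compose (carrier C) g f)\<rparr>"


section \<open>Residuation ACDLs\<close>

text \<open>
  \<open>lres R x z\<close> is \<open>x \ z\<close> and \<open>rres R z y\<close> is \<open>z / y\<close>.
\<close>

record 'a residuation = "'a gorder" +
  lres :: "'a \<Rightarrow> 'a \<Rightarrow> 'a"
  rres :: "'a \<Rightarrow> 'a \<Rightarrow> 'a"

text \<open>Turning joins into meets is preserving joins as a map into the dual order.\<close>

definition residuation_acdl :: "'a residuation \<Rightarrow> bool" where
  "residuation_acdl R \<longleftrightarrow> acdl R \<and> order_on_carrier R \<and>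
     lres R \<in> carrier R \<rightarrow>\<^sub>E carrier R \<rightarrow>\<^sub>E carrier R \<and>
     rres R \<in> carrier R \<rightarrow>\<^sub>E carrier R \<rightarrow>\<^sub>E carrier R \<and>
     (\<forall>x\<in>carrier R. inf_pres R R (\<lambda>z. lres R x z)) \<and>
     (\<forall>y\<in>carrier R. inf_pres R R (\<lambda>z. rres R z y)) \<and>
     (\<forall>z\<in>carrier R. sup_pres R (inv_gorder R) (\<lambda>x. lres R x z)) \<and>
     (\<forall>z\<in>carrier R. sup_pres R (inv_gorder R) (\<lambda>y. rres R z y)) \<and>
     (\<forall>a\<in>carrier R. \<forall>b\<in>carrier R. \<forall>c\<in>carrier R. b \<sqsubseteq>\<^bsub>R\<^esub> lres R a c \<longleftrightarrow> a \<sqsubseteq>\<^bsub>R\<^esub> rres R c b)"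

definition is_prime_unit :: "'a residuation \<Rightarrow> 'a \<Rightarrow> bool" where
  "is_prime_unit R e \<longleftrightarrow> completely_join_prime R e \<and>
     (\<forall>z\<in>carrier R. lres R e z = z \<and> rres R z e = z)"

definition prime_unital :: "'a residuation \<Rightarrow> bool" where
  "prime_unital R \<longleftrightarrow> (\<exists>e. is_prime_unit R e)"

text \<open>There is at most one prime unit in a residuation ACDL, so the unit is no part of the structure.\<close>

definition res_unit :: "'a residuation \<Rightarrow> 'a" where
  "res_unit R = (THE e. is_prime_unit R e)"

definition res_associative :: "'a residuation \<Rightarrow> bool" where
  "res_associative R \<longleftrightarrow> (\<forall>x\<in>carrier R. \<forall>y\<in>carrier R. \<forall>z\<in>carrier R.
     lres R x (rres R z y) = rres R (lres R x z) y)"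

definition res_pure :: "'a residuation \<Rightarrow> bool" where
  "res_pure R \<longleftrightarrow> (\<forall>p. completely_join_prime R p \<longrightarrow>
     sup_pres R R (\<lambda>z. lres R p z) \<and> sup_pres R R (\<lambda>z. rres R z p))"

definition derivation_acdl :: "'a residuation \<Rightarrow> bool" where
  "derivation_acdl R \<longleftrightarrow> residuation_acdl R \<and> res_pure R \<and> res_associative R \<and> prime_unital R"

definition res_morphism :: "'a residuation \<Rightarrow> 'a residuation \<Rightarrow> ('a \<Rightarrow> 'a) \<Rightarrow> bool" where
  "res_morphism R S f \<longleftrightarrow> f \<in> acdl_hom R S \<and>
     (\<forall>x\<in>carrier R. \<forall>z\<in>carrier R.
        f (lres R x z) \<sqsubseteq>\<^bsub>S\<^esub> lres S (f x) (f z) \<and> f (rres R z x) \<sqsubseteq>\<^bsub>S\<^esub> rres S (f z) (f x)) \<and>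
     (\<forall>y\<in>carrier S. \<forall>z\<in>carrier R. \<exists>x\<in>carrier R.
        y \<sqsubseteq>\<^bsub>S\<^esub> f x \<and> lres S y (f z) = f (lres R x z)) \<and>
     (\<forall>y\<in>carrier S. \<forall>z\<in>carrier R. \<exists>x\<in>carrier R.
        y \<sqsubseteq>\<^bsub>S\<^esub> f x \<and> rres S (f z) y = f (rres R z x)) \<and>
     (\<forall>x\<in>carrier R. res_unit R \<sqsubseteq>\<^bsub>R\<^esub> x \<longleftrightarrow> res_unit S \<sqsubseteq>\<^bsub>S\<^esub> f x)"

definition corel_res_morphism :: "'a residuation \<Rightarrow> 'a residuation \<Rightarrow> ('a \<Rightarrow> 'a) \<Rightarrow> bool" where
  "corel_res_morphism R S \<rho> \<longleftrightarrow> \<rho> \<in> carrier R \<rightarrow>\<^sub>E carrier S \<and> sup_pres R S \<rho> \<and> \<rho> \<top>\<^bsub>R\<^esub> = \<top>\<^bsub>S\<^esub> \<and>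
     (\<forall>x\<in>carrier R. \<forall>z\<in>carrier R. \<rho> (lres R x z) \<sqsubseteq>\<^bsub>S\<^esub> lres S (\<rho> x) (\<rho> z)) \<and>
     res_unit S \<sqsubseteq>\<^bsub>S\<^esub> \<rho> (res_unit R)"

definition ResACDL :: "('a residuation, 'a \<Rightarrow> 'a) category" where
  "ResACDL = \<lparr>Obj = {R. residuation_acdl R \<and> prime_unital R},
     Hom = (\<lambda>R S. {f. res_morphism R S f}),
     Ident = (\<lambda>R. restrict id (carrier R)),
     Comp = (\<lambda>R S T g f. compose (carrier R) g f)\<rparr>"

definition DerACDL :: "('a residuation, 'a \<Rightarrow> 'a) category" where
  "DerACDL = full_subcategory ResACDL derivation_acdl"

definition RelDerACDL :: "('a residuation, 'a \<Rightarrow> 'a) category" where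
  "RelDerACDL = \<lparr>Obj = {R. derivation_acdl R},
     Hom = (\<lambda>R S. {\<rho>. corel_res_morphism R S \<rho>}),
     Ident = (\<lambda>R. restrict id (carrier R)),
     Comp = (\<lambda>R S T g f. compose (carrier R) g f)\<rparr>"

end

theory Submission
  imports Defs
begin

text \<open>
  In an ACDL every element is a join of completely join-primes. Hence an element of
  \<open>D \<otimes> E\<close> is determined by the pure tensors \<open>a \<otimes> b\<close> below it, an element of
  \<open>D \<boxtimes> E\<close> by the elements \<open>d \<boxtimes> e\<close> above it, and \<open>\<omega>\<close> is the polarity of the
  relation \<open>a \<otimes> b \<le> d \<boxtimes> e \<longleftrightarrow> a \<le> d \<or> b \<le> e\<close>.
  A coalgebra \<open>\<gamma>\<close> and its residuals then encode the same ternary relation: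
  \<open>a \<otimes> b \<le> \<gamma> z\<close> iff \<open>b \<le> a \ z\<close> iff \<open>a \<le> z / b\<close>. Equivalently, there is a
  multiplication with \<open>a \<cdot> b \<le> z\<close> iff \<open>a \<otimes> b \<le> \<gamma> z\<close>. Under this dictionary pure
  morphisms are the \<open>f\<close> whose left adjoint preserves multiplication, coassociativity is
  associativity of the multiplication, and preservation of joins by \<open>\<gamma>\<close>, tested on pairs of
  completely join-primes, is purity. The isomorphisms are the identity on maps.
\<close>

section \<open>Lattices generated by completely join-prime elements\<close>

text \<open>The obstacle is that joins in \<open>tensor\<close> and meets in \<open>box\<close> are
  generated, not computed on sets, so the results of \<open>tensor_map\<close> and
  \<open>box_map\<close> are known only through their bounds. Identities are therefore proved by
  testing against elements that separate. The supply of these comes from one fact: each completely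
  join-prime \<open>p\<close> has a partner \<open>m\<close>, the largest element not above
  \<open>p\<close>, so that failing to be above \<open>p\<close> means being below \<open>m\<close>.
  Partners turn the primes of a lattice into primes of its dual, which lets statements on
  \<boxtimes> be read off those on \<otimes> for the duals, and singleton copolars of partner pairs
  serve as test elements of \<otimes>. The defining equations of coalgebras live in \<boxtimes>,
  where a larger set is a smaller element; copolars move them to \<otimes>, where membership in
  \<open>tcomult C z\<close> is the ternary relation. Left adjoints enter in order to move test
  elements from the target of a map to its source.\<close>

lemma le_inf_iff:
  assumes "complete_lattice L" "A \<subseteq> carrier L" "s \<in> carrier L"
  shows "s \<sqsubseteq>\<^bsub>L\<^esub> \<Sqinter>\<^bsub>L\<^esub>A \<longleftrightarrow> (\<forall>a\<in>A. s \<sqsubseteq>\<^bsub>L\<^esub> a)"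
proof -
  interpret L: complete_lattice L by fact
  show ?thesis
    using assms(2,3) L.inf_lower L.inf_greatest L.inf_closed L.le_trans by (meson subsetD)
qed

lemma eq_by_lower_bounds:
  assumes "complete_lattice L" "x \<in> carrier L" "y \<in> carrier L"
    and "\<And>s. s \<in> carrier L \<Longrightarrow> s \<sqsubseteq>\<^bsub>L\<^esub> x \<longleftrightarrow> s \<sqsubseteq>\<^bsub>L\<^esub> y"
  shows "x = y"
proof -
  interpret L: complete_lattice L by fact
  show ?thesis using assms(2-4) L.le_refl L.le_antisym by blast
qed

text \<open>The locale facts with the lattice as an explicit argument: the proofs below keep
  switching between a lattice, its dual and its tensor products.\<close>

lemma
  assumes "complete_lattice L"
  shows complete_lattice_refl: "x \<in> carrier L \<Longrightarrow> x \<sqsubseteq>\<^bsub>L\<^esub> x"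
    and complete_lattice_trans: "x \<sqsubseteq>\<^bsub>L\<^esub> y \<Longrightarrow> y \<sqsubseteq>\<^bsub>L\<^esub> z \<Longrightarrow>
      x \<in> carrier L \<Longrightarrow> y \<in> carrier L \<Longrightarrow> z \<in> carrier L \<Longrightarrow> x \<sqsubseteq>\<^bsub>L\<^esub> z"
    and complete_lattice_sup_closed: "A \<subseteq> carrier L \<Longrightarrow> \<Squnion>\<^bsub>L\<^esub>A \<in> carrier L"
    and complete_lattice_inf_closed: "A \<subseteq> carrier L \<Longrightarrow> \<Sqinter>\<^bsub>L\<^esub>A \<in> carrier L"
    and complete_lattice_bottom: "\<bottom>\<^bsub>L\<^esub> \<in> carrier L" "x \<in> carrier L \<Longrightarrow> \<bottom>\<^bsub>L\<^esub> \<sqsubseteq>\<^bsub>L\<^esub> x"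
    and complete_lattice_top: "\<top>\<^bsub>L\<^esub> \<in> carrier L" "x \<in> carrier L \<Longrightarrow> x \<sqsubseteq>\<^bsub>L\<^esub> \<top>\<^bsub>L\<^esub>"
    and complete_lattice_sup_pair: "x \<sqsubseteq>\<^bsub>L\<^esub> y \<Longrightarrow> x \<in> carrier L \<Longrightarrow> y \<in> carrier L \<Longrightarrow>
      \<Squnion>\<^bsub>L\<^esub>{x, y} = y"
proof -
  interpret L: complete_lattice L by fact
  show "x \<in> carrier L \<Longrightarrow> x \<sqsubseteq>\<^bsub>L\<^esub> x" by simp
  show "x \<sqsubseteq>\<^bsub>L\<^esub> y \<Longrightarrow> y \<sqsubseteq>\<^bsub>L\<^esub> z \<Longrightarrow> x \<in> carrier L \<Longrightarrow> y \<in> carrier L \<Longrightarrow> z \<in> carrier L \<Longrightarrow>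
    x \<sqsubseteq>\<^bsub>L\<^esub> z" by (rule L.le_trans)
  show "A \<subseteq> carrier L \<Longrightarrow> \<Squnion>\<^bsub>L\<^esub>A \<in> carrier L" by simp
  show "A \<subseteq> carrier L \<Longrightarrow> \<Sqinter>\<^bsub>L\<^esub>A \<in> carrier L" by simp
  show "\<bottom>\<^bsub>L\<^esub> \<in> carrier L" "x \<in> carrier L \<Longrightarrow> \<bottom>\<^bsub>L\<^esub> \<sqsubseteq>\<^bsub>L\<^esub> x" by simp_all
  show "\<top>\<^bsub>L\<^esub> \<in> carrier L" "x \<in> carrier L \<Longrightarrow> x \<sqsubseteq>\<^bsub>L\<^esub> \<top>\<^bsub>L\<^esub>" by simp_all
  show "\<Squnion>\<^bsub>L\<^esub>{x, y} = y" if "x \<sqsubseteq>\<^bsub>L\<^esub> y" "x \<in> carrier L" "y \<in> carrier L"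
  proof (rule L.le_antisym)
    show "\<Squnion>\<^bsub>L\<^esub>{x, y} \<sqsubseteq>\<^bsub>L\<^esub> y" using that by (intro L.sup_least) auto
    show "y \<sqsubseteq>\<^bsub>L\<^esub> \<Squnion>\<^bsub>L\<^esub>{x, y}" using that by (intro L.sup_upper) auto
  qed (use that in auto)
qed

lemma complete_lattice_inf_pair:
  assumes "complete_lattice L" "x \<sqsubseteq>\<^bsub>L\<^esub> y" "x \<in> carrier L" "y \<in> carrier L"
  shows "\<Sqinter>\<^bsub>L\<^esub>{y, x} = x"
  using complete_lattice_sup_pair[of "inv_gorder L" y x] assms
  by (simp add: complete_lattice_dual_iff)

lemma complete_lattice_sup_upper:
  assumes "complete_lattice L" "A \<subseteq> carrier L" "x \<in> A"
  shows "x \<sqsubseteq>\<^bsub>L\<^esub> \<Squnion>\<^bsub>L\<^esub>A"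
proof -
  interpret L: complete_lattice L by fact
  show ?thesis using assms(2,3) by (rule L.sup_upper)
qed

text \<open>Equivalent to every element being a join of completely join-primes. The form by
  separation passes directly to the order dual.\<close>

definition prime_generated :: "('a, 'z) gorder_scheme \<Rightarrow> bool" where
  "prime_generated L \<longleftrightarrow> complete_lattice L \<and>
     (\<forall>a\<in>carrier L. \<forall>b\<in>carrier L. \<not> a \<sqsubseteq>\<^bsub>L\<^esub> b \<longrightarrow>
        (\<exists>p. completely_join_prime L p \<and> p \<sqsubseteq>\<^bsub>L\<^esub> a \<and> \<not> p \<sqsubseteq>\<^bsub>L\<^esub> b))"

text \<open>
  By complete distributivity a compact \<open>k\<close> is a join of elements \<open>x\<close> totally below \<open>k\<close>, hence of
  finitely many. The members of such a join of minimal length are completely join-prime.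
\<close>

lemma prime_below_compact:
  assumes cd: "completely_distributive L" and k: "compact_element L k"
    and b: "b \<in> carrier L" and kb: "\<not> k \<sqsubseteq>\<^bsub>L\<^esub> b"
  obtains p where "completely_join_prime L p" "p \<sqsubseteq>\<^bsub>L\<^esub> k" "\<not> p \<sqsubseteq>\<^bsub>L\<^esub> b"
proof -
  have cl: "complete_lattice L" using cd by (simp add: completely_distributive_def)
  interpret L: complete_lattice L by (rule cl)
  have kL: "k \<in> carrier L" using k by (simp add: compact_element_def)
  \<comment> \<open>Complete distributivity is applied to the family of all sets whose join is above
    \<open>k\<close>. Its meet of joins is above \<open>k\<close>, and each member of
    \<open>S\<close>, from the other side of the law, lies below some element of every such
    set.\<close>
  define \<A> where "\<A> = {A. A \<subseteq> carrier L \<and> k \<sqsubseteq>\<^bsub>L\<^esub> \<Squnion>\<^bsub>L\<^esub>A}"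
  define S where "S = (\<lambda>B. \<Sqinter>\<^bsub>L\<^esub>B) ` {f ` \<A> |f. \<forall>A\<in>\<A>. f A \<in> A}"
  have img: "f ` \<A> \<subseteq> carrier L" if "\<forall>A\<in>\<A>. f A \<in> A" for f
    using that by (auto simp: \<A>_def)
  have SL: "S \<subseteq> carrier L" unfolding S_def using img by (auto intro!: L.inf_closed)
  have totally: "\<exists>a\<in>A. x \<sqsubseteq>\<^bsub>L\<^esub> a" if x: "x \<in> S" and "A \<subseteq> carrier L" "k \<sqsubseteq>\<^bsub>L\<^esub> \<Squnion>\<^bsub>L\<^esub>A" for x A
  proof -
    obtain f where f: "\<forall>A\<in>\<A>. f A \<in> A" "x = \<Sqinter>\<^bsub>L\<^esub>(f ` \<A>)" using x by (auto simp: S_def)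
    have "A \<in> \<A>" using that by (simp add: \<A>_def)
    then show ?thesis using f L.inf_lower[OF img[OF f(1)]] by blast
  qed
  have "\<A> \<subseteq> Pow (carrier L)" by (auto simp: \<A>_def)
  then have "\<Sqinter>\<^bsub>L\<^esub>((\<lambda>A. \<Squnion>\<^bsub>L\<^esub>A) ` \<A>) = \<Squnion>\<^bsub>L\<^esub>S"
    using cd unfolding completely_distributive_def S_def by blast
  moreover have "k \<sqsubseteq>\<^bsub>L\<^esub> \<Sqinter>\<^bsub>L\<^esub>((\<lambda>A. \<Squnion>\<^bsub>L\<^esub>A) ` \<A>)"
    using kL by (intro L.inf_greatest) (auto simp: \<A>_def)
  ultimately have "\<exists>F\<subseteq>S. finite F \<and> k \<sqsubseteq>\<^bsub>L\<^esub> \<Squnion>\<^bsub>L\<^esub>F"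
    using k SL by (auto simp: compact_element_def)
  then obtain n where "\<exists>F\<subseteq>S. finite F \<and> k \<sqsubseteq>\<^bsub>L\<^esub> \<Squnion>\<^bsub>L\<^esub>F \<and> card F = n" by blast
  then obtain F where F: "F \<subseteq> S" "finite F" "k \<sqsubseteq>\<^bsub>L\<^esub> \<Squnion>\<^bsub>L\<^esub>F"
    and min: "\<And>G. G \<subseteq> S \<Longrightarrow> finite G \<Longrightarrow> k \<sqsubseteq>\<^bsub>L\<^esub> \<Squnion>\<^bsub>L\<^esub>G \<Longrightarrow> card F \<le> card G"
    using exists_least_iff[of "\<lambda>n. \<exists>F\<subseteq>S. finite F \<and> k \<sqsubseteq>\<^bsub>L\<^esub> \<Squnion>\<^bsub>L\<^esub>F \<and> card F = n"]
    by (metis leI)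
  have FL: "F \<subseteq> carrier L" using F SL by blast
  have prime: "completely_join_prime L x" if x: "x \<in> F" for x
    unfolding completely_join_prime_def
  proof (intro conjI allI impI)
    show "x \<in> carrier L" using x FL by blast
    fix A assume A: "A \<subseteq> carrier L" "x \<sqsubseteq>\<^bsub>L\<^esub> \<Squnion>\<^bsub>L\<^esub>A"
    have AF: "A \<union> (F - {x}) \<subseteq> carrier L" using A FL by blast
    have "y \<sqsubseteq>\<^bsub>L\<^esub> \<Squnion>\<^bsub>L\<^esub>(A \<union> (F - {x}))" if y: "y \<in> F" for y
    proof (cases "y = x")
      case True
      have "\<Squnion>\<^bsub>L\<^esub>A \<sqsubseteq>\<^bsub>L\<^esub> \<Squnion>\<^bsub>L\<^esub>(A \<union> (F - {x}))"
        using A AF by (intro L.sup_least L.sup_upper) auto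
      with A AF True FL y show ?thesis
        by (meson L.le_trans L.sup_closed subsetD)
    next
      case False
      with y AF show ?thesis by (intro L.sup_upper) auto
    qed
    then have "\<Squnion>\<^bsub>L\<^esub>F \<sqsubseteq>\<^bsub>L\<^esub> \<Squnion>\<^bsub>L\<^esub>(A \<union> (F - {x}))"
      using AF FL by (intro L.sup_least) auto
    then have "k \<sqsubseteq>\<^bsub>L\<^esub> \<Squnion>\<^bsub>L\<^esub>(A \<union> (F - {x}))"
      using F(3) kL FL AF by (meson L.le_trans L.sup_closed)
    \<comment> \<open>\<open>x\<close> is totally below \<open>k\<close>, so covering
      \<open>k\<close> by \<open>A\<close> and the other members of \<open>F\<close> puts
      \<open>x\<close> below one of these elements.\<close>
    then obtain a where a: "a \<in> A \<union> (F - {x})" "x \<sqsubseteq>\<^bsub>L\<^esub> a"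
      using totally AF x F(1) by blast
    show "\<exists>a\<in>A. x \<sqsubseteq>\<^bsub>L\<^esub> a"
    proof (cases "a \<in> A")
      case False
      \<comment> \<open>Here \<open>a\<close> is another member of \<open>F\<close>, so
        \<open>x\<close> is redundant in the join and \<open>F - {x}\<close> would be a shorter
        cover of \<open>k\<close>.\<close>
      have sub: "F - {x} \<subseteq> carrier L" using FL by blast
      have "y \<sqsubseteq>\<^bsub>L\<^esub> \<Squnion>\<^bsub>L\<^esub>(F - {x})" if y: "y \<in> F" for y
      proof (cases "y = x")
        case True
        have "a \<sqsubseteq>\<^bsub>L\<^esub> \<Squnion>\<^bsub>L\<^esub>(F - {x})" using False a sub by (intro L.sup_upper) auto
        with True a sub False x FL show ?thesis by (meson L.le_trans L.sup_closed UnE subsetD)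
      next
        case False
        with y sub show ?thesis by (intro L.sup_upper) auto
      qed
      then have "\<Squnion>\<^bsub>L\<^esub>F \<sqsubseteq>\<^bsub>L\<^esub> \<Squnion>\<^bsub>L\<^esub>(F - {x})"
        using sub FL by (intro L.sup_least) auto
      then have "k \<sqsubseteq>\<^bsub>L\<^esub> \<Squnion>\<^bsub>L\<^esub>(F - {x})"
        using F(3) kL FL sub by (meson L.le_trans L.sup_closed)
      with min[of "F - {x}"] F have "card F \<le> card (F - {x})" by blast
      with x F show ?thesis by (metis card_Diff1_less linorder_not_less)
    qed (use a in blast)
  qed
  have "\<exists>x\<in>F. \<not> x \<sqsubseteq>\<^bsub>L\<^esub> b"
  proof (rule ccontr)
    assume "\<not> ?thesis"
    then have "\<Squnion>\<^bsub>L\<^esub>F \<sqsubseteq>\<^bsub>L\<^esub> b" using FL b by (intro L.sup_least) auto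
    with F(3) kL b FL kb show False by (meson L.le_trans L.sup_closed)
  qed
  then obtain x where x: "x \<in> F" "\<not> x \<sqsubseteq>\<^bsub>L\<^esub> b" by blast
  \<comment> \<open>Totally below implies below: \<open>{k}\<close> is one of the covering
    sets.\<close>
  have "k \<sqsubseteq>\<^bsub>L\<^esub> \<Squnion>\<^bsub>L\<^esub>{k}" using kL by simp
  then have "x \<sqsubseteq>\<^bsub>L\<^esub> k" using totally[of x "{k}"] x F(1) kL by blast
  then show thesis using that prime[OF x(1)] x(2) by blast
qed

lemma acdl_prime_generated:
  assumes "acdl L"
  shows "prime_generated L"
  unfolding prime_generated_def
proof (intro conjI ballI impI)
  have alg: "algebraic_lattice L" and cd: "completely_distributive L"
    using assms by (simp_all add: acdl_def)
  show cl: "complete_lattice L" using alg by (simp add: algebraic_lattice_def)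
  interpret L: complete_lattice L by (rule cl)
  fix a b assume ab: "a \<in> carrier L" "b \<in> carrier L" "\<not> a \<sqsubseteq>\<^bsub>L\<^esub> b"
  let ?K = "{k. compact_element L k \<and> k \<sqsubseteq>\<^bsub>L\<^esub> a}"
  have "a = \<Squnion>\<^bsub>L\<^esub>?K" using alg ab by (simp add: algebraic_lattice_def)
  moreover have "?K \<subseteq> carrier L" by (auto simp: compact_element_def)
  ultimately obtain k where k: "k \<in> ?K" "\<not> k \<sqsubseteq>\<^bsub>L\<^esub> b"
    using ab sup_le_iff[OF cl, of ?K b] by auto
  then obtain p where p: "completely_join_prime L p" "p \<sqsubseteq>\<^bsub>L\<^esub> k" "\<not> p \<sqsubseteq>\<^bsub>L\<^esub> b"
    using prime_below_compact[OF cd] ab(2) by blast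
  then have "p \<sqsubseteq>\<^bsub>L\<^esub> a"
    using k ab L.le_trans by (auto simp: compact_element_def completely_join_prime_def)
  with p show "\<exists>p. completely_join_prime L p \<and> p \<sqsubseteq>\<^bsub>L\<^esub> a \<and> \<not> p \<sqsubseteq>\<^bsub>L\<^esub> b" by blast
qed

lemma completely_join_prime_le_sup_iff:
  assumes L: "complete_lattice L" and q: "completely_join_prime L q" and A: "A \<subseteq> carrier L"
  shows "q \<sqsubseteq>\<^bsub>L\<^esub> \<Squnion>\<^bsub>L\<^esub>A \<longleftrightarrow> (\<exists>a\<in>A. q \<sqsubseteq>\<^bsub>L\<^esub> a)"
proof
  assume "\<exists>a\<in>A. q \<sqsubseteq>\<^bsub>L\<^esub> a"
  then obtain a where a: "a \<in> A" "q \<sqsubseteq>\<^bsub>L\<^esub> a" by blast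
  have "q \<in> carrier L" "a \<in> carrier L" using q a A by (auto simp: completely_join_prime_def)
  then show "q \<sqsubseteq>\<^bsub>L\<^esub> \<Squnion>\<^bsub>L\<^esub>A"
    using complete_lattice_trans[OF L a(2) complete_lattice_sup_upper[OF L A a(1)] _ _
      complete_lattice_sup_closed[OF L A]] by simp
qed (use q A in \<open>simp add: completely_join_prime_def\<close>)

text \<open>The partner is the join of all elements not above \<open>p\<close>; primality keeps
  \<open>p\<close> from being below this join. The principal filter of \<open>p\<close> and the
  principal ideal of \<open>m\<close> thus partition the carrier.\<close>

lemma completely_join_prime_complement:
  assumes cl: "complete_lattice L" and p: "completely_join_prime L p"
  obtains m where "m \<in> carrier L" "\<And>x. x \<in> carrier L \<Longrightarrow> p \<sqsubseteq>\<^bsub>L\<^esub> x \<longleftrightarrow> \<not> x \<sqsubseteq>\<^bsub>L\<^esub> m"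
proof
  interpret L: complete_lattice L by (rule cl)
  let ?A = "{x \<in> carrier L. \<not> p \<sqsubseteq>\<^bsub>L\<^esub> x}"
  have A: "?A \<subseteq> carrier L" by blast
  show mL: "\<Squnion>\<^bsub>L\<^esub>?A \<in> carrier L" using A by (rule L.sup_closed)
  have pL: "p \<in> carrier L" using p by (simp add: completely_join_prime_def)
  have pm: "\<not> p \<sqsubseteq>\<^bsub>L\<^esub> \<Squnion>\<^bsub>L\<^esub>?A" using p A unfolding completely_join_prime_def by blast
  fix x assume x: "x \<in> carrier L"
  show "p \<sqsubseteq>\<^bsub>L\<^esub> x \<longleftrightarrow> \<not> x \<sqsubseteq>\<^bsub>L\<^esub> \<Squnion>\<^bsub>L\<^esub>?A"
  proof
    show "\<not> x \<sqsubseteq>\<^bsub>L\<^esub> \<Squnion>\<^bsub>L\<^esub>?A" if "p \<sqsubseteq>\<^bsub>L\<^esub> x"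
      using that pm L.le_trans pL x mL by blast
    show "p \<sqsubseteq>\<^bsub>L\<^esub> x" if "\<not> x \<sqsubseteq>\<^bsub>L\<^esub> \<Squnion>\<^bsub>L\<^esub>?A"
      using that L.sup_upper[OF A] x by blast
  qed
qed

text \<open>If a completely join-prime separates \<open>b\<close> from \<open>a\<close>, its partner
  is a completely join-prime of the dual that separates \<open>a\<close> from
  \<open>b\<close>.\<close>

lemma prime_generated_dual:
  assumes "prime_generated L"
  shows "prime_generated (inv_gorder L)"
proof -
  have cl: "complete_lattice L" using assms by (simp add: prime_generated_def)
  have "\<exists>m. completely_join_prime (inv_gorder L) m \<and> a \<sqsubseteq>\<^bsub>L\<^esub> m \<and> \<not> b \<sqsubseteq>\<^bsub>L\<^esub> m"
    if ab: "a \<in> carrier L" "b \<in> carrier L" "\<not> b \<sqsubseteq>\<^bsub>L\<^esub> a" for a b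
  proof -
    obtain p where p: "completely_join_prime L p" "p \<sqsubseteq>\<^bsub>L\<^esub> b" "\<not> p \<sqsubseteq>\<^bsub>L\<^esub> a"
      using assms ab by (auto simp: prime_generated_def)
    obtain m where m: "m \<in> carrier L" "\<And>x. x \<in> carrier L \<Longrightarrow> p \<sqsubseteq>\<^bsub>L\<^esub> x \<longleftrightarrow> \<not> x \<sqsubseteq>\<^bsub>L\<^esub> m"
      using completely_join_prime_complement[OF cl p(1)] by blast
    have "\<exists>a\<in>A. a \<sqsubseteq>\<^bsub>L\<^esub> m" if A: "A \<subseteq> carrier L" "\<Sqinter>\<^bsub>L\<^esub>A \<sqsubseteq>\<^bsub>L\<^esub> m" for A
    proof -
      have "\<not> p \<sqsubseteq>\<^bsub>L\<^esub> \<Sqinter>\<^bsub>L\<^esub>A" using m A complete_lattice_inf_closed[OF cl] by blast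
      then have "\<exists>a\<in>A. \<not> p \<sqsubseteq>\<^bsub>L\<^esub> a"
        using le_inf_iff[OF cl A(1)] p(1) by (auto simp: completely_join_prime_def)
      then show ?thesis using m(2) A(1) by blast
    qed
    then have "completely_join_prime (inv_gorder L) m"
      using m(1) by (simp add: completely_join_prime_def)
    with m p ab show ?thesis by blast
  qed
  with cl show ?thesis by (simp add: prime_generated_def complete_lattice_dual_iff)
qed

text \<open>Since \<open>a\<close> is the join of the completely join-primes below it, a set closed
  under joins that misses \<open>a\<close> misses one of them. This reduces membership questions in
  a tensor product to primes.\<close>

lemma prime_generated_witness:
  assumes L: "prime_generated L" and a: "a \<in> carrier L" "a \<notin> S"
    and S: "\<And>A. A \<subseteq> carrier L \<Longrightarrow> A \<subseteq> S \<Longrightarrow> \<Squnion>\<^bsub>L\<^esub>A \<in> S"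
  obtains p where "completely_join_prime L p" "p \<in> carrier L" "p \<sqsubseteq>\<^bsub>L\<^esub> a" "p \<notin> S"
proof -
  have cl: "complete_lattice L" using L by (simp add: prime_generated_def)
  interpret L: complete_lattice L by (rule cl)
  let ?P = "{p. completely_join_prime L p \<and> p \<sqsubseteq>\<^bsub>L\<^esub> a}"
  have P: "?P \<subseteq> carrier L" by (auto simp: completely_join_prime_def)
  have "\<Squnion>\<^bsub>L\<^esub>?P \<sqsubseteq>\<^bsub>L\<^esub> a" using P a by (auto intro: L.sup_least)
  moreover have "a \<sqsubseteq>\<^bsub>L\<^esub> \<Squnion>\<^bsub>L\<^esub>?P"
  proof (rule ccontr)
    assume "\<not> ?thesis"
    then obtain p where "p \<in> ?P" "\<not> p \<sqsubseteq>\<^bsub>L\<^esub> \<Squnion>\<^bsub>L\<^esub>?P"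
      using L a(1) L.sup_closed[OF P] unfolding prime_generated_def by blast
    with L.sup_upper[OF P] show False by blast
  qed
  ultimately have "\<Squnion>\<^bsub>L\<^esub>?P = a" using a P L.le_antisym L.sup_closed by blast
  then have "\<not> ?P \<subseteq> S" using S[OF P] a(2) by metis
  with P that show thesis by blast
qed

section \<open>Polars and the isomorphism between the tensor products\<close>

text \<open>Dualizing twice cuts off the extra fields of a record; the joins of the truncated record
  are those of the original.\<close>

lemma sup_trunc [simp]: "\<Squnion>\<^bsub>\<lparr>carrier = carrier L, eq = eq L, le = le L\<rparr>\<^esub>A = \<Squnion>\<^bsub>L\<^esub>A"
  by (simp add: sup_def least_def Upper_def)

lemma tensor_dual_dual:
  "tensor (inv_gorder (inv_gorder D)) (inv_gorder (inv_gorder E)) = tensor D E"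
  by (simp add: tensor_def)

definition polar ::
  "('a, 'y) gorder_scheme \<Rightarrow> ('b, 'z) gorder_scheme \<Rightarrow> ('a \<times> 'b) set \<Rightarrow> ('a \<times> 'b) set" where
  "polar D E U = {(d, e). d \<in> carrier D \<and> e \<in> carrier E \<and>
     (\<forall>(a, b)\<in>U. a \<sqsubseteq>\<^bsub>D\<^esub> d \<or> b \<sqsubseteq>\<^bsub>E\<^esub> e)}"

definition copolar ::
  "('a, 'y) gorder_scheme \<Rightarrow> ('b, 'z) gorder_scheme \<Rightarrow> ('a \<times> 'b) set \<Rightarrow> ('a \<times> 'b) set" where
  "copolar D E V = {(a, b). a \<in> carrier D \<and> b \<in> carrier E \<and>
     (\<forall>(d, e)\<in>V. a \<sqsubseteq>\<^bsub>D\<^esub> d \<or> b \<sqsubseteq>\<^bsub>E\<^esub> e)}"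

text \<open>By this symmetry a fact on \<open>polar\<close> and \<otimes> yields one on
  \<open>copolar\<close> and \<boxtimes> when the lattices are instantiated with their
  duals.\<close>

lemma polar_dual [simp]: "polar (inv_gorder D) (inv_gorder E) = copolar D E"
  by (simp add: polar_def copolar_def fun_eq_iff)

lemma copolar_dual [simp]: "copolar (inv_gorder D) (inv_gorder E) = polar D E"
  by (simp add: polar_def copolar_def fun_eq_iff)

lemma polar_subset: "polar D E U \<subseteq> carrier D \<times> carrier E"
  by (auto simp: polar_def)

lemma tensor_subset: "U \<in> carrier (tensor D E) \<Longrightarrow> U \<subseteq> carrier D \<times> carrier E"
  by (simp add: tensor_def)

lemma tensor_sup_left:
  "U \<in> carrier (tensor D E) \<Longrightarrow> A \<subseteq> carrier D \<Longrightarrow> e \<in> carrier E \<Longrightarrow>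
    (\<Squnion>\<^bsub>D\<^esub>A, e) \<in> U \<longleftrightarrow> (\<forall>a\<in>A. (a, e) \<in> U)"
  by (simp add: tensor_def)

lemma tensor_sup_right:
  "U \<in> carrier (tensor D E) \<Longrightarrow> d \<in> carrier D \<Longrightarrow> B \<subseteq> carrier E \<Longrightarrow>
    (d, \<Squnion>\<^bsub>E\<^esub>B) \<in> U \<longleftrightarrow> (\<forall>b\<in>B. (d, b) \<in> U)"
  by (simp add: tensor_def)

text \<open>Downward closure is the join condition for the two-element sets \<open>{a', a}\<close>
  and \<open>{b', b}\<close>.\<close>

lemma tensor_downward:
  assumes D: "complete_lattice D" and E: "complete_lattice E" and U: "U \<in> carrier (tensor D E)"
    and ab: "(a, b) \<in> U" "a' \<sqsubseteq>\<^bsub>D\<^esub> a" "b' \<sqsubseteq>\<^bsub>E\<^esub> b" "a' \<in> carrier D" "b' \<in> carrier E"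
  shows "(a', b') \<in> U"
proof -
  have c: "a \<in> carrier D" "b \<in> carrier E" using tensor_subset[OF U] ab(1) by auto
  have "(\<Squnion>\<^bsub>D\<^esub>{a', a}, b) \<in> U" using complete_lattice_sup_pair[OF D] ab c by simp
  then have "(a', b) \<in> U" using tensor_sup_left[OF U, of "{a', a}" b] ab c by simp
  then have "(a', \<Squnion>\<^bsub>E\<^esub>{b', b}) \<in> U" using complete_lattice_sup_pair[OF E] ab c by simp
  then show ?thesis using tensor_sup_right[OF U, of a' "{b', b}"] ab c by simp
qed

text \<open>Disjunction with a fixed statement commutes with the universal quantifier over
  \<open>A\<close>, so meets in one variable pass through the alternative that defines the polar.
  The set \<open>U\<close> may be a singleton, which provides the test elements used below.\<close>

lemma polar_in_tensor_dual:
  assumes D: "complete_lattice D" and E: "complete_lattice E" and U: "U \<subseteq> carrier D \<times> carrier E"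
  shows "polar D E U \<in> carrier (tensor (inv_gorder D) (inv_gorder E))"
proof -
  have "(\<Sqinter>\<^bsub>D\<^esub>A, e) \<in> polar D E U \<longleftrightarrow> (\<forall>a\<in>A. (a, e) \<in> polar D E U)"
    if A: "A \<subseteq> carrier D" and e: "e \<in> carrier E" for A e
  proof -
    have "(\<forall>(x, y)\<in>U. x \<sqsubseteq>\<^bsub>D\<^esub> \<Sqinter>\<^bsub>D\<^esub>A \<or> y \<sqsubseteq>\<^bsub>E\<^esub> e) \<longleftrightarrow>
        (\<forall>(x, y)\<in>U. (\<forall>a\<in>A. x \<sqsubseteq>\<^bsub>D\<^esub> a) \<or> y \<sqsubseteq>\<^bsub>E\<^esub> e)"
      using U le_inf_iff[OF D A] by (intro ball_cong) auto
    also have "\<dots> \<longleftrightarrow> (\<forall>a\<in>A. \<forall>(x, y)\<in>U. x \<sqsubseteq>\<^bsub>D\<^esub> a \<or> y \<sqsubseteq>\<^bsub>E\<^esub> e)" by blast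
    finally show ?thesis
      using A e complete_lattice_inf_closed[OF D A] by (simp add: polar_def subset_iff)
  qed
  moreover have "(d, \<Sqinter>\<^bsub>E\<^esub>B) \<in> polar D E U \<longleftrightarrow> (\<forall>b\<in>B. (d, b) \<in> polar D E U)"
    if d: "d \<in> carrier D" and B: "B \<subseteq> carrier E" for d B
  proof -
    have "(\<forall>(x, y)\<in>U. x \<sqsubseteq>\<^bsub>D\<^esub> d \<or> y \<sqsubseteq>\<^bsub>E\<^esub> \<Sqinter>\<^bsub>E\<^esub>B) \<longleftrightarrow>
        (\<forall>(x, y)\<in>U. x \<sqsubseteq>\<^bsub>D\<^esub> d \<or> (\<forall>b\<in>B. y \<sqsubseteq>\<^bsub>E\<^esub> b))"
      using U le_inf_iff[OF E B] by (intro ball_cong) auto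
    also have "\<dots> \<longleftrightarrow> (\<forall>b\<in>B. \<forall>(x, y)\<in>U. x \<sqsubseteq>\<^bsub>D\<^esub> d \<or> y \<sqsubseteq>\<^bsub>E\<^esub> b)" by blast
    finally show ?thesis
      using B d complete_lattice_inf_closed[OF E B] by (simp add: polar_def subset_iff)
  qed
  ultimately show ?thesis unfolding tensor_def by (simp add: polar_subset)
qed

lemma copolar_in_tensor:
  assumes D: "complete_lattice D" and E: "complete_lattice E" and V: "V \<subseteq> carrier D \<times> carrier E"
  shows "copolar D E V \<in> carrier (tensor D E)"
  using polar_in_tensor_dual[of "inv_gorder D" "inv_gorder E" V] assms
  by (simp only: polar_dual tensor_dual_dual complete_lattice_dual_iff) simp

text \<open>For fixed \<open>b\<close> the elements \<open>x\<close> with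
  \<open>(x, b) \<in> U\<close> are closed under joins.\<close>

lemma tensor_prime_witness_left:
  assumes D: "prime_generated D" and U: "U \<in> carrier (tensor D E)"
    and ab: "a \<in> carrier D" "b \<in> carrier E" "(a, b) \<notin> U"
  obtains p where "completely_join_prime D p" "p \<in> carrier D" "p \<sqsubseteq>\<^bsub>D\<^esub> a" "(p, b) \<notin> U"
proof (rule prime_generated_witness[OF D ab(1)])
  show "a \<notin> {x. (x, b) \<in> U}" using ab(3) by simp
  show "\<Squnion>\<^bsub>D\<^esub>A \<in> {x. (x, b) \<in> U}" if "A \<subseteq> carrier D" "A \<subseteq> {x. (x, b) \<in> U}" for A
    using tensor_sup_left[OF U that(1) ab(2)] that(2) by blast
qed (use that in simp)

lemma tensor_prime_witness_right:
  assumes E: "prime_generated E" and U: "U \<in> carrier (tensor D E)"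
    and ab: "a \<in> carrier D" "b \<in> carrier E" "(a, b) \<notin> U"
  obtains q where "completely_join_prime E q" "q \<in> carrier E" "q \<sqsubseteq>\<^bsub>E\<^esub> b" "(a, q) \<notin> U"
proof (rule prime_generated_witness[OF E ab(2)])
  show "b \<notin> {x. (a, x) \<in> U}" using ab(3) by simp
  show "\<Squnion>\<^bsub>E\<^esub>B \<in> {x. (a, x) \<in> U}" if "B \<subseteq> carrier E" "B \<subseteq> {x. (a, x) \<in> U}" for B
    using tensor_sup_right[OF U ab(1) that(1)] that(2) by blast
qed (use that in simp)

lemma tensor_prime_witness:
  assumes D: "prime_generated D" and E: "prime_generated E" and U: "U \<in> carrier (tensor D E)"
    and ab: "a \<in> carrier D" "b \<in> carrier E" "(a, b) \<notin> U"
  obtains p q where "completely_join_prime D p" "p \<in> carrier D" "p \<sqsubseteq>\<^bsub>D\<^esub> a"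
    "completely_join_prime E q" "q \<in> carrier E" "q \<sqsubseteq>\<^bsub>E\<^esub> b" "(p, q) \<notin> U"
proof -
  obtain p where p: "completely_join_prime D p" "p \<in> carrier D" "p \<sqsubseteq>\<^bsub>D\<^esub> a" "(p, b) \<notin> U"
    using tensor_prime_witness_left[OF D U ab] .
  then obtain q where "completely_join_prime E q" "q \<in> carrier E" "q \<sqsubseteq>\<^bsub>E\<^esub> b" "(p, q) \<notin> U"
    using tensor_prime_witness_right[OF E U p(2) ab(2)] by blast
  with that p show thesis by blast
qed

text \<open>This is where prime generation enters the comparison of the two tensor products: a pair
  missing from \<open>U\<close> is separated from it by a pair of partners.\<close>

lemma copolar_polar:
  assumes D: "prime_generated D" and E: "prime_generated E" and U: "U \<in> carrier (tensor D E)"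
  shows "copolar D E (polar D E U) = U"
proof
  have cD: "complete_lattice D" and cE: "complete_lattice E"
    using D E by (simp_all add: prime_generated_def)
  show "U \<subseteq> copolar D E (polar D E U)"
    using tensor_subset[OF U] by (auto simp: polar_def copolar_def)
  show "copolar D E (polar D E U) \<subseteq> U"
  proof (rule subrelI, rule ccontr)
    fix a b assume ab: "(a, b) \<in> copolar D E (polar D E U)" "(a, b) \<notin> U"
    then have c: "a \<in> carrier D" "b \<in> carrier E" by (auto simp: copolar_def)
    obtain p q where p: "completely_join_prime D p" "p \<in> carrier D" "p \<sqsubseteq>\<^bsub>D\<^esub> a"
      and q: "completely_join_prime E q" "q \<in> carrier E" "q \<sqsubseteq>\<^bsub>E\<^esub> b" "(p, q) \<notin> U"
      using tensor_prime_witness[OF D E U c ab(2)] by blast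
    obtain m where m: "m \<in> carrier D" "\<And>x. x \<in> carrier D \<Longrightarrow> p \<sqsubseteq>\<^bsub>D\<^esub> x \<longleftrightarrow> \<not> x \<sqsubseteq>\<^bsub>D\<^esub> m"
      using completely_join_prime_complement[OF cD p(1)] by blast
    obtain n where n: "n \<in> carrier E" "\<And>x. x \<in> carrier E \<Longrightarrow> q \<sqsubseteq>\<^bsub>E\<^esub> x \<longleftrightarrow> \<not> x \<sqsubseteq>\<^bsub>E\<^esub> n"
      using completely_join_prime_complement[OF cE q(1)] by blast
    \<comment> \<open>A pair of \<open>U\<close> with neither component below its partner would have
      components above \<open>p\<close> and \<open>q\<close>, which would put \<open>(p, q)\<close>
      into \<open>U\<close>. On the other hand \<open>a\<close> is not below \<open>m\<close> and
      \<open>b\<close> is not below \<open>n\<close>.\<close>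
    have "(m, n) \<in> polar D E U"
      unfolding polar_def
    proof (clarsimp simp: m(1) n(1))
      fix x y assume xy: "(x, y) \<in> U" "\<not> y \<sqsubseteq>\<^bsub>E\<^esub> n"
      then have "x \<in> carrier D" "y \<in> carrier E" using tensor_subset[OF U] by auto
      then show "x \<sqsubseteq>\<^bsub>D\<^esub> m"
        using xy m(2) n(2) tensor_downward[OF cD cE U _ _ _ p(2) q(2)] q(4) by blast
    qed
    then show False using ab(1) m(2)[OF c(1)] n(2)[OF c(2)] p(3) q(3) by (auto simp: copolar_def)
  qed
qed

lemma polar_copolar:
  assumes "prime_generated D" "prime_generated E"
    and "V \<in> carrier (tensor (inv_gorder D) (inv_gorder E))"
  shows "polar D E (copolar D E V) = V"
  using copolar_polar[OF prime_generated_dual prime_generated_dual, OF assms]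
  by (simp only: polar_dual copolar_dual)

lemma polar_iff:
  assumes D: "complete_lattice D" and E: "complete_lattice E"
    and U: "U \<subseteq> carrier D \<times> carrier E" and d: "d \<in> carrier D" and e: "e \<in> carrier E"
  shows "(d, e) \<in> polar D E U \<longleftrightarrow> U \<subseteq> copolar D E {(d, e)}"
  using assms by (auto simp: polar_def copolar_def)

text \<open>A join of tensor elements is not a union, but \<open>(d, e)\<close> is in the polar of
  \<open>U\<close> iff \<open>U\<close> is below the tensor element
  \<open>copolar D E {(d, e)}\<close>, and a join is below an element iff all its members
  are.\<close>

lemma polar_sup:
  assumes D: "complete_lattice D" and E: "complete_lattice E"
    and \<U>: "\<U> \<subseteq> carrier (tensor D E)"
  shows "polar D E (\<Squnion>\<^bsub>tensor D E\<^esub>\<U>) =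
    {(d, e). d \<in> carrier D \<and> e \<in> carrier E \<and> (\<forall>U\<in>\<U>. (d, e) \<in> polar D E U)}"
proof -
  have T: "complete_lattice (tensor D E)" using D E by (rule complete_lattice_tensor)
  have sub: "\<Squnion>\<^bsub>tensor D E\<^esub>\<U> \<subseteq> carrier D \<times> carrier E"
    using tensor_subset[OF complete_lattice_sup_closed[OF T \<U>]] .
  have "(d, e) \<in> polar D E (\<Squnion>\<^bsub>tensor D E\<^esub>\<U>) \<longleftrightarrow> (\<forall>U\<in>\<U>. (d, e) \<in> polar D E U)"
    if de: "d \<in> carrier D" "e \<in> carrier E" for d e
  proof -
    have "copolar D E {(d, e)} \<in> carrier (tensor D E)"
      using copolar_in_tensor[OF D E] de by simp
    from sup_le_iff[OF T \<U> this]
    have "(d, e) \<in> polar D E (\<Squnion>\<^bsub>tensor D E\<^esub>\<U>) \<longleftrightarrow> (\<forall>U\<in>\<U>. U \<subseteq> copolar D E {(d, e)})"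
      using polar_iff[OF D E sub de] by simp
    also have "\<dots> \<longleftrightarrow> (\<forall>U\<in>\<U>. (d, e) \<in> polar D E U)"
      using polar_iff[OF D E tensor_subset de] \<U> by (meson subsetD)
    finally show ?thesis .
  qed
  then show ?thesis using polar_subset[of D E "\<Squnion>\<^bsub>tensor D E\<^esub>\<U>"] by auto
qed

lemma polar_pure_tensor:
  assumes D: "complete_lattice D" and E: "complete_lattice E"
    and ab: "a \<in> carrier D" "b \<in> carrier E"
  shows "polar D E (pure_tensor D E a b) =
    {(d, e). d \<in> carrier D \<and> e \<in> carrier E \<and> (a \<sqsubseteq>\<^bsub>D\<^esub> d \<or> b \<sqsubseteq>\<^bsub>E\<^esub> e)}"
proof -
  have sub: "pure_tensor D E a b \<subseteq> carrier D \<times> carrier E"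
    using tensor_subset[OF pure_tensor_closed[OF D E ab]] .
  have "(d, e) \<in> polar D E (pure_tensor D E a b) \<longleftrightarrow> a \<sqsubseteq>\<^bsub>D\<^esub> d \<or> b \<sqsubseteq>\<^bsub>E\<^esub> e"
    if de: "d \<in> carrier D" "e \<in> carrier E" for d e
  proof -
    have "copolar D E {(d, e)} \<in> carrier (tensor D E)"
      using copolar_in_tensor[OF D E] de by simp
    then show ?thesis
      using polar_iff[OF D E sub de] pure_tensor_le_iff[OF D E ab] ab by (simp add: copolar_def)
  qed
  then show ?thesis using polar_subset[of D E "pure_tensor D E a b"] by auto
qed

section \<open>Maps between tensor products, read through the polarity\<close>

lemma
  assumes D: "complete_lattice D" and E: "complete_lattice E"
    and fg: "\<And>a b. (a, b) \<in> U \<Longrightarrow> f a \<in> carrier D \<and> g b \<in> carrier E"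
  shows tensor_map_closed: "tensor_map D E f g U \<in> carrier (tensor D E)"
    and tensor_map_le_iff: "V \<in> carrier (tensor D E) \<Longrightarrow>
      tensor_map D E f g U \<subseteq> V \<longleftrightarrow> (\<forall>(a, b)\<in>U. (f a, g b) \<in> V)"
proof -
  have T: "complete_lattice (tensor D E)" using D E by (rule complete_lattice_tensor)
  have sub: "{pure_tensor D E (f a) (g b) |a b. (a, b) \<in> U} \<subseteq> carrier (tensor D E)"
    using pure_tensor_closed[OF D E] fg by blast
  show "tensor_map D E f g U \<in> carrier (tensor D E)"
    using complete_lattice_sup_closed[OF T sub] by (simp add: tensor_map_def tensor_lift_def)
  show "tensor_map D E f g U \<subseteq> V \<longleftrightarrow> (\<forall>(a, b)\<in>U. (f a, g b) \<in> V)"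
    if V: "V \<in> carrier (tensor D E)"
  proof -
    have "tensor_map D E f g U \<subseteq> V \<longleftrightarrow> (\<forall>(a, b)\<in>U. pure_tensor D E (f a) (g b) \<subseteq> V)"
      using sup_le_iff[OF T sub V] unfolding tensor_map_def tensor_lift_def le_tensor by blast
    also have "\<dots> \<longleftrightarrow> (\<forall>(a, b)\<in>U. (f a, g b) \<in> V)"
      using pure_tensor_le_iff[OF D E _ _ V] fg by blast
    finally show ?thesis .
  qed
qed

text \<open>The image under \<open>tensor_map\<close> is only generated by pure tensors, whereas its
  polar can be described elementwise.\<close>

lemma polar_tensor_map:
  assumes D: "complete_lattice D" and E: "complete_lattice E"
    and fg: "\<And>a b. (a, b) \<in> U \<Longrightarrow> f a \<in> carrier D \<and> g b \<in> carrier E"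
  shows "polar D E (tensor_map D E f g U) = {(d, e). d \<in> carrier D \<and> e \<in> carrier E \<and>
    (\<forall>(a, b)\<in>U. f a \<sqsubseteq>\<^bsub>D\<^esub> d \<or> g b \<sqsubseteq>\<^bsub>E\<^esub> e)}"
proof -
  have sub: "{pure_tensor D E (f a) (g b) |a b. (a, b) \<in> U} \<subseteq> carrier (tensor D E)"
    using pure_tensor_closed[OF D E] fg by blast
  have "(\<forall>V\<in>{pure_tensor D E (f a) (g b) |a b. (a, b) \<in> U}. (d, e) \<in> polar D E V) \<longleftrightarrow>
      (\<forall>(a, b)\<in>U. f a \<sqsubseteq>\<^bsub>D\<^esub> d \<or> g b \<sqsubseteq>\<^bsub>E\<^esub> e)" if "d \<in> carrier D" "e \<in> carrier E" for d e
  proof -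
    have "(\<forall>V\<in>{pure_tensor D E (f a) (g b) |a b. (a, b) \<in> U}. (d, e) \<in> polar D E V) \<longleftrightarrow>
        (\<forall>(a, b)\<in>U. (d, e) \<in> polar D E (pure_tensor D E (f a) (g b)))" by blast
    also have "\<dots> \<longleftrightarrow> (\<forall>(a, b)\<in>U. f a \<sqsubseteq>\<^bsub>D\<^esub> d \<or> g b \<sqsubseteq>\<^bsub>E\<^esub> e)"
      using polar_pure_tensor[OF D E] fg that by (intro ball_cong) auto
    finally show ?thesis .
  qed
  then show ?thesis
    unfolding tensor_map_def tensor_lift_def polar_sup[OF D E sub] by blast
qed

lemma copolar_box_map:
  assumes "complete_lattice D" "complete_lattice E"
    and "\<And>a b. (a, b) \<in> V \<Longrightarrow> f a \<in> carrier D \<and> g b \<in> carrier E"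
  shows "copolar D E (box_map D E f g V) = {(a, b). a \<in> carrier D \<and> b \<in> carrier E \<and>
    (\<forall>(d, e)\<in>V. a \<sqsubseteq>\<^bsub>D\<^esub> f d \<or> b \<sqsubseteq>\<^bsub>E\<^esub> g e)}"
  using polar_tensor_map[of "inv_gorder D" "inv_gorder E" V f g] assms
  unfolding box_map_def polar_dual complete_lattice_dual_iff by simp

lemma copolar_pure_box:
  assumes "complete_lattice D" "complete_lattice E" "d \<in> carrier D" "e \<in> carrier E"
  shows "copolar D E (pure_box D E d e) =
    {(a, b). a \<in> carrier D \<and> b \<in> carrier E \<and> (a \<sqsubseteq>\<^bsub>D\<^esub> d \<or> b \<sqsubseteq>\<^bsub>E\<^esub> e)}"
  using polar_pure_tensor[of "inv_gorder D" "inv_gorder E" d e] assms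
  unfolding pure_box_def polar_dual complete_lattice_dual_iff by simp

lemma copolar_inf_box:
  assumes "complete_lattice D" "complete_lattice E" "\<V> \<subseteq> carrier (box D E)"
  shows "copolar D E (\<Sqinter>\<^bsub>box D E\<^esub>\<V>) =
    {(a, b). a \<in> carrier D \<and> b \<in> carrier E \<and> (\<forall>V\<in>\<V>. (a, b) \<in> copolar D E V)}"
  using polar_sup[of "inv_gorder D" "inv_gorder E" \<V>] assms
  unfolding polar_dual complete_lattice_dual_iff carrier_box unfolding box_def inf_dual by simp

lemma complete_lattice_box:
  "complete_lattice D \<Longrightarrow> complete_lattice E \<Longrightarrow> complete_lattice (box D E)"
  unfolding box_def complete_lattice_dual_iff
  by (intro complete_lattice_tensor) (simp_all add: complete_lattice_dual_iff)

lemma le_box: "U \<sqsubseteq>\<^bsub>box D E\<^esub> V \<longleftrightarrow> V \<subseteq> U"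
  by (simp add: box_def)

lemma box_map_closed:
  assumes "complete_lattice D" "complete_lattice E"
    and "\<And>a b. (a, b) \<in> V \<Longrightarrow> f a \<in> carrier D \<and> g b \<in> carrier E"
  shows "box_map D E f g V \<in> carrier (box D E)"
  unfolding box_map_def carrier_box
  by (rule tensor_map_closed) (use assms in \<open>simp_all add: complete_lattice_dual_iff\<close>)

lemma pure_box_closed:
  assumes "complete_lattice D" "complete_lattice E" "d \<in> carrier D" "e \<in> carrier E"
  shows "pure_box D E d e \<in> carrier (box D E)"
  unfolding pure_box_def carrier_box
  by (rule pure_tensor_closed) (use assms in \<open>simp_all add: complete_lattice_dual_iff\<close>)

text \<open>Equations in \<boxtimes> are proved by comparing copolars, which will turn out to be the
  values of the inverse of \<open>omega\<close>.\<close>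

lemma copolar_inject:
  assumes "prime_generated D" "prime_generated E"
    and "V \<in> carrier (box D E)" "V' \<in> carrier (box D E)"
  shows "copolar D E V = copolar D E V' \<longleftrightarrow> V = V'"
  using polar_copolar[OF assms(1,2)] assms(3,4) by (metis carrier_box)

text \<open>The join conditions for empty sets force every pair with a bottom component into every
  tensor element. Adding these pairs to the rectangle below \<open>(d, e)\<close> already yields a
  tensor element.\<close>

lemma pure_tensor_eq:
  assumes D: "complete_lattice D" and E: "complete_lattice E"
    and de: "d \<in> carrier D" "e \<in> carrier E"
  shows "pure_tensor D E d e = {(a, b). a \<in> carrier D \<and> b \<in> carrier E \<and>
    (a \<sqsubseteq>\<^bsub>D\<^esub> d \<and> b \<sqsubseteq>\<^bsub>E\<^esub> e \<or> a \<sqsubseteq>\<^bsub>D\<^esub> \<bottom>\<^bsub>D\<^esub> \<or> b \<sqsubseteq>\<^bsub>E\<^esub> \<bottom>\<^bsub>E\<^esub>)}" (is "_ = ?P")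
proof
  have bot: "\<bottom>\<^bsub>D\<^esub> \<in> carrier D" "\<bottom>\<^bsub>E\<^esub> \<in> carrier E"
    using D E by (simp_all add: complete_lattice_bottom)
  have *: "a \<sqsubseteq>\<^bsub>D\<^esub> d" if "a \<sqsubseteq>\<^bsub>D\<^esub> \<bottom>\<^bsub>D\<^esub>" "a \<in> carrier D" for a
    using complete_lattice_trans[OF D that(1) _ that(2)] bot de complete_lattice_bottom(2)[OF D]
    by blast
  have **: "b \<sqsubseteq>\<^bsub>E\<^esub> e" if "b \<sqsubseteq>\<^bsub>E\<^esub> \<bottom>\<^bsub>E\<^esub>" "b \<in> carrier E" for b
    using complete_lattice_trans[OF E that(1) _ that(2)] bot de complete_lattice_bottom(2)[OF E]
    by blast
  have "(\<Squnion>\<^bsub>D\<^esub>A, b) \<in> ?P \<longleftrightarrow> (\<forall>a\<in>A. (a, b) \<in> ?P)"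
    if A: "A \<subseteq> carrier D" and b: "b \<in> carrier E" for A b
    using sup_le_iff[OF D A de(1)] sup_le_iff[OF D A bot(1)] A b *
      complete_lattice_sup_closed[OF D A] by (simp add: subset_iff) blast
  moreover have "(a, \<Squnion>\<^bsub>E\<^esub>B) \<in> ?P \<longleftrightarrow> (\<forall>b\<in>B. (a, b) \<in> ?P)"
    if a: "a \<in> carrier D" and B: "B \<subseteq> carrier E" for a B
    using sup_le_iff[OF E B de(2)] sup_le_iff[OF E B bot(2)] a B **
      complete_lattice_sup_closed[OF E B] by (simp add: subset_iff) blast
  ultimately have P: "?P \<in> carrier (tensor D E)" by (subst tensor_def) auto
  have "(d, e) \<in> ?P" using de complete_lattice_refl[OF D] complete_lattice_refl[OF E] by simp
  with P de show "pure_tensor D E d e \<subseteq> ?P" by (simp add: pure_tensor_le_iff[OF D E])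
  have cl: "pure_tensor D E d e \<in> carrier (tensor D E)" by (rule pure_tensor_closed[OF D E de])
  have mem: "(d, e) \<in> pure_tensor D E d e" using pure_tensor_le_iff[OF D E de cl] by simp
  have "(\<Squnion>\<^bsub>D\<^esub>{}, b) \<in> pure_tensor D E d e" if "b \<in> carrier E" for b
    using tensor_sup_left[OF cl, of "{}" b] that by simp
  moreover have "a \<sqsubseteq>\<^bsub>D\<^esub> \<Squnion>\<^bsub>D\<^esub>{}" if "a \<in> carrier D" "a \<sqsubseteq>\<^bsub>D\<^esub> \<bottom>\<^bsub>D\<^esub>" for a
    using complete_lattice_trans[OF D that(2) _ that(1) bot(1)]
      complete_lattice_bottom(2)[OF D] complete_lattice_sup_closed[OF D, of "{}"] by simp
  moreover have "(a, \<Squnion>\<^bsub>E\<^esub>{}) \<in> pure_tensor D E d e" if "a \<in> carrier D" for a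
    using tensor_sup_right[OF cl, of a "{}"] that by simp
  moreover have "b \<sqsubseteq>\<^bsub>E\<^esub> \<Squnion>\<^bsub>E\<^esub>{}" if "b \<in> carrier E" "b \<sqsubseteq>\<^bsub>E\<^esub> \<bottom>\<^bsub>E\<^esub>" for b
    using complete_lattice_trans[OF E that(2) _ that(1) bot(2)]
      complete_lattice_bottom(2)[OF E] complete_lattice_sup_closed[OF E, of "{}"] by simp
  ultimately have "(a, b) \<in> pure_tensor D E d e" if "(a, b) \<in> ?P" for a b
    using tensor_downward[OF D E cl, of _ _ a b] mem complete_lattice_refl[OF D, of a]
      complete_lattice_refl[OF E, of b] that
    by (elim CollectE case_prodE) (metis prod.inject)
  then show "?P \<subseteq> pure_tensor D E d e" by (rule subrelI)
qed

lemma order_iso_sup_pres: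
  assumes L: "complete_lattice L" and M: "complete_lattice M"
    and bij: "bij_betw f (carrier L) (carrier M)"
    and mono: "\<And>x y. x \<in> carrier L \<Longrightarrow> y \<in> carrier L \<Longrightarrow> f x \<sqsubseteq>\<^bsub>M\<^esub> f y \<longleftrightarrow> x \<sqsubseteq>\<^bsub>L\<^esub> y"
  shows "sup_pres L M f"
  unfolding sup_pres_def
proof (intro conjI allI impI)
  fix A assume A: "A \<subseteq> carrier L"
  have img: "f ` A \<subseteq> carrier M" using bij A by (auto simp: bij_betw_def)
  have sc: "\<Squnion>\<^bsub>L\<^esub>A \<in> carrier L" using complete_lattice_sup_closed[OF L A] .
  show "f (\<Squnion>\<^bsub>L\<^esub>A) = \<Squnion>\<^bsub>M\<^esub>(f ` A)"
  proof (rule eq_by_upper_bounds[OF M])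
    show "f (\<Squnion>\<^bsub>L\<^esub>A) \<in> carrier M" using sc bij by (auto simp: bij_betw_def)
    show "\<Squnion>\<^bsub>M\<^esub>(f ` A) \<in> carrier M" using complete_lattice_sup_closed[OF M img] .
    fix s assume s: "s \<in> carrier M"
    then obtain t where t: "t \<in> carrier L" "s = f t" using bij by (auto simp: bij_betw_def)
    have "(\<forall>a\<in>A. a \<sqsubseteq>\<^bsub>L\<^esub> t) \<longleftrightarrow> (\<forall>a\<in>A. f a \<sqsubseteq>\<^bsub>M\<^esub> s)" using t mono A by blast
    then show "f (\<Squnion>\<^bsub>L\<^esub>A) \<sqsubseteq>\<^bsub>M\<^esub> s \<longleftrightarrow> \<Squnion>\<^bsub>M\<^esub>(f ` A) \<sqsubseteq>\<^bsub>M\<^esub> s"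
      using sup_le_iff[OF M img s] sup_le_iff[OF L A t(1)] mono[OF sc t(1)] t by simp
  qed
qed (rule L M)+

lemma order_iso_inf_pres:
  assumes "complete_lattice L" "complete_lattice M"
    and "bij_betw f (carrier L) (carrier M)"
    and "\<And>x y. x \<in> carrier L \<Longrightarrow> y \<in> carrier L \<Longrightarrow> f x \<sqsubseteq>\<^bsub>M\<^esub> f y \<longleftrightarrow> x \<sqsubseteq>\<^bsub>L\<^esub> y"
  shows "inf_pres L M f"
  unfolding sup_pres_dual[symmetric]
  by (rule order_iso_sup_pres) (use assms in \<open>simp_all add: complete_lattice_dual_iff\<close>)

text \<open>A definite description requires existence and uniqueness. The polar is an order
  isomorphism with inverse \<open>copolar\<close>, hence preserves all joins and meets. Uniqueness
  holds because the two injections generate: \<open>d \<otimes> e\<close> is the meet of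
  \<open>d \<otimes> 1\<close> and \<open>1 \<otimes> e\<close>, and every element is a join of such
  meets.\<close>

lemma omega_eq:
  assumes D: "prime_generated D" and E: "prime_generated E"
  shows "omega D E = restrict (polar D E) (carrier (tensor D E))"
proof -
  have cD: "complete_lattice D" and cE: "complete_lattice E"
    using D E by (simp_all add: prime_generated_def)
  have T: "complete_lattice (tensor D E)" using cD cE by (rule complete_lattice_tensor)
  have B: "complete_lattice (box D E)" using cD cE by (rule complete_lattice_box)
  let ?w = "restrict (polar D E) (carrier (tensor D E))"
  have pc: "polar D E U \<in> carrier (box D E)" if "U \<in> carrier (tensor D E)" for U
    using polar_in_tensor_dual[OF cD cE tensor_subset[OF that]] by (simp add: carrier_box)
  have cc: "copolar D E V \<in> carrier (tensor D E)" if "V \<in> carrier (box D E)" for V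
    using copolar_in_tensor[OF cD cE] tensor_subset[of V "inv_gorder D" "inv_gorder E"] that
    by (simp add: carrier_box)
  have inv: "polar D E (copolar D E V) = V" if "V \<in> carrier (box D E)" for V
    using polar_copolar[OF D E] that by (simp add: carrier_box)
  have bij: "bij_betw ?w (carrier (tensor D E)) (carrier (box D E))"
    by (rule bij_betw_byWitness[of _ "copolar D E"]) (use pc cc inv copolar_polar[OF D E] in auto)
  have mono: "?w U \<sqsubseteq>\<^bsub>box D E\<^esub> ?w V \<longleftrightarrow> U \<sqsubseteq>\<^bsub>tensor D E\<^esub> V"
    if "U \<in> carrier (tensor D E)" "V \<in> carrier (tensor D E)" for U V
  proof -
    have "polar D E V \<subseteq> polar D E U" if "U \<subseteq> V" using that by (auto simp: polar_def)
    moreover have "copolar D E (polar D E U) \<subseteq> copolar D E (polar D E V)"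
      if "polar D E V \<subseteq> polar D E U" using that by (auto simp: copolar_def)
    ultimately show ?thesis using that copolar_polar[OF D E] by (auto simp: le_box)
  qed
  have bot: "\<bottom>\<^bsub>D\<^esub> \<in> carrier D" "\<bottom>\<^bsub>E\<^esub> \<in> carrier E" and top: "\<top>\<^bsub>D\<^esub> \<in> carrier D" "\<top>\<^bsub>E\<^esub> \<in> carrier E"
    using cD cE by (simp_all add: complete_lattice_bottom complete_lattice_top)
  let ?inj = "\<lambda>w. (\<forall>d\<in>carrier D. w (pure_tensor D E d \<top>\<^bsub>E\<^esub>) = pure_box D E d \<bottom>\<^bsub>E\<^esub>) \<and>
     (\<forall>e\<in>carrier E. w (pure_tensor D E \<top>\<^bsub>D\<^esub> e) = pure_box D E \<bottom>\<^bsub>D\<^esub> e)"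
  have dcl: "complete_lattice (inv_gorder D)" "complete_lattice (inv_gorder E)"
    using cD cE by (simp_all add: complete_lattice_dual_iff)
  \<comment> \<open>The explicit form of pure tensors, read in the duals: the clauses for bottom
    become clauses for top.\<close>
  have pb: "pure_box D E d e = {(a, b). a \<in> carrier D \<and> b \<in> carrier E \<and>
    (d \<sqsubseteq>\<^bsub>D\<^esub> a \<and> e \<sqsubseteq>\<^bsub>E\<^esub> b \<or> \<top>\<^bsub>D\<^esub> \<sqsubseteq>\<^bsub>D\<^esub> a \<or> \<top>\<^bsub>E\<^esub> \<sqsubseteq>\<^bsub>E\<^esub> b)}"
    if "d \<in> carrier D" "e \<in> carrier E" for d e
    using pure_tensor_eq[OF dcl, of d e] that by (simp add: pure_box_def)
  have top_above: "d \<sqsubseteq>\<^bsub>D\<^esub> a" if "\<top>\<^bsub>D\<^esub> \<sqsubseteq>\<^bsub>D\<^esub> a" "d \<in> carrier D" "a \<in> carrier D" for a d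
    using complete_lattice_trans[OF cD complete_lattice_top(2)[OF cD] that(1)] that top by blast
  have top_above': "e \<sqsubseteq>\<^bsub>E\<^esub> b" if "\<top>\<^bsub>E\<^esub> \<sqsubseteq>\<^bsub>E\<^esub> b" "e \<in> carrier E" "b \<in> carrier E" for b e
    using complete_lattice_trans[OF cE complete_lattice_top(2)[OF cE] that(1)] that top by blast
  have inj: "?inj ?w"
  proof (intro conjI ballI)
    fix d assume d: "d \<in> carrier D"
    show "?w (pure_tensor D E d \<top>\<^bsub>E\<^esub>) = pure_box D E d \<bottom>\<^bsub>E\<^esub>"
      using d top bot top_above
      by (auto simp: pb pure_tensor_closed[OF cD cE] polar_pure_tensor[OF cD cE]
          complete_lattice_bottom(2)[OF cE])
  next
    fix e assume e: "e \<in> carrier E"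
    show "?w (pure_tensor D E \<top>\<^bsub>D\<^esub> e) = pure_box D E \<bottom>\<^bsub>D\<^esub> e"
      using e top bot top_above'
      by (auto simp: pb pure_tensor_closed[OF cD cE] polar_pure_tensor[OF cD cE]
          complete_lattice_bottom(2)[OF cD])
  qed
  have hom: "?w \<in> acdl_hom (tensor D E) (box D E)"
    unfolding acdl_hom_def mem_Collect_eq restrict_PiE_iff
    using pc order_iso_sup_pres[OF T B bij] order_iso_inf_pres[OF T B bij] mono by blast
  have pure_inf: "pure_tensor D E d e =
      \<Sqinter>\<^bsub>tensor D E\<^esub>{pure_tensor D E d \<top>\<^bsub>E\<^esub>, pure_tensor D E \<top>\<^bsub>D\<^esub> e}"
    if de: "d \<in> carrier D" "e \<in> carrier E" for d e
  proof (rule eq_by_lower_bounds[OF T])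
    have sub: "{pure_tensor D E d \<top>\<^bsub>E\<^esub>, pure_tensor D E \<top>\<^bsub>D\<^esub> e} \<subseteq> carrier (tensor D E)"
      using pure_tensor_closed[OF cD cE] de top by simp
    show "pure_tensor D E d e \<in> carrier (tensor D E)" using pure_tensor_closed[OF cD cE de] .
    show "\<Sqinter>\<^bsub>tensor D E\<^esub>{pure_tensor D E d \<top>\<^bsub>E\<^esub>, pure_tensor D E \<top>\<^bsub>D\<^esub> e} \<in> carrier (tensor D E)"
      using complete_lattice_inf_closed[OF T sub] .
    have "pure_tensor D E d e = pure_tensor D E d \<top>\<^bsub>E\<^esub> \<inter> pure_tensor D E \<top>\<^bsub>D\<^esub> e"
      using de top complete_lattice_top(2)[OF cD] complete_lattice_top(2)[OF cE]
      by (auto simp: pure_tensor_eq[OF cD cE])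
    then show "U \<sqsubseteq>\<^bsub>tensor D E\<^esub> pure_tensor D E d e \<longleftrightarrow>
        U \<sqsubseteq>\<^bsub>tensor D E\<^esub> \<Sqinter>\<^bsub>tensor D E\<^esub>{pure_tensor D E d \<top>\<^bsub>E\<^esub>, pure_tensor D E \<top>\<^bsub>D\<^esub> e}"
      if "U \<in> carrier (tensor D E)" for U
      using le_inf_iff[OF T sub that] by simp
  qed
  \<comment> \<open>The value of any candidate at \<open>U\<close> is expressed by the prescribed
    values at the injections alone.\<close>
  have uniq: "w U = \<Squnion>\<^bsub>box D E\<^esub>{\<Sqinter>\<^bsub>box D E\<^esub>{pure_box D E d \<bottom>\<^bsub>E\<^esub>, pure_box D E \<bottom>\<^bsub>D\<^esub> e} |d e. (d, e) \<in> U}"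
    if w: "w \<in> acdl_hom (tensor D E) (box D E)" "?inj w" and U: "U \<in> carrier (tensor D E)" for w U
  proof -
    let ?P = "{pure_tensor D E d e |d e. (d, e) \<in> U}"
    have P: "?P \<subseteq> carrier (tensor D E)"
      using pure_tensor_closed[OF cD cE] tensor_subset[OF U] by blast
    have "w (pure_tensor D E d e) = \<Sqinter>\<^bsub>box D E\<^esub>{pure_box D E d \<bottom>\<^bsub>E\<^esub>, pure_box D E \<bottom>\<^bsub>D\<^esub> e}"
      if "(d, e) \<in> U" for d e
    proof -
      have de: "d \<in> carrier D" "e \<in> carrier E" using that tensor_subset[OF U] by auto
      have "{pure_tensor D E d \<top>\<^bsub>E\<^esub>, pure_tensor D E \<top>\<^bsub>D\<^esub> e} \<subseteq> carrier (tensor D E)"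
        using pure_tensor_closed[OF cD cE] de top by simp
      then show ?thesis
        using w de unfolding pure_inf[OF de] acdl_hom_def inf_pres_def by simp
    qed
    then have "w ` ?P =
        {\<Sqinter>\<^bsub>box D E\<^esub>{pure_box D E d \<bottom>\<^bsub>E\<^esub>, pure_box D E \<bottom>\<^bsub>D\<^esub> e} |d e. (d, e) \<in> U}"
      by (force simp: image_iff)
    moreover have "w (\<Squnion>\<^bsub>tensor D E\<^esub>?P) = \<Squnion>\<^bsub>box D E\<^esub>(w ` ?P)"
      using w(1) P unfolding acdl_hom_def sup_pres_def by blast
    ultimately show ?thesis using tensor_eq_sup_pure[OF cD cE U] by simp
  qed
  show ?thesis
    unfolding omega_def
  proof (rule the_equality)
    show "?w \<in> acdl_hom (tensor D E) (box D E) \<and>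
      bij_betw ?w (carrier (tensor D E)) (carrier (box D E)) \<and> ?inj ?w"
      using hom bij inj by blast
    fix w assume w: "w \<in> acdl_hom (tensor D E) (box D E) \<and>
      bij_betw w (carrier (tensor D E)) (carrier (box D E)) \<and> ?inj w"
    show "w = ?w"
    proof
      fix U
      show "w U = ?w U"
      proof (cases "U \<in> carrier (tensor D E)")
        case True
        have "w U = \<Squnion>\<^bsub>box D E\<^esub>
            {\<Sqinter>\<^bsub>box D E\<^esub>{pure_box D E d \<bottom>\<^bsub>E\<^esub>, pure_box D E \<bottom>\<^bsub>D\<^esub> e} |d e. (d, e) \<in> U}"
          by (rule uniq[OF _ _ True]) (use w in blast)+
        also have "\<dots> = ?w U" using uniq[OF hom inj True] by simp
        finally show ?thesis .
      next
        case False
        with w show ?thesis by (auto simp: acdl_hom_def PiE_def extensional_def)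
      qed
    qed
  qed
qed

section \<open>Coalgebras and residuations\<close>

text \<open>Preservation of meets tested on lower bounds, the form that suits residuals, since it is
  their lower bounds that are known.\<close>

lemma inf_pres_iff:
  assumes L: "complete_lattice L" and M: "complete_lattice M"
    and f: "\<And>x. x \<in> carrier L \<Longrightarrow> f x \<in> carrier M"
  shows "inf_pres L M f \<longleftrightarrow> (\<forall>A\<subseteq>carrier L. \<forall>b\<in>carrier M.
    b \<sqsubseteq>\<^bsub>M\<^esub> f (\<Sqinter>\<^bsub>L\<^esub>A) \<longleftrightarrow> (\<forall>a\<in>A. b \<sqsubseteq>\<^bsub>M\<^esub> f a))"
proof -
  have "f (\<Sqinter>\<^bsub>L\<^esub>A) = \<Sqinter>\<^bsub>M\<^esub>(f ` A) \<longleftrightarrow>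
      (\<forall>b\<in>carrier M. b \<sqsubseteq>\<^bsub>M\<^esub> f (\<Sqinter>\<^bsub>L\<^esub>A) \<longleftrightarrow> (\<forall>a\<in>A. b \<sqsubseteq>\<^bsub>M\<^esub> f a))" if A: "A \<subseteq> carrier L" for A
  proof -
    have img: "f ` A \<subseteq> carrier M" using f A by blast
    have "f (\<Sqinter>\<^bsub>L\<^esub>A) = \<Sqinter>\<^bsub>M\<^esub>(f ` A) \<longleftrightarrow>
        (\<forall>b\<in>carrier M. b \<sqsubseteq>\<^bsub>M\<^esub> f (\<Sqinter>\<^bsub>L\<^esub>A) \<longleftrightarrow> b \<sqsubseteq>\<^bsub>M\<^esub> \<Sqinter>\<^bsub>M\<^esub>(f ` A))"
      using eq_by_lower_bounds[OF M f[OF complete_lattice_inf_closed[OF L A]]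
        complete_lattice_inf_closed[OF M img]] by auto
    then show ?thesis using le_inf_iff[OF M img] by simp
  qed
  then show ?thesis using L M by (simp add: inf_pres_def)
qed

text \<open>Turning joins into meets is preserving meets as a map out of the dual lattice.\<close>

lemma sup_pres_dual_target_iff:
  assumes L: "complete_lattice L" and M: "complete_lattice M"
    and f: "\<And>x. x \<in> carrier L \<Longrightarrow> f x \<in> carrier M"
  shows "sup_pres L (inv_gorder M) f \<longleftrightarrow> (\<forall>A\<subseteq>carrier L. \<forall>b\<in>carrier M.
    b \<sqsubseteq>\<^bsub>M\<^esub> f (\<Squnion>\<^bsub>L\<^esub>A) \<longleftrightarrow> (\<forall>a\<in>A. b \<sqsubseteq>\<^bsub>M\<^esub> f a))"
proof -
  have "sup_pres L (inv_gorder M) f \<longleftrightarrow> inf_pres (inv_gorder L) M f"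
    by (simp add: sup_pres_def inf_pres_def complete_lattice_dual_iff)
  also have "\<dots> \<longleftrightarrow> (\<forall>A\<subseteq>carrier L. \<forall>b\<in>carrier M.
    b \<sqsubseteq>\<^bsub>M\<^esub> f (\<Squnion>\<^bsub>L\<^esub>A) \<longleftrightarrow> (\<forall>a\<in>A. b \<sqsubseteq>\<^bsub>M\<^esub> f a))"
    using inf_pres_iff[of "inv_gorder L" M f] assms by (simp add: complete_lattice_dual_iff)
  finally show ?thesis .
qed

text \<open>Coalgebras and residuations are different record extensions of the same ordered set, so
  the notions that depend on the order alone have to be carried across.\<close>

lemma
  assumes "carrier L = carrier M" "eq L = eq M" "le L = le M"
  shows sup_cong_order: "\<Squnion>\<^bsub>L\<^esub>A = \<Squnion>\<^bsub>M\<^esub>A"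
    and inf_cong_order: "\<Sqinter>\<^bsub>L\<^esub>A = \<Sqinter>\<^bsub>M\<^esub>A"
    and complete_lattice_cong_order: "complete_lattice L \<longleftrightarrow> complete_lattice M"
    and acdl_cong_order: "acdl L \<longleftrightarrow> acdl M"
    and completely_join_prime_cong_order: "completely_join_prime L = completely_join_prime M"
    and order_on_carrier_cong_order: "order_on_carrier L \<longleftrightarrow> order_on_carrier M"
    and tensor_cong_order: "tensor L L = tensor M M"
    and box_cong_order: "box L L = box M M"
proof -
  \<comment> \<open>\<open>inv_gorder\<close> forgets the extra fields, so the two duals are equal
    as records and the notions transfer through duality.\<close>
  have inv: "inv_gorder L = inv_gorder M" using assms by simp
  have s: "\<Squnion>\<^bsub>L\<^esub>A = \<Squnion>\<^bsub>M\<^esub>A" for A using inf_dual[of L A] inf_dual[of M A] inv by simp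
  have i: "\<Sqinter>\<^bsub>L\<^esub>A = \<Sqinter>\<^bsub>M\<^esub>A" for A using sup_dual[of L A] sup_dual[of M A] inv by simp
  have c: "complete_lattice L \<longleftrightarrow> complete_lattice M"
    using complete_lattice_dual_iff[of L] complete_lattice_dual_iff[of M] inv by simp
  show "\<Squnion>\<^bsub>L\<^esub>A = \<Squnion>\<^bsub>M\<^esub>A" "\<Sqinter>\<^bsub>L\<^esub>A = \<Sqinter>\<^bsub>M\<^esub>A" "complete_lattice L \<longleftrightarrow> complete_lattice M" by fact+
  show "acdl L \<longleftrightarrow> acdl M"
    by (simp add: acdl_def algebraic_lattice_def completely_distributive_def compact_element_def
        c assms s[abs_def] i[abs_def])
  show "completely_join_prime L = completely_join_prime M"
    by (simp add: completely_join_prime_def s assms fun_eq_iff)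
  show "order_on_carrier L \<longleftrightarrow> order_on_carrier M" by (simp add: order_on_carrier_def assms)
  show "tensor L L = tensor M M" by (simp add: tensor_def s assms)
  show "box L L = box M M" unfolding box_def inv ..
qed

section \<open>The two-element lattice and counits\<close>

lemma complete_lattice_two: "complete_lattice two"
proof -
  interpret T: partial_order two by unfold_locales (auto simp: two_def)
  show ?thesis
  proof (rule T.complete_lattice_criterion1)
    show "\<exists>g. greatest two g (carrier two)"
      by (rule exI[of _ True]) (auto simp: greatest_def two_def)
    fix A :: "bool set" assume "A \<subseteq> carrier two" "A \<noteq> {}"
    show "\<exists>i. is_glb two i A"
      by (rule exI[of _ "False \<notin> A"])
        (auto simp: greatest_def Lower_def two_def, metis (full_types))
  qed
qed

lemma carrier_two [simp]: "carrier two = UNIV"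
  and le_two [simp]: "x \<sqsubseteq>\<^bsub>two\<^esub> y \<longleftrightarrow> (x \<longrightarrow> y)"
  by (simp_all add: two_def)

lemma bottom_two [simp]: "\<bottom>\<^bsub>two\<^esub> = False"
  using complete_lattice_bottom(2)[OF complete_lattice_two, of False] by simp

lemma sup_two [simp]: "\<Squnion>\<^bsub>two\<^esub>A \<longleftrightarrow> True \<in> A"
  using sup_le_iff[OF complete_lattice_two, of A "\<Squnion>\<^bsub>two\<^esub>A"]
    sup_le_iff[OF complete_lattice_two, of A False] by auto

lemma inf_two [simp]: "\<Sqinter>\<^bsub>two\<^esub>A \<longleftrightarrow> False \<notin> A"
  using le_inf_iff[OF complete_lattice_two, of A True] by (simp, metis)

lemma prime_generated_two: "prime_generated two"
  unfolding prime_generated_def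
  by (auto simp: complete_lattice_two completely_join_prime_def intro!: exI[of _ True])

text \<open>A map into \<open>two\<close> that preserves joins and meets is the indicator of a
  principal filter. Its generator \<open>e\<close> is the least element sent to \<open>True\<close>,
  and preservation of joins makes \<open>e\<close> completely join-prime. Hence a counit is the same
  thing as a completely join-prime element.\<close>

lemma acdl_hom_two_iff:
  assumes L: "complete_lattice L"
  shows "f \<in> acdl_hom L two \<longleftrightarrow> f \<in> extensional (carrier L) \<and>
    (\<exists>e. completely_join_prime L e \<and> (\<forall>x\<in>carrier L. f x \<longleftrightarrow> e \<sqsubseteq>\<^bsub>L\<^esub> x))"
proof (intro iffI conjI; (elim conjE exE)?)
  assume f: "f \<in> acdl_hom L two"
  then show "f \<in> extensional (carrier L)" by (auto simp: acdl_hom_def PiE_def)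
  have sup: "f (\<Squnion>\<^bsub>L\<^esub>A) \<longleftrightarrow> (\<exists>a\<in>A. f a)" and inf: "f (\<Sqinter>\<^bsub>L\<^esub>A) \<longleftrightarrow> (\<forall>a\<in>A. f a)"
    if "A \<subseteq> carrier L" for A
    using f that by (auto simp: acdl_hom_def sup_pres_def inf_pres_def)
  define e where "e = \<Sqinter>\<^bsub>L\<^esub>{x \<in> carrier L. f x}"
  have eL: "e \<in> carrier L" unfolding e_def by (rule complete_lattice_inf_closed[OF L]) blast
  have fe: "f e" unfolding e_def by (subst inf) auto
  have e: "f x \<longleftrightarrow> e \<sqsubseteq>\<^bsub>L\<^esub> x" if x: "x \<in> carrier L" for x
  proof
    show "e \<sqsubseteq>\<^bsub>L\<^esub> x" if "f x"
      using le_inf_iff[OF L, of "{x \<in> carrier L. f x}" e] complete_lattice_refl[OF L eL] that x eL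
      by (simp add: e_def[symmetric])
    \<comment> \<open>\<open>f\<close> is monotone because it preserves the join of
      \<open>{e, x}\<close>.\<close>
    show "f x" if "e \<sqsubseteq>\<^bsub>L\<^esub> x"
      using sup[of "{e, x}"] complete_lattice_sup_pair[OF L that eL x] eL x fe by simp
  qed
  moreover have "completely_join_prime L e"
    unfolding completely_join_prime_def
  proof (intro conjI allI impI eL)
    fix A assume A: "A \<subseteq> carrier L" "e \<sqsubseteq>\<^bsub>L\<^esub> \<Squnion>\<^bsub>L\<^esub>A"
    then have "\<exists>a\<in>A. f a" using e[OF complete_lattice_sup_closed[OF L A(1)]] sup[OF A(1)] by simp
    then show "\<exists>a\<in>A. e \<sqsubseteq>\<^bsub>L\<^esub> a" using e A(1) by blast
  qed
  ultimately show "\<exists>e. completely_join_prime L e \<and> (\<forall>x\<in>carrier L. f x \<longleftrightarrow> e \<sqsubseteq>\<^bsub>L\<^esub> x)" by blast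
next
  fix e assume f: "f \<in> extensional (carrier L)" and p: "completely_join_prime L e"
    and e: "\<forall>x\<in>carrier L. f x \<longleftrightarrow> e \<sqsubseteq>\<^bsub>L\<^esub> x"
  have eL: "e \<in> carrier L" using p by (simp add: completely_join_prime_def)
  have "f (\<Sqinter>\<^bsub>L\<^esub>A) = \<Sqinter>\<^bsub>two\<^esub>(f ` A)" if A: "A \<subseteq> carrier L" for A
    using e A le_inf_iff[OF L A eL] complete_lattice_inf_closed[OF L A] by auto
  moreover have "f (\<Squnion>\<^bsub>L\<^esub>A) = \<Squnion>\<^bsub>two\<^esub>(f ` A)" if A: "A \<subseteq> carrier L" for A
  proof -
    have "f (\<Squnion>\<^bsub>L\<^esub>A) \<longleftrightarrow> (\<exists>a\<in>A. f a)"
      using e A completely_join_prime_le_sup_iff[OF L p A] complete_lattice_sup_closed[OF L A] by (meson subsetD)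
    then show ?thesis by auto
  qed
  ultimately show "f \<in> acdl_hom L two"
    using f L complete_lattice_two by (simp add: acdl_hom_def sup_pres_def inf_pres_def PiE_def)
qed

text \<open>As \<open>omega\<close> is the polar, its inverse is the copolar, and
  \<open>comult\<close> and \<open>tcomult\<close> determine each other. Meets in the box become
  conjunctions of memberships in \<open>tcomult\<close>.\<close>

lemma
  assumes C: "V_coalgebra C"
  shows V_coalgebra_complete: "complete_lattice C"
    and V_coalgebra_prime_generated: "prime_generated C"
    and comult_closed: "x \<in> carrier C \<Longrightarrow> comult C x \<in> carrier (box C C)"
    and tcomult_eq: "x \<in> carrier C \<Longrightarrow> tcomult C x = copolar C C (comult C x)"
    and tcomult_closed: "x \<in> carrier C \<Longrightarrow> tcomult C x \<in> carrier (tensor C C)"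
    and comult_eq: "x \<in> carrier C \<Longrightarrow> comult C x = polar C C (tcomult C x)"
    and tcomult_inf: "A \<subseteq> carrier C \<Longrightarrow> a \<in> carrier C \<Longrightarrow> b \<in> carrier C \<Longrightarrow>
      (a, b) \<in> tcomult C (\<Sqinter>\<^bsub>C\<^esub>A) \<longleftrightarrow> (\<forall>x\<in>A. (a, b) \<in> tcomult C x)"
proof -
  show pg: "prime_generated C" using C acdl_prime_generated by (auto simp: V_coalgebra_def)
  then show cl: "complete_lattice C" by (simp add: prime_generated_def)
  have cc: "comult C x \<in> carrier (box C C)" if "x \<in> carrier C" for x
    using C that by (auto simp: V_coalgebra_def)
  then show "x \<in> carrier C \<Longrightarrow> comult C x \<in> carrier (box C C)" .
  have copc: "copolar C C V \<in> carrier (tensor C C)" if "V \<in> carrier (box C C)" for V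
    using copolar_in_tensor[OF cl cl] tensor_subset[of V "inv_gorder C" "inv_gorder C"] that
    by (simp add: carrier_box)
  have inv: "polar C C (copolar C C V) = V" if "V \<in> carrier (box C C)" for V
    using polar_copolar[OF pg pg] that by (simp add: carrier_box)
  have tc: "tcomult C x = copolar C C (comult C x)" if x: "x \<in> carrier C" for x
  proof -
    have "inj_on (omega C C) (carrier (tensor C C))"
      unfolding omega_eq[OF pg pg]
      by (rule inj_on_inverseI[of _ "copolar C C"]) (simp add: copolar_polar[OF pg pg])
    moreover have "omega C C (copolar C C (comult C x)) = comult C x"
      using copc cc[OF x] inv by (simp add: omega_eq[OF pg pg])
    ultimately have "inv_into (carrier (tensor C C)) (omega C C) (comult C x) =
        copolar C C (comult C x)"
      using copc[OF cc[OF x]] by (rule_tac inv_into_f_eq)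
    then show ?thesis using x by (simp add: tcomult_def)
  qed
  then show "x \<in> carrier C \<Longrightarrow> tcomult C x = copolar C C (comult C x)" .
  show "x \<in> carrier C \<Longrightarrow> tcomult C x \<in> carrier (tensor C C)" using tc copc cc by simp
  show "x \<in> carrier C \<Longrightarrow> comult C x = polar C C (tcomult C x)" using tc inv cc by simp
  show "(a, b) \<in> tcomult C (\<Sqinter>\<^bsub>C\<^esub>A) \<longleftrightarrow> (\<forall>x\<in>A. (a, b) \<in> tcomult C x)"
    if A: "A \<subseteq> carrier C" and ab: "a \<in> carrier C" "b \<in> carrier C"
  proof -
    have "comult C (\<Sqinter>\<^bsub>C\<^esub>A) = \<Sqinter>\<^bsub>box C C\<^esub>(comult C ` A)"
      using C A by (auto simp: V_coalgebra_def inf_pres_def)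
    moreover have "comult C ` A \<subseteq> carrier (box C C)" using cc A by blast
    ultimately have "(a, b) \<in> tcomult C (\<Sqinter>\<^bsub>C\<^esub>A) \<longleftrightarrow> (\<forall>x\<in>A. (a, b) \<in> copolar C C (comult C x))"
      using tc[OF complete_lattice_inf_closed[OF cl A]] copolar_inf_box[OF cl cl] ab by simp
    then show ?thesis using tc A by (simp add: subset_iff)
  qed
qed

text \<open>The two sides of a counit law are compared through their copolars in
  \<open>two \<otimes> C\<close> or \<open>C \<otimes> two\<close>. Pairs whose truth value is
  \<open>False\<close> lie in both copolars; those with \<open>True\<close> say that
  \<open>u\<close> is neutral for the ternary relation \<open>tcomult\<close>.\<close>

lemma prime_counital_iff:
  assumes C: "V_coalgebra C" and hom: "counit C \<in> acdl_hom C two"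
    and u: "u \<in> carrier C" "\<And>x. x \<in> carrier C \<Longrightarrow> counit C x \<longleftrightarrow> u \<sqsubseteq>\<^bsub>C\<^esub> x"
  shows "prime_counital C \<longleftrightarrow> (\<forall>x\<in>carrier C. \<forall>b\<in>carrier C.
    ((u, b) \<in> tcomult C x \<longleftrightarrow> b \<sqsubseteq>\<^bsub>C\<^esub> x) \<and> ((b, u) \<in> tcomult C x \<longleftrightarrow> b \<sqsubseteq>\<^bsub>C\<^esub> x))"
proof -
  note cl = V_coalgebra_complete[OF C] and pg = V_coalgebra_prime_generated[OF C]
  note cl2 = complete_lattice_two and pg2 = prime_generated_two
  have left: "box_map two C (counit C) id (comult C x) = pure_box two C \<bottom>\<^bsub>two\<^esub> x \<longleftrightarrow>
      (\<forall>b\<in>carrier C. (u, b) \<in> tcomult C x \<longleftrightarrow> b \<sqsubseteq>\<^bsub>C\<^esub> x)"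
    and right: "box_map C two id (counit C) (comult C x) = pure_box C two x \<bottom>\<^bsub>two\<^esub> \<longleftrightarrow>
      (\<forall>b\<in>carrier C. (b, u) \<in> tcomult C x \<longleftrightarrow> b \<sqsubseteq>\<^bsub>C\<^esub> x)"
    if x: "x \<in> carrier C" for x
  proof -
    have V: "(d, e) \<in> comult C x \<Longrightarrow> d \<in> carrier C \<and> e \<in> carrier C" for d e
      using comult_closed[OF C x] tensor_subset[of "comult C x" "inv_gorder C" "inv_gorder C"]
      by (auto simp: carrier_box)
    \<comment> \<open>\<open>counit C d\<close> means that \<open>u\<close> is below
      \<open>d\<close>, so these conditions are the ones for membership in the copolar of
      \<open>comult C x\<close>.\<close>
    have l: "(u, b) \<in> tcomult C x \<longleftrightarrow> (\<forall>(d, e)\<in>comult C x. counit C d \<or> b \<sqsubseteq>\<^bsub>C\<^esub> e)"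
      and r: "(b, u) \<in> tcomult C x \<longleftrightarrow> (\<forall>(d, e)\<in>comult C x. b \<sqsubseteq>\<^bsub>C\<^esub> d \<or> counit C e)"
      if "b \<in> carrier C" for b
      using that u V by (auto simp: tcomult_eq[OF C x] copolar_def)
    have b1: "box_map two C (counit C) id (comult C x) \<in> carrier (box two C)"
      by (rule box_map_closed[OF cl2 cl]) (use V in auto)
    have b2: "box_map C two id (counit C) (comult C x) \<in> carrier (box C two)"
      by (rule box_map_closed[OF cl cl2]) (use V in auto)
    have e1: "box_map two C (counit C) id (comult C x) = pure_box two C \<bottom>\<^bsub>two\<^esub> x \<longleftrightarrow>
        copolar two C (box_map two C (counit C) id (comult C x)) =
        copolar two C (pure_box two C \<bottom>\<^bsub>two\<^esub> x)"
      using copolar_inject[OF pg2 pg b1 pure_box_closed[OF cl2 cl _ x]] by simp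
    have e2: "copolar two C (box_map two C (counit C) id (comult C x)) =
        {(s, b). b \<in> carrier C \<and> (s \<longrightarrow> (u, b) \<in> tcomult C x)}"
      using V l by (subst copolar_box_map[OF cl2 cl]) auto
    have e3: "copolar two C (pure_box two C \<bottom>\<^bsub>two\<^esub> x) =
        {(s, b). b \<in> carrier C \<and> (s \<longrightarrow> b \<sqsubseteq>\<^bsub>C\<^esub> x)}"
      using x by (subst copolar_pure_box[OF cl2 cl]) auto
    have e4: "{(s, b). b \<in> carrier C \<and> (s \<longrightarrow> (u, b) \<in> tcomult C x)} =
        {(s, b). b \<in> carrier C \<and> (s \<longrightarrow> b \<sqsubseteq>\<^bsub>C\<^esub> x)} \<longleftrightarrow>
        (\<forall>b\<in>carrier C. (u, b) \<in> tcomult C x \<longleftrightarrow> b \<sqsubseteq>\<^bsub>C\<^esub> x)" by auto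
    show "box_map two C (counit C) id (comult C x) = pure_box two C \<bottom>\<^bsub>two\<^esub> x \<longleftrightarrow>
      (\<forall>b\<in>carrier C. (u, b) \<in> tcomult C x \<longleftrightarrow> b \<sqsubseteq>\<^bsub>C\<^esub> x)" by (simp only: e1 e2 e3 e4)
    have f1: "box_map C two id (counit C) (comult C x) = pure_box C two x \<bottom>\<^bsub>two\<^esub> \<longleftrightarrow>
        copolar C two (box_map C two id (counit C) (comult C x)) =
        copolar C two (pure_box C two x \<bottom>\<^bsub>two\<^esub>)"
      using copolar_inject[OF pg pg2 b2 pure_box_closed[OF cl cl2 x]] by simp
    have f2: "copolar C two (box_map C two id (counit C) (comult C x)) =
        {(b, s). b \<in> carrier C \<and> (s \<longrightarrow> (b, u) \<in> tcomult C x)}"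
      using V r by (subst copolar_box_map[OF cl cl2]) auto
    have f3: "copolar C two (pure_box C two x \<bottom>\<^bsub>two\<^esub>) =
        {(b, s). b \<in> carrier C \<and> (s \<longrightarrow> b \<sqsubseteq>\<^bsub>C\<^esub> x)}"
      using x by (subst copolar_pure_box[OF cl cl2]) auto
    have f4: "{(b, s). b \<in> carrier C \<and> (s \<longrightarrow> (b, u) \<in> tcomult C x)} =
        {(b, s). b \<in> carrier C \<and> (s \<longrightarrow> b \<sqsubseteq>\<^bsub>C\<^esub> x)} \<longleftrightarrow>
        (\<forall>b\<in>carrier C. (b, u) \<in> tcomult C x \<longleftrightarrow> b \<sqsubseteq>\<^bsub>C\<^esub> x)" by auto
    show "box_map C two id (counit C) (comult C x) = pure_box C two x \<bottom>\<^bsub>two\<^esub> \<longleftrightarrow>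
      (\<forall>b\<in>carrier C. (b, u) \<in> tcomult C x \<longleftrightarrow> b \<sqsubseteq>\<^bsub>C\<^esub> x)" by (simp only: f1 f2 f3 f4)
  qed
  show ?thesis
    \<comment> \<open>\<open>bottom_two\<close> is switched off so that the counit laws keep the
      shape in which \<open>left\<close> and \<open>right\<close> are stated.\<close>
    unfolding prime_counital_def by (simp add: hom left right ball_conj_distrib del: bottom_two)
qed

text \<open>A relation instead of a map in one direction: morphisms and properties are compared on
  the basis of this correspondence, and since each side determines the other under it, the two
  constructions below are mutually inverse.\<close>

definition represents :: "'a coalgebra \<Rightarrow> 'a residuation \<Rightarrow> bool" where
  "represents C R \<longleftrightarrow> carrier R = carrier C \<and> eq R = eq C \<and> le R = le C \<and>
     (\<forall>a\<in>carrier C. \<forall>b\<in>carrier C. \<forall>z\<in>carrier C.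
        ((a, b) \<in> tcomult C z \<longleftrightarrow> b \<sqsubseteq>\<^bsub>C\<^esub> lres R a z) \<and>
        ((a, b) \<in> tcomult C z \<longleftrightarrow> a \<sqsubseteq>\<^bsub>C\<^esub> rres R z b)) \<and>
     (\<forall>x\<in>carrier C. counit C x \<longleftrightarrow> res_unit R \<sqsubseteq>\<^bsub>C\<^esub> x)"

text \<open>The slices of \<open>tcomult C z\<close> are closed under joins, so these joins are
  their largest elements.\<close>

definition residuation_of :: "'a coalgebra \<Rightarrow> 'a residuation" where
  "residuation_of C = \<lparr>carrier = carrier C, eq = eq C, le = le C,
     lres = (\<lambda>a\<in>carrier C. \<lambda>z\<in>carrier C. \<Squnion>\<^bsub>C\<^esub>{b. (a, b) \<in> tcomult C z}),
     rres = (\<lambda>z\<in>carrier C. \<lambda>b\<in>carrier C. \<Squnion>\<^bsub>C\<^esub>{a. (a, b) \<in> tcomult C z})\<rparr>"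

text \<open>The set under \<open>polar\<close> is the intended \<open>tcomult\<close>;
  \<open>polar\<close> is \<open>omega\<close> and transports it into the box.\<close>

definition coalgebra_of :: "'a residuation \<Rightarrow> 'a coalgebra" where
  "coalgebra_of R = \<lparr>carrier = carrier R, eq = eq R, le = le R,
     comult = (\<lambda>z\<in>carrier R. polar R R
       {(a, b). a \<in> carrier R \<and> b \<in> carrier R \<and> b \<sqsubseteq>\<^bsub>R\<^esub> lres R a z}),
     counit = (\<lambda>x\<in>carrier R. res_unit R \<sqsubseteq>\<^bsub>R\<^esub> x)\<rparr>"

section \<open>Constructing each structure from the other\<close>

lemma PiE_mem2: "f \<in> A \<rightarrow>\<^sub>E B \<rightarrow>\<^sub>E C \<Longrightarrow> a \<in> A \<Longrightarrow> b \<in> B \<Longrightarrow> f a b \<in> C"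
  using PiE_mem[of f A "\<lambda>_. B \<rightarrow>\<^sub>E C" a] PiE_mem[of "f a" B "\<lambda>_. C" b] by simp

lemma PiE_ext2:
  assumes "f \<in> A \<rightarrow>\<^sub>E B \<rightarrow>\<^sub>E C" "g \<in> A \<rightarrow>\<^sub>E B \<rightarrow>\<^sub>E C"
    and "\<And>a b. a \<in> A \<Longrightarrow> b \<in> B \<Longrightarrow> f a b = g a b"
  shows "f = g"
proof (rule PiE_ext[OF assms(1,2)])
  fix a assume "a \<in> A"
  then show "f a = g a" using PiE_mem[OF assms(1)] PiE_mem[OF assms(2)] assms(3) by (rule_tac PiE_ext)
qed

lemma
  assumes R: "residuation_acdl R"
  shows residuation_complete: "complete_lattice R"
    and lres_closed: "a \<in> carrier R \<Longrightarrow> z \<in> carrier R \<Longrightarrow> lres R a z \<in> carrier R"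
    and rres_closed: "b \<in> carrier R \<Longrightarrow> z \<in> carrier R \<Longrightarrow> rres R z b \<in> carrier R"
    and residuation_adjoint: "a \<in> carrier R \<Longrightarrow> b \<in> carrier R \<Longrightarrow> c \<in> carrier R \<Longrightarrow>
      b \<sqsubseteq>\<^bsub>R\<^esub> lres R a c \<longleftrightarrow> a \<sqsubseteq>\<^bsub>R\<^esub> rres R c b"
    and le_lres_inf: "a \<in> carrier R \<Longrightarrow> b \<in> carrier R \<Longrightarrow> A \<subseteq> carrier R \<Longrightarrow>
      b \<sqsubseteq>\<^bsub>R\<^esub> lres R a (\<Sqinter>\<^bsub>R\<^esub>A) \<longleftrightarrow> (\<forall>z\<in>A. b \<sqsubseteq>\<^bsub>R\<^esub> lres R a z)"
    and le_lres_sup: "z \<in> carrier R \<Longrightarrow> b \<in> carrier R \<Longrightarrow> A \<subseteq> carrier R \<Longrightarrow>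
      b \<sqsubseteq>\<^bsub>R\<^esub> lres R (\<Squnion>\<^bsub>R\<^esub>A) z \<longleftrightarrow> (\<forall>a\<in>A. b \<sqsubseteq>\<^bsub>R\<^esub> lres R a z)"
    and lres_antitone: "a \<sqsubseteq>\<^bsub>R\<^esub> a' \<Longrightarrow> a \<in> carrier R \<Longrightarrow> a' \<in> carrier R \<Longrightarrow> z \<in> carrier R \<Longrightarrow>
      lres R a' z \<sqsubseteq>\<^bsub>R\<^esub> lres R a z"
    and rres_antitone: "b \<sqsubseteq>\<^bsub>R\<^esub> b' \<Longrightarrow> b \<in> carrier R \<Longrightarrow> b' \<in> carrier R \<Longrightarrow> z \<in> carrier R \<Longrightarrow>
      rres R z b' \<sqsubseteq>\<^bsub>R\<^esub> rres R z b"
proof -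
  show cl: "complete_lattice R"
    using R by (simp add: residuation_acdl_def acdl_def algebraic_lattice_def)
  have l: "lres R a z \<in> carrier R" and r: "rres R z a \<in> carrier R"
    if "a \<in> carrier R" "z \<in> carrier R" for a z
  proof -
    have "lres R \<in> carrier R \<rightarrow>\<^sub>E carrier R \<rightarrow>\<^sub>E carrier R" "rres R \<in> carrier R \<rightarrow>\<^sub>E carrier R \<rightarrow>\<^sub>E carrier R"
      using R unfolding residuation_acdl_def by blast+
    from PiE_mem2[OF this(1) that] PiE_mem2[OF this(2) that(2,1)]
    show "lres R a z \<in> carrier R" "rres R z a \<in> carrier R" .
  qed
  then show "a \<in> carrier R \<Longrightarrow> z \<in> carrier R \<Longrightarrow> lres R a z \<in> carrier R"
    "b \<in> carrier R \<Longrightarrow> z \<in> carrier R \<Longrightarrow> rres R z b \<in> carrier R" by simp_all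
  have adj: "b \<sqsubseteq>\<^bsub>R\<^esub> lres R a c \<longleftrightarrow> a \<sqsubseteq>\<^bsub>R\<^esub> rres R c b"
    if "a \<in> carrier R" "b \<in> carrier R" "c \<in> carrier R" for a b c
    using R that by (simp add: residuation_acdl_def)
  then show "a \<in> carrier R \<Longrightarrow> b \<in> carrier R \<Longrightarrow> c \<in> carrier R \<Longrightarrow>
      b \<sqsubseteq>\<^bsub>R\<^esub> lres R a c \<longleftrightarrow> a \<sqsubseteq>\<^bsub>R\<^esub> rres R c b" .
  show "b \<sqsubseteq>\<^bsub>R\<^esub> lres R a (\<Sqinter>\<^bsub>R\<^esub>A) \<longleftrightarrow> (\<forall>z\<in>A. b \<sqsubseteq>\<^bsub>R\<^esub> lres R a z)"
    if "a \<in> carrier R" "b \<in> carrier R" "A \<subseteq> carrier R"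
  proof -
    have "inf_pres R R (\<lambda>z. lres R a z)" using R that by (simp add: residuation_acdl_def)
    then show ?thesis using inf_pres_iff[OF cl cl, of "\<lambda>z. lres R a z"] l that by simp
  qed
  show "b \<sqsubseteq>\<^bsub>R\<^esub> lres R (\<Squnion>\<^bsub>R\<^esub>A) z \<longleftrightarrow> (\<forall>a\<in>A. b \<sqsubseteq>\<^bsub>R\<^esub> lres R a z)"
    if "z \<in> carrier R" "b \<in> carrier R" "A \<subseteq> carrier R"
  proof -
    have "sup_pres R (inv_gorder R) (\<lambda>a. lres R a z)"
      using R that unfolding residuation_acdl_def by blast
    then show ?thesis
      using sup_pres_dual_target_iff[OF cl cl, of "\<lambda>a. lres R a z"] l that by simp
  qed
  show "lres R a' z \<sqsubseteq>\<^bsub>R\<^esub> lres R a z"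
    if a: "a \<sqsubseteq>\<^bsub>R\<^esub> a'" "a \<in> carrier R" "a' \<in> carrier R" and z: "z \<in> carrier R"
  proof -
    have "a' \<sqsubseteq>\<^bsub>R\<^esub> rres R z (lres R a' z)"
      using adj[of a' "lres R a' z" z] l complete_lattice_refl[OF cl] a z by blast
    then have "a \<sqsubseteq>\<^bsub>R\<^esub> rres R z (lres R a' z)"
      using complete_lattice_trans[OF cl a(1) _ a(2,3) r[OF l[OF a(3) z] z]] by simp
    then show ?thesis using adj[of a "lres R a' z" z] l a z by blast
  qed
  show "rres R z b' \<sqsubseteq>\<^bsub>R\<^esub> rres R z b"
    if b: "b \<sqsubseteq>\<^bsub>R\<^esub> b'" "b \<in> carrier R" "b' \<in> carrier R" and z: "z \<in> carrier R"
  proof -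
    have "b' \<sqsubseteq>\<^bsub>R\<^esub> lres R (rres R z b') z"
      using adj[of "rres R z b'" b' z] r complete_lattice_refl[OF cl] b z by blast
    then have "b \<sqsubseteq>\<^bsub>R\<^esub> lres R (rres R z b') z"
      using complete_lattice_trans[OF cl b(1) _ b(2,3) l[OF r[OF b(3) z] z]] by simp
    then show ?thesis using adj[of "rres R z b'" b z] r b z by blast
  qed
qed

text \<open>Since \<open>e'\<close> is a unit, \<open>e\<close> is below
  \<open>e = rres R e e'\<close>; the adjunction turns this into \<open>e'\<close> being below
  \<open>lres R e e = e\<close>. By symmetry units are unique.\<close>

lemma prime_unit_below:
  assumes R: "residuation_acdl R" and e: "is_prime_unit R e" and e': "is_prime_unit R e'"
  shows "e' \<sqsubseteq>\<^bsub>R\<^esub> e"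
proof -
  have c: "e \<in> carrier R" "e' \<in> carrier R"
    using e e' by (auto simp: is_prime_unit_def completely_join_prime_def)
  have "e \<sqsubseteq>\<^bsub>R\<^esub> rres R e e'"
    using e' c complete_lattice_refl[OF residuation_complete[OF R]] by (simp add: is_prime_unit_def)
  then show ?thesis
    using residuation_adjoint[OF R c(1) c(2) c(1)] e c by (simp add: is_prime_unit_def)
qed

lemma is_prime_unit_res_unit:
  assumes R: "residuation_acdl R" and e: "is_prime_unit R e"
  shows "res_unit R = e"
  unfolding res_unit_def
proof (rule the_equality)
  interpret L: complete_lattice R using residuation_complete[OF R] .
  fix e' assume e': "is_prime_unit R e'"
  have "e \<in> carrier R" "e' \<in> carrier R"
    using e e' by (simp_all add: is_prime_unit_def completely_join_prime_def)
  with e e' show "e' = e" by (intro L.le_antisym prime_unit_below[OF R])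
qed (rule e)

lemma prime_unital_res_unit:
  assumes "residuation_acdl R" "prime_unital R"
  shows "is_prime_unit R (res_unit R)"
proof -
  obtain e where e: "is_prime_unit R e" using assms(2) by (auto simp: prime_unital_def)
  then show ?thesis unfolding is_prime_unit_res_unit[OF assms(1) e] .
qed

text \<open>That residuals turn joins into meets is the closure of \<open>tcomult C z\<close> under
  joins in each variable; that they preserve meets is the preservation of meets by
  \<open>comult\<close>. The unit is the generator of the filter indicated by the counit.\<close>

lemma residuation_of:
  assumes C: "V_coalgebra C" and counital: "prime_counital C"
  shows "residuation_acdl (residuation_of C)"
    and "prime_unital (residuation_of C)"
    and "represents C (residuation_of C)"
proof -
  let ?R = "residuation_of C"
  note cl = V_coalgebra_complete[OF C]
  have R_sel: "carrier ?R = carrier C" "eq ?R = eq C" "le ?R = le C"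
    by (simp_all add: residuation_of_def)
  note cong = sup_cong_order[OF R_sel] inf_cong_order[OF R_sel] complete_lattice_cong_order[OF R_sel]
    acdl_cong_order[OF R_sel] completely_join_prime_cong_order[OF R_sel]
    order_on_carrier_cong_order[OF R_sel] R_sel
  have sub: "{b. (a, b) \<in> tcomult C z} \<subseteq> carrier C" "{b. (b, a) \<in> tcomult C z} \<subseteq> carrier C"
    if "z \<in> carrier C" for a z
    using tensor_subset[OF tcomult_closed[OF C that]] by auto
  have lc: "lres ?R a z \<in> carrier C" and rc: "rres ?R z a \<in> carrier C"
    if "a \<in> carrier C" "z \<in> carrier C" for a z
    using that sub complete_lattice_sup_closed[OF cl] by (simp_all add: residuation_of_def)
  have l: "(a, b) \<in> tcomult C z \<longleftrightarrow> b \<sqsubseteq>\<^bsub>C\<^esub> lres ?R a z" and r: "(a, b) \<in> tcomult C z \<longleftrightarrow> a \<sqsubseteq>\<^bsub>C\<^esub> rres ?R z b"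
    if abz: "a \<in> carrier C" "b \<in> carrier C" "z \<in> carrier C" for a b z
  proof -
    note T = tcomult_closed[OF C abz(3)]
    let ?B = "{b. (a, b) \<in> tcomult C z}" and ?A = "{a. (a, b) \<in> tcomult C z}"
    have eq: "lres ?R a z = \<Squnion>\<^bsub>C\<^esub>?B" "rres ?R z b = \<Squnion>\<^bsub>C\<^esub>?A"
      using abz by (simp_all add: residuation_of_def)
    \<comment> \<open>The slice contains its own join and is closed downward, so membership in it
      means lying below that join.\<close>
    have B: "(a, \<Squnion>\<^bsub>C\<^esub>?B) \<in> tcomult C z"
      using tensor_sup_right[OF T abz(1) sub(1)[OF abz(3)]] by simp
    have A: "(\<Squnion>\<^bsub>C\<^esub>?A, b) \<in> tcomult C z"
      using tensor_sup_left[OF T sub(2)[OF abz(3)] abz(2)] by simp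
    have "b \<sqsubseteq>\<^bsub>C\<^esub> \<Squnion>\<^bsub>C\<^esub>?B" if "(a, b) \<in> tcomult C z"
      using complete_lattice_sup_upper[OF cl sub(1)[OF abz(3)]] that by simp
    moreover have "(a, b) \<in> tcomult C z" if "b \<sqsubseteq>\<^bsub>C\<^esub> \<Squnion>\<^bsub>C\<^esub>?B"
      using tensor_downward[OF cl cl T B complete_lattice_refl[OF cl abz(1)] that abz(1,2)] .
    ultimately show "(a, b) \<in> tcomult C z \<longleftrightarrow> b \<sqsubseteq>\<^bsub>C\<^esub> lres ?R a z" unfolding eq by blast
    have "a \<sqsubseteq>\<^bsub>C\<^esub> \<Squnion>\<^bsub>C\<^esub>?A" if "(a, b) \<in> tcomult C z"
      using complete_lattice_sup_upper[OF cl sub(2)[OF abz(3)]] that by simp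
    moreover have "(a, b) \<in> tcomult C z" if "a \<sqsubseteq>\<^bsub>C\<^esub> \<Squnion>\<^bsub>C\<^esub>?A"
      using tensor_downward[OF cl cl T A that complete_lattice_refl[OF cl abz(2)] abz(1,2)] .
    ultimately show "(a, b) \<in> tcomult C z \<longleftrightarrow> a \<sqsubseteq>\<^bsub>C\<^esub> rres ?R z b" unfolding eq by blast
  qed
  have tinf: "(a, b) \<in> tcomult C (\<Sqinter>\<^bsub>C\<^esub>A) \<longleftrightarrow> (\<forall>x\<in>A. (a, b) \<in> tcomult C x)"
    if "A \<subseteq> carrier C" "a \<in> carrier C" "b \<in> carrier C" for A a b
    using tcomult_inf[OF C] that by blast
  show R: "residuation_acdl ?R"
    unfolding residuation_acdl_def
  proof (intro conjI ballI)
    show "acdl ?R" "order_on_carrier ?R" using C by (simp_all add: cong V_coalgebra_def)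
    show "lres ?R \<in> carrier ?R \<rightarrow>\<^sub>E carrier ?R \<rightarrow>\<^sub>E carrier ?R"
      "rres ?R \<in> carrier ?R \<rightarrow>\<^sub>E carrier ?R \<rightarrow>\<^sub>E carrier ?R"
      using sub complete_lattice_sup_closed[OF cl] by (auto simp: residuation_of_def)
    fix x assume x: "x \<in> carrier ?R"
    then have xC: "x \<in> carrier C" by (simp add: cong)
    have clR: "complete_lattice ?R" using cl by (simp add: cong)
    have "b \<sqsubseteq>\<^bsub>C\<^esub> lres ?R x (\<Sqinter>\<^bsub>C\<^esub>A) \<longleftrightarrow> (\<forall>z\<in>A. b \<sqsubseteq>\<^bsub>C\<^esub> lres ?R x z)"
      "b \<sqsubseteq>\<^bsub>C\<^esub> rres ?R (\<Sqinter>\<^bsub>C\<^esub>A) x \<longleftrightarrow> (\<forall>z\<in>A. b \<sqsubseteq>\<^bsub>C\<^esub> rres ?R z x)"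
      "b \<sqsubseteq>\<^bsub>C\<^esub> lres ?R (\<Squnion>\<^bsub>C\<^esub>A) x \<longleftrightarrow> (\<forall>a\<in>A. b \<sqsubseteq>\<^bsub>C\<^esub> lres ?R a x)"
      "b \<sqsubseteq>\<^bsub>C\<^esub> rres ?R x (\<Squnion>\<^bsub>C\<^esub>A) \<longleftrightarrow> (\<forall>a\<in>A. b \<sqsubseteq>\<^bsub>C\<^esub> rres ?R x a)"
      if A: "A \<subseteq> carrier C" and b: "b \<in> carrier C" for A b
    proof -
      have AC: "a \<in> carrier C" if "a \<in> A" for a using A that by blast
      note i = complete_lattice_inf_closed[OF cl A] and s = complete_lattice_sup_closed[OF cl A]
      show "b \<sqsubseteq>\<^bsub>C\<^esub> lres ?R x (\<Sqinter>\<^bsub>C\<^esub>A) \<longleftrightarrow> (\<forall>z\<in>A. b \<sqsubseteq>\<^bsub>C\<^esub> lres ?R x z)"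
        using tinf[OF A xC b] l[OF xC b i] l[OF xC b AC] by simp
      show "b \<sqsubseteq>\<^bsub>C\<^esub> rres ?R (\<Sqinter>\<^bsub>C\<^esub>A) x \<longleftrightarrow> (\<forall>z\<in>A. b \<sqsubseteq>\<^bsub>C\<^esub> rres ?R z x)"
        using tinf[OF A b xC] r[OF b xC i] r[OF b xC AC] by simp
      show "b \<sqsubseteq>\<^bsub>C\<^esub> lres ?R (\<Squnion>\<^bsub>C\<^esub>A) x \<longleftrightarrow> (\<forall>a\<in>A. b \<sqsubseteq>\<^bsub>C\<^esub> lres ?R a x)"
        using tensor_sup_left[OF tcomult_closed[OF C xC] A b] l[OF s b xC] l[OF AC b xC] by simp
      show "b \<sqsubseteq>\<^bsub>C\<^esub> rres ?R x (\<Squnion>\<^bsub>C\<^esub>A) \<longleftrightarrow> (\<forall>a\<in>A. b \<sqsubseteq>\<^bsub>C\<^esub> rres ?R x a)"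
        using tensor_sup_right[OF tcomult_closed[OF C xC] b A] r[OF b s xC] r[OF b AC xC] by simp
    qed
    then show "inf_pres ?R ?R (\<lambda>z. lres ?R x z)" "inf_pres ?R ?R (\<lambda>z. rres ?R z x)"
      "sup_pres ?R (inv_gorder ?R) (\<lambda>a. lres ?R a x)" "sup_pres ?R (inv_gorder ?R) (\<lambda>b. rres ?R x b)"
      using inf_pres_iff[OF clR clR, of "\<lambda>z. lres ?R x z"] inf_pres_iff[OF clR clR, of "\<lambda>z. rres ?R z x"]
        sup_pres_dual_target_iff[OF clR clR, of "\<lambda>a. lres ?R a x"]
        sup_pres_dual_target_iff[OF clR clR, of "\<lambda>b. rres ?R x b"] lc xC rc
      by (simp_all add: cong)
  next
    fix a b c assume "a \<in> carrier ?R" "b \<in> carrier ?R" "c \<in> carrier ?R"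
    then show "b \<sqsubseteq>\<^bsub>?R\<^esub> lres ?R a c \<longleftrightarrow> a \<sqsubseteq>\<^bsub>?R\<^esub> rres ?R c b"
      using l r by (simp add: cong)
  qed
  have hom: "counit C \<in> acdl_hom C two" using counital by (simp add: prime_counital_def)
  from hom[unfolded acdl_hom_two_iff[OF cl]]
  obtain e where p: "completely_join_prime C e"
    and e: "\<forall>x\<in>carrier C. counit C x \<longleftrightarrow> e \<sqsubseteq>\<^bsub>C\<^esub> x" by (elim conjE exE)
  have eC: "e \<in> carrier C" using p by (simp add: completely_join_prime_def)
  have law: "(e, b) \<in> tcomult C x \<longleftrightarrow> b \<sqsubseteq>\<^bsub>C\<^esub> x" "(b, e) \<in> tcomult C x \<longleftrightarrow> b \<sqsubseteq>\<^bsub>C\<^esub> x"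
    if "x \<in> carrier C" "b \<in> carrier C" for x b
    using prime_counital_iff[OF C hom eC] e counital that by simp_all
  have "lres ?R e z = z" if z: "z \<in> carrier C" for z
    by (rule eq_by_lower_bounds[OF cl lc[OF eC z] z]) (simp add: l[OF eC _ z, symmetric] law z)
  moreover have "rres ?R z e = z" if z: "z \<in> carrier C" for z
    by (rule eq_by_lower_bounds[OF cl rc[OF eC z] z]) (simp add: r[OF _ eC z, symmetric] law z)
  ultimately have unit: "is_prime_unit ?R e"
    using p by (simp add: is_prime_unit_def cong)
  then show "prime_unital ?R" by (auto simp: prime_unital_def)
  show "represents C ?R"
    unfolding represents_def is_prime_unit_res_unit[OF R unit] using l r e by (simp add: R_sel)
qed

lemma coalgebra_of:
  assumes R: "residuation_acdl R" and unital: "prime_unital R"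
  shows "V_coalgebra (coalgebra_of R)"
    and "prime_counital (coalgebra_of R)"
    and "represents (coalgebra_of R) R"
proof -
  let ?C = "coalgebra_of R"
  note cl = residuation_complete[OF R]
  have pg: "prime_generated R" using R acdl_prime_generated unfolding residuation_acdl_def by blast
  have C_sel: "carrier ?C = carrier R" "eq ?C = eq R" "le ?C = le R"
    by (simp_all add: coalgebra_of_def)
  note cong = sup_cong_order[OF C_sel] inf_cong_order[OF C_sel] complete_lattice_cong_order[OF C_sel]
    acdl_cong_order[OF C_sel] completely_join_prime_cong_order[OF C_sel]
    order_on_carrier_cong_order[OF C_sel] tensor_cong_order[OF C_sel] box_cong_order[OF C_sel] C_sel
  \<comment> \<open>\<open>T z\<close> is the future value of \<open>tcomult\<close>. It respects
    joins in the first variable because \<open>lres\<close> turns them into meets, and in the second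
    because \<open>b\<close> occurs there as a lower bound.\<close>
  define T where "T z = {(a, b). a \<in> carrier R \<and> b \<in> carrier R \<and> b \<sqsubseteq>\<^bsub>R\<^esub> lres R a z}" for z
  have T: "T z \<in> carrier (tensor R R)" if z: "z \<in> carrier R" for z
  proof -
    have "(\<Squnion>\<^bsub>R\<^esub>A, b) \<in> T z \<longleftrightarrow> (\<forall>a\<in>A. (a, b) \<in> T z)" if "A \<subseteq> carrier R" "b \<in> carrier R" for A b
      using that le_lres_sup[OF R z that(2,1)] complete_lattice_sup_closed[OF cl]
      by (auto simp: T_def)
    moreover have "(a, \<Squnion>\<^bsub>R\<^esub>B) \<in> T z \<longleftrightarrow> (\<forall>b\<in>B. (a, b) \<in> T z)"
      if "a \<in> carrier R" "B \<subseteq> carrier R" for a B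
      using that sup_le_iff[OF cl that(2) lres_closed[OF R that(1) z]]
        complete_lattice_sup_closed[OF cl] by (auto simp: T_def)
    moreover have "T z \<subseteq> carrier R \<times> carrier R" by (auto simp: T_def)
    ultimately show ?thesis unfolding tensor_def by simp
  qed
  have comult: "comult ?C z = polar R R (T z)" if "z \<in> carrier R" for z
    using that by (simp add: coalgebra_of_def T_def)
  have pc: "polar R R (T z) \<in> carrier (box R R)" if "z \<in> carrier R" for z
    using polar_in_tensor_dual[OF cl cl tensor_subset[OF T[OF that]]] by (simp add: carrier_box)
  have "comult ?C (\<Sqinter>\<^bsub>R\<^esub>A) = \<Sqinter>\<^bsub>box R R\<^esub>(comult ?C ` A)" if A: "A \<subseteq> carrier R" for A
  proof -
    have img: "comult ?C ` A \<subseteq> carrier (box R R)" using comult pc A by auto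
    have iA: "\<Sqinter>\<^bsub>R\<^esub>A \<in> carrier R" using complete_lattice_inf_closed[OF cl A] .
    \<comment> \<open>Meets in the box are not computed on sets, so the two sides are compared after
      taking copolars.\<close>
    have "copolar R R (\<Sqinter>\<^bsub>box R R\<^esub>(comult ?C ` A)) =
        {(a, b). a \<in> carrier R \<and> b \<in> carrier R \<and> (\<forall>z\<in>A. (a, b) \<in> copolar R R (comult ?C z))}"
      using copolar_inf_box[OF cl cl img] by simp
    also have "\<dots> = {(a, b). a \<in> carrier R \<and> b \<in> carrier R \<and> (\<forall>z\<in>A. (a, b) \<in> T z)}"
      using A comult copolar_polar[OF pg pg T] by (auto simp: subset_iff)
    also have "\<dots> = T (\<Sqinter>\<^bsub>R\<^esub>A)" using le_lres_inf[OF R _ _ A] by (auto simp: T_def)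
    also have "\<dots> = copolar R R (comult ?C (\<Sqinter>\<^bsub>R\<^esub>A))"
      using comult[OF iA] copolar_polar[OF pg pg T[OF iA]] by simp
    finally show ?thesis
      using copolar_inject[OF pg pg] comult[OF iA] pc[OF iA]
        complete_lattice_inf_closed[OF complete_lattice_box[OF cl cl] img] by metis
  qed
  then have "inf_pres ?C (box ?C ?C) (comult ?C)"
    using cl complete_lattice_box[OF cl cl] by (simp add: inf_pres_def cong)
  moreover have "comult ?C \<in> carrier ?C \<rightarrow>\<^sub>E carrier (box ?C ?C)"
    using pc unfolding cong by (simp add: coalgebra_of_def T_def)
  ultimately show C: "V_coalgebra ?C"
    using R by (simp add: V_coalgebra_def residuation_acdl_def cong)
  have copolar_cong: "copolar ?C ?C = copolar R R" by (simp add: copolar_def C_sel fun_eq_iff)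
  have tc: "tcomult ?C z = T z" if "z \<in> carrier R" for z
    using tcomult_eq[OF C, of z] that comult copolar_polar[OF pg pg T[OF that]]
    by (simp add: C_sel copolar_cong)
  let ?e = "res_unit R"
  have unit: "is_prime_unit R ?e" using prime_unital_res_unit[OF R unital] .
  have eR: "?e \<in> carrier R" using unit by (simp add: is_prime_unit_def completely_join_prime_def)
  have ce: "counit ?C x \<longleftrightarrow> ?e \<sqsubseteq>\<^bsub>R\<^esub> x" if "x \<in> carrier R" for x
    using that by (simp add: coalgebra_of_def)
  have "counit ?C \<in> extensional (carrier ?C)" by (simp add: coalgebra_of_def)
  then have hom: "counit ?C \<in> acdl_hom ?C two"
    using acdl_hom_two_iff[of ?C] cl unit ce unfolding cong is_prime_unit_def by blast
  have "(?e, b) \<in> T x \<longleftrightarrow> b \<sqsubseteq>\<^bsub>R\<^esub> x" "(b, ?e) \<in> T x \<longleftrightarrow> b \<sqsubseteq>\<^bsub>R\<^esub> x"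
    if "x \<in> carrier R" "b \<in> carrier R" for x b
    using unit eR that residuation_adjoint[OF R that(2) eR that(1)]
    by (simp_all add: T_def is_prime_unit_def)
  then show "prime_counital ?C"
    using prime_counital_iff[OF C hom, of ?e] eR ce tc by (simp add: C_sel)
  show "represents ?C R"
    unfolding represents_def using ce tc residuation_adjoint[OF R] by (simp add: C_sel T_def)
qed

text \<open>On the carrier residuals are determined by their lower bounds, and outside it by
  extensionality.\<close>

lemma represents_residuation_unique:
  assumes R: "residuation_acdl R" "represents C R" and S: "residuation_acdl S" "represents C S"
  shows "R = S"
proof (rule residuation.equality)
  have sel: "carrier R = carrier C" "eq R = eq C" "le R = le C"
    "carrier S = carrier C" "eq S = eq C" "le S = le C"
    using R S by (simp_all add: represents_def)
  then show "carrier R = carrier S" "eq R = eq S" "le R = le S" by simp_all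
  have cl: "complete_lattice C" using residuation_complete[OF R(1)]
    by (subst complete_lattice_cong_order[of C R]) (simp_all add: sel)
  have le_iff: "b \<sqsubseteq>\<^bsub>C\<^esub> lres R a z \<longleftrightarrow> b \<sqsubseteq>\<^bsub>C\<^esub> lres S a z" "b \<sqsubseteq>\<^bsub>C\<^esub> rres R z a \<longleftrightarrow> b \<sqsubseteq>\<^bsub>C\<^esub> rres S z a"
    if "a \<in> carrier C" "b \<in> carrier C" "z \<in> carrier C" for a b z
    using R(2) S(2) that unfolding represents_def by blast+
  have closed: "lres R a z \<in> carrier C" "lres S a z \<in> carrier C"
    "rres R z a \<in> carrier C" "rres S z a \<in> carrier C" if "a \<in> carrier C" "z \<in> carrier C" for a z
    using lres_closed[OF R(1), of a z] lres_closed[OF S(1), of a z]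
      rres_closed[OF R(1), of a z] rres_closed[OF S(1), of a z] that by (simp_all add: sel)
  have eqs: "lres R a z = lres S a z" "rres R z a = rres S z a"
    if "a \<in> carrier C" "z \<in> carrier C" for a z
    using eq_by_lower_bounds[OF cl closed(1,2)[OF that] le_iff(1)[OF that(1) _ that(2)]]
      eq_by_lower_bounds[OF cl closed(3,4)[OF that] le_iff(2)[OF that(1) _ that(2)]] by simp_all
  have mem: "lres Q \<in> carrier Q \<rightarrow>\<^sub>E carrier Q \<rightarrow>\<^sub>E carrier Q"
    "rres Q \<in> carrier Q \<rightarrow>\<^sub>E carrier Q \<rightarrow>\<^sub>E carrier Q" if "residuation_acdl Q" for Q :: "'a residuation"
    using that unfolding residuation_acdl_def by blast+
  note memR = mem[OF R(1), unfolded sel] and memS = mem[OF S(1), unfolded sel]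
  show "lres R = lres S" by (rule PiE_ext2[OF memR(1) memS(1) eqs(1)])
  show "rres R = rres S" by (rule PiE_ext2[OF memR(2) memS(2) eqs(2)])
qed simp

text \<open>The correspondence fixes the pairs in \<open>tcomult\<close>, and \<open>comult\<close>
  is recovered as their polar.\<close>

lemma represents_coalgebra_unique:
  assumes C: "V_coalgebra C" "prime_counital C" "represents C R"
    and D: "V_coalgebra D" "prime_counital D" "represents D R"
  shows "C = D"
proof (rule coalgebra.equality)
  have sel: "carrier D = carrier C" "eq D = eq C" "le D = le C"
    using C D by (simp_all add: represents_def)
  then show "carrier C = carrier D" "eq C = eq D" "le C = le D" by simp_all
  have "counit C \<in> extensional (carrier C)" "counit D \<in> extensional (carrier C)"
    using C(2) D(2) by (auto simp: prime_counital_def acdl_hom_def PiE_def sel)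
  moreover have "counit C x = counit D x" if "x \<in> carrier C" for x
    using C(3) D(3) that by (simp add: represents_def sel)
  ultimately show "counit C = counit D" by (rule extensionalityI)
  have "tcomult C x = tcomult D x" if x: "x \<in> carrier C" for x
  proof -
    have "tcomult C x \<subseteq> carrier C \<times> carrier C" "tcomult D x \<subseteq> carrier C \<times> carrier C"
      using tensor_subset[OF tcomult_closed[OF C(1)]] tensor_subset[OF tcomult_closed[OF D(1)]] x sel
      by auto
    moreover have "(a, b) \<in> tcomult C x \<longleftrightarrow> (a, b) \<in> tcomult D x"
      if "a \<in> carrier C" "b \<in> carrier C" for a b
      using C(3) D(3) that x by (simp add: represents_def sel)
    ultimately show ?thesis by auto
  qed
  moreover have "polar D D = polar C C" by (simp add: polar_def sel fun_eq_iff)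
  ultimately have "comult C x = comult D x" if "x \<in> carrier C" for x
    using comult_eq[OF C(1)] comult_eq[OF D(1)] that sel by simp
  moreover have "comult C \<in> extensional (carrier C)" "comult D \<in> extensional (carrier C)"
    using C(1) D(1) by (auto simp: V_coalgebra_def PiE_def sel)
  ultimately show "comult C = comult D" by (auto intro: extensionalityI)
qed simp

section \<open>Morphisms\<close>

lemma left_adjoint:
  assumes L: "complete_lattice L" and M: "complete_lattice M"
    and f: "\<And>x. x \<in> carrier L \<Longrightarrow> f x \<in> carrier M" and inf: "inf_pres L M f"
  shows "\<exists>g. (\<forall>a\<in>carrier M. g a \<in> carrier L) \<and>
    (\<forall>a\<in>carrier M. \<forall>x\<in>carrier L. g a \<sqsubseteq>\<^bsub>L\<^esub> x \<longleftrightarrow> a \<sqsubseteq>\<^bsub>M\<^esub> f x)"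
proof -
  define A where "A a = {x \<in> carrier L. a \<sqsubseteq>\<^bsub>M\<^esub> f x}" for a
  have A: "A a \<subseteq> carrier L" for a by (auto simp: A_def)
  have le: "a \<sqsubseteq>\<^bsub>M\<^esub> f (\<Sqinter>\<^bsub>L\<^esub>B) \<longleftrightarrow> (\<forall>x\<in>B. a \<sqsubseteq>\<^bsub>M\<^esub> f x)" if "a \<in> carrier M" "B \<subseteq> carrier L" for a B
    using inf inf_pres_iff[OF L M f] that by simp
  have g: "\<Sqinter>\<^bsub>L\<^esub>(A a) \<in> carrier L" for a using complete_lattice_inf_closed[OF L A] .
  have "\<Sqinter>\<^bsub>L\<^esub>(A a) \<sqsubseteq>\<^bsub>L\<^esub> x \<longleftrightarrow> a \<sqsubseteq>\<^bsub>M\<^esub> f x" if a: "a \<in> carrier M" and x: "x \<in> carrier L" for a x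
  proof
    assume "a \<sqsubseteq>\<^bsub>M\<^esub> f x"
    then have "x \<in> A a" using x by (simp add: A_def)
    then show "\<Sqinter>\<^bsub>L\<^esub>(A a) \<sqsubseteq>\<^bsub>L\<^esub> x"
      using le_inf_iff[OF L A g] complete_lattice_refl[OF L g] by simp
  next
    assume *: "\<Sqinter>\<^bsub>L\<^esub>(A a) \<sqsubseteq>\<^bsub>L\<^esub> x"
    have "\<Sqinter>\<^bsub>L\<^esub>{x, \<Sqinter>\<^bsub>L\<^esub>(A a)} = \<Sqinter>\<^bsub>L\<^esub>(A a)"
      by (rule complete_lattice_inf_pair[OF L * g x])
    moreover have "a \<sqsubseteq>\<^bsub>M\<^esub> f (\<Sqinter>\<^bsub>L\<^esub>(A a))" using le[OF a A] by (simp add: A_def)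
    ultimately show "a \<sqsubseteq>\<^bsub>M\<^esub> f x" using le[OF a, of "{x, \<Sqinter>\<^bsub>L\<^esub>(A a)}"] x g by simp
  qed
  with g show ?thesis by (intro exI[of _ "\<lambda>a. \<Sqinter>\<^bsub>L\<^esub>(A a)"]) simp
qed

text \<open>In the copolar of the left-hand side the tests of \<open>a\<close> against
  \<open>f d\<close> and of \<open>b\<close> against \<open>f e\<close> move across the adjunction
  to tests of \<open>g a\<close> against \<open>d\<close> and of \<open>g b\<close> against
  \<open>e\<close>. These are the tests for membership of \<open>(g a, g b)\<close> in
  \<open>tcomult C x\<close>.\<close>

lemma box_map_comult_iff:
  assumes C: "V_coalgebra C" and D: "V_coalgebra D"
    and f: "\<And>x. x \<in> carrier C \<Longrightarrow> f x \<in> carrier D"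
    and g: "\<And>a. a \<in> carrier D \<Longrightarrow> g a \<in> carrier C"
    and adj: "\<And>a x. a \<in> carrier D \<Longrightarrow> x \<in> carrier C \<Longrightarrow> g a \<sqsubseteq>\<^bsub>C\<^esub> x \<longleftrightarrow> a \<sqsubseteq>\<^bsub>D\<^esub> f x"
    and x: "x \<in> carrier C"
  shows "box_map D D f f (comult C x) = comult D (f x) \<longleftrightarrow>
    (\<forall>a\<in>carrier D. \<forall>b\<in>carrier D. (g a, g b) \<in> tcomult C x \<longleftrightarrow> (a, b) \<in> tcomult D (f x))"
proof -
  note cl = V_coalgebra_complete[OF D] and pg = V_coalgebra_prime_generated[OF D]
  have V: "d \<in> carrier C \<and> e \<in> carrier C" if "(d, e) \<in> comult C x" for d e
    using comult_closed[OF C x] tensor_subset[of "comult C x" "inv_gorder C" "inv_gorder C"] that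
    by (auto simp: carrier_box)
  have fV: "f d \<in> carrier D \<and> f e \<in> carrier D" if "(d, e) \<in> comult C x" for d e
    using V[OF that] f by simp
  have "box_map D D f f (comult C x) = comult D (f x) \<longleftrightarrow>
      copolar D D (box_map D D f f (comult C x)) = tcomult D (f x)"
    unfolding tcomult_eq[OF D f[OF x]]
    using copolar_inject[OF pg pg box_map_closed[OF cl cl, of "comult C x" f f, OF fV] comult_closed[OF D f[OF x]]] by simp
  also have "copolar D D (box_map D D f f (comult C x)) =
      {(a, b). a \<in> carrier D \<and> b \<in> carrier D \<and>
        (\<forall>(d, e)\<in>comult C x. a \<sqsubseteq>\<^bsub>D\<^esub> f d \<or> b \<sqsubseteq>\<^bsub>D\<^esub> f e)}"
    by (rule copolar_box_map[OF cl cl]) (rule fV)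
  also have "\<dots> = {(a, b). a \<in> carrier D \<and> b \<in> carrier D \<and> (g a, g b) \<in> tcomult C x}"
  proof -
    have "(\<forall>(d, e)\<in>comult C x. a \<sqsubseteq>\<^bsub>D\<^esub> f d \<or> b \<sqsubseteq>\<^bsub>D\<^esub> f e) \<longleftrightarrow> (g a, g b) \<in> tcomult C x"
      if ab: "a \<in> carrier D" "b \<in> carrier D" for a b
    proof -
      have "(\<forall>(d, e)\<in>comult C x. a \<sqsubseteq>\<^bsub>D\<^esub> f d \<or> b \<sqsubseteq>\<^bsub>D\<^esub> f e) \<longleftrightarrow>
          (\<forall>(d, e)\<in>comult C x. g a \<sqsubseteq>\<^bsub>C\<^esub> d \<or> g b \<sqsubseteq>\<^bsub>C\<^esub> e)"
        using adj[OF ab(1)] adj[OF ab(2)] V by (intro ball_cong) auto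
      then show ?thesis using g ab by (simp add: tcomult_eq[OF C x] copolar_def)
    qed
    then show ?thesis by (simp cong: conj_cong)
  qed
  also have "\<dots> = tcomult D (f x) \<longleftrightarrow>
      (\<forall>a\<in>carrier D. \<forall>b\<in>carrier D. (g a, g b) \<in> tcomult C x \<longleftrightarrow> (a, b) \<in> tcomult D (f x))"
    using tensor_subset[OF tcomult_closed[OF D f[OF x]]] by auto
  finally show ?thesis .
qed

text \<open>
  Back holds for \<open>y\<close> with the least witness \<open>x = g y\<close>, where \<open>g\<close> is left adjoint to \<open>f\<close>. This
  turns Back and Forth into a single equation.
\<close>

lemma back_forth_iff:
  assumes R: "complete_lattice R" and S: "complete_lattice S"
    and f: "\<And>x. x \<in> carrier R \<Longrightarrow> f x \<in> carrier S"
    and g: "\<And>a. a \<in> carrier S \<Longrightarrow> g a \<in> carrier R"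
    and adj: "\<And>a x. a \<in> carrier S \<Longrightarrow> x \<in> carrier R \<Longrightarrow> g a \<sqsubseteq>\<^bsub>R\<^esub> x \<longleftrightarrow> a \<sqsubseteq>\<^bsub>S\<^esub> f x"
    and h: "\<And>x z. x \<in> carrier R \<Longrightarrow> z \<in> carrier R \<Longrightarrow> h x z \<in> carrier R"
    and k: "\<And>x z. x \<in> carrier S \<Longrightarrow> z \<in> carrier S \<Longrightarrow> k x z \<in> carrier S"
    and h_anti: "\<And>x x' z. x \<sqsubseteq>\<^bsub>R\<^esub> x' \<Longrightarrow> x \<in> carrier R \<Longrightarrow> x' \<in> carrier R \<Longrightarrow> z \<in> carrier R \<Longrightarrow>
      h x' z \<sqsubseteq>\<^bsub>R\<^esub> h x z"
    and k_anti: "\<And>x x' z. x \<sqsubseteq>\<^bsub>S\<^esub> x' \<Longrightarrow> x \<in> carrier S \<Longrightarrow> x' \<in> carrier S \<Longrightarrow> z \<in> carrier S \<Longrightarrow>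
      k x' z \<sqsubseteq>\<^bsub>S\<^esub> k x z"
  shows "(\<forall>x\<in>carrier R. \<forall>z\<in>carrier R. f (h x z) \<sqsubseteq>\<^bsub>S\<^esub> k (f x) (f z)) \<and>
      (\<forall>y\<in>carrier S. \<forall>z\<in>carrier R. \<exists>x\<in>carrier R. y \<sqsubseteq>\<^bsub>S\<^esub> f x \<and> k y (f z) = f (h x z)) \<longleftrightarrow>
    (\<forall>y\<in>carrier S. \<forall>z\<in>carrier R. f (h (g y) z) = k y (f z))"
    (is "?forth \<and> ?back \<longleftrightarrow> ?eq")
proof -
  interpret R: complete_lattice R by (rule R)
  interpret S: complete_lattice S by (rule S)
  have counit: "g (f x) \<sqsubseteq>\<^bsub>R\<^esub> x" if "x \<in> carrier R" for x
    using adj[OF f[OF that] that] f[OF that] by simp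
  have unit: "y \<sqsubseteq>\<^bsub>S\<^esub> f (g y)" if "y \<in> carrier S" for y
    using adj[OF that g[OF that]] g[OF that] by simp
  have mono: "f x \<sqsubseteq>\<^bsub>S\<^esub> f x'" if "x \<sqsubseteq>\<^bsub>R\<^esub> x'" and x: "x \<in> carrier R" and x': "x' \<in> carrier R" for x x'
    using R.le_trans[OF counit[OF x] that(1) g[OF f[OF x]] x x'] adj[OF f[OF x] x'] by simp
  show ?thesis
  proof
    assume fb: "?forth \<and> ?back"
    show ?eq
    proof (intro ballI)
      fix y z assume y: "y \<in> carrier S" and z: "z \<in> carrier R"
      obtain x where x: "x \<in> carrier R" "y \<sqsubseteq>\<^bsub>S\<^esub> f x" "k y (f z) = f (h x z)" using fb y z by blast
      have "g y \<sqsubseteq>\<^bsub>R\<^esub> x" using adj[OF y x(1)] x(2) by simp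
      \<comment> \<open>Back may supply a witness larger than \<open>g y\<close>; antitonicity lets
        \<open>g y\<close> replace it at the price of an inequality.\<close>
      then have ge: "k y (f z) \<sqsubseteq>\<^bsub>S\<^esub> f (h (g y) z)"
        unfolding x(3) by (intro mono h_anti h g x(1) y z)
      \<comment> \<open>The reverse inequality is Forth at \<open>g y\<close>, followed by
        antitonicity along the unit of the adjunction at \<open>y\<close>.\<close>
      have "f (h (g y) z) \<sqsubseteq>\<^bsub>S\<^esub> k (f (g y)) (f z)" using fb g[OF y] z by blast
      moreover have "k (f (g y)) (f z) \<sqsubseteq>\<^bsub>S\<^esub> k y (f z)" by (intro k_anti unit f g y z)
      ultimately have "f (h (g y) z) \<sqsubseteq>\<^bsub>S\<^esub> k y (f z)"
        by (rule S.le_trans) (intro f g h k y z)+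
      then show "f (h (g y) z) = k y (f z)"
        using ge by (rule S.le_antisym) (intro f g h k y z)+
    qed
  next
    assume eq: ?eq
    show "?forth \<and> ?back"
    proof (intro conjI ballI)
      fix x z assume x: "x \<in> carrier R" and z: "z \<in> carrier R"
      \<comment> \<open>Forth is recovered from the equation at \<open>y = f x\<close>, because
        \<open>g (f x)\<close> is below \<open>x\<close>.\<close>
      have "f (h x z) \<sqsubseteq>\<^bsub>S\<^esub> f (h (g (f x)) z)" by (intro mono h_anti counit f g h x z)
      then show "f (h x z) \<sqsubseteq>\<^bsub>S\<^esub> k (f x) (f z)" using eq f[OF x] z by simp
    next
      fix y z assume y: "y \<in> carrier S" and z: "z \<in> carrier R"
      show "\<exists>x\<in>carrier R. y \<sqsubseteq>\<^bsub>S\<^esub> f x \<and> k y (f z) = f (h x z)"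
        using unit[OF y] g[OF y] eq y z by (intro bexI[of _ "g y"]) simp_all
    qed
  qed
qed

section \<open>Morphisms on the two sides of the dictionary\<close>

lemma representsD:
  assumes "represents C R"
  shows "carrier R = carrier C" "eq R = eq C" "le R = le C"
    and "a \<in> carrier C \<Longrightarrow> b \<in> carrier C \<Longrightarrow> z \<in> carrier C \<Longrightarrow>
      (a, b) \<in> tcomult C z \<longleftrightarrow> b \<sqsubseteq>\<^bsub>C\<^esub> lres R a z"
    and "a \<in> carrier C \<Longrightarrow> b \<in> carrier C \<Longrightarrow> z \<in> carrier C \<Longrightarrow>
      (a, b) \<in> tcomult C z \<longleftrightarrow> a \<sqsubseteq>\<^bsub>C\<^esub> rres R z b"
    and "x \<in> carrier C \<Longrightarrow> counit C x \<longleftrightarrow> res_unit R \<sqsubseteq>\<^bsub>C\<^esub> x"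
  using assms unfolding represents_def by blast+

lemma
  assumes "carrier L = carrier L'" "eq L = eq L'" "le L = le L'"
    and "carrier M = carrier M'" "eq M = eq M'" "le M = le M'"
  shows sup_pres_cong_order: "sup_pres L M = sup_pres L' M'"
    and inf_pres_cong_order: "inf_pres L M = inf_pres L' M'"
    and acdl_hom_cong_order: "acdl_hom L M = acdl_hom L' M'"
proof -
  note cong = sup_cong_order[OF assms(1-3)] sup_cong_order[OF assms(4-6)]
    inf_cong_order[OF assms(1-3)] inf_cong_order[OF assms(4-6)]
    complete_lattice_cong_order[OF assms(1-3)] complete_lattice_cong_order[OF assms(4-6)]
  show s: "sup_pres L M = sup_pres L' M'" and i: "inf_pres L M = inf_pres L' M'"
    by (simp_all add: fun_eq_iff sup_pres_def inf_pres_def cong assms(1))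
  show "acdl_hom L M = acdl_hom L' M'" by (simp add: acdl_hom_def s i assms)
qed

text \<open>The condition that \<open>g\<close> respects the ternary relations has two readings. For
  fixed \<open>a\<close>, comparing all lower bounds \<open>b\<close> gives the Back and Forth
  equation for \<open>lres\<close>; for fixed \<open>b\<close>, comparing all \<open>a\<close> gives
  the one for \<open>rres\<close>. Both equations are therefore the coalgebra law.\<close>

lemma pure_morphism_iff_res_morphism:
  assumes C: "V_coalgebra C" and R: "residuation_acdl R" and CR: "represents C R"
    and D: "V_coalgebra D" and S: "residuation_acdl S" and DS: "represents D S"
  shows "pure_morphism C D f \<longleftrightarrow> res_morphism R S f"
proof (cases "f \<in> acdl_hom C D")
  case True
  note selR = representsD(1-3)[OF CR] and selS = representsD(1-3)[OF DS]
  note clC = V_coalgebra_complete[OF C] and clD = V_coalgebra_complete[OF D]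
  have f: "f x \<in> carrier D" if "x \<in> carrier C" for x using True that by (auto simp: acdl_hom_def)
  have inf: "inf_pres C D f" using True by (simp add: acdl_hom_def)
  obtain g where "\<forall>a\<in>carrier D. g a \<in> carrier C"
    and "\<forall>a\<in>carrier D. \<forall>x\<in>carrier C. g a \<sqsubseteq>\<^bsub>C\<^esub> x \<longleftrightarrow> a \<sqsubseteq>\<^bsub>D\<^esub> f x"
    using left_adjoint[OF clC clD f inf] by auto
  then have g: "\<And>a. a \<in> carrier D \<Longrightarrow> g a \<in> carrier C"
    and adj: "\<And>a x. a \<in> carrier D \<Longrightarrow> x \<in> carrier C \<Longrightarrow> g a \<sqsubseteq>\<^bsub>C\<^esub> x \<longleftrightarrow> a \<sqsubseteq>\<^bsub>D\<^esub> f x"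
    by simp_all
  have lR: "lres R a z \<in> carrier C" "rres R z a \<in> carrier C" if "a \<in> carrier C" "z \<in> carrier C" for a z
    using lres_closed[OF R, of a z] rres_closed[OF R, of a z] that by (simp_all add: selR)
  have lS: "lres S a z \<in> carrier D" "rres S z a \<in> carrier D" if "a \<in> carrier D" "z \<in> carrier D" for a z
    using lres_closed[OF S, of a z] rres_closed[OF S, of a z] that by (simp_all add: selS)
  have lres_eq: "(\<forall>b\<in>carrier D. (g a, g b) \<in> tcomult C x \<longleftrightarrow> (a, b) \<in> tcomult D (f x)) \<longleftrightarrow>
      f (lres R (g a) x) = lres S a (f x)" if a: "a \<in> carrier D" and x: "x \<in> carrier C" for a x
  proof -
    note cl = f[OF lR(1)[OF g[OF a] x]] lS(1)[OF a f[OF x]]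
    have "(\<forall>b\<in>carrier D. (g a, g b) \<in> tcomult C x \<longleftrightarrow> (a, b) \<in> tcomult D (f x)) \<longleftrightarrow>
        (\<forall>b\<in>carrier D. b \<sqsubseteq>\<^bsub>D\<^esub> f (lres R (g a) x) \<longleftrightarrow> b \<sqsubseteq>\<^bsub>D\<^esub> lres S a (f x))"
      using a x g f lR by (simp add: representsD(4)[OF CR] representsD(4)[OF DS] adj)
    then show ?thesis using eq_by_lower_bounds[OF clD cl] by auto
  qed
  have rres_eq: "(\<forall>a\<in>carrier D. (g a, g b) \<in> tcomult C x \<longleftrightarrow> (a, b) \<in> tcomult D (f x)) \<longleftrightarrow>
      f (rres R x (g b)) = rres S (f x) b" if b: "b \<in> carrier D" and x: "x \<in> carrier C" for b x
  proof -
    note cl = f[OF lR(2)[OF g[OF b] x]] lS(2)[OF b f[OF x]]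
    have "(\<forall>a\<in>carrier D. (g a, g b) \<in> tcomult C x \<longleftrightarrow> (a, b) \<in> tcomult D (f x)) \<longleftrightarrow>
        (\<forall>a\<in>carrier D. a \<sqsubseteq>\<^bsub>D\<^esub> f (rres R x (g b)) \<longleftrightarrow> a \<sqsubseteq>\<^bsub>D\<^esub> rres S (f x) b)"
      using b x g f lR by (simp add: representsD(5)[OF CR] representsD(5)[OF DS] adj)
    then show ?thesis using eq_by_lower_bounds[OF clD cl] by auto
  qed
  have anti: "lres R x' z \<sqsubseteq>\<^bsub>C\<^esub> lres R x z" "rres R z x' \<sqsubseteq>\<^bsub>C\<^esub> rres R z x"
    if "x \<sqsubseteq>\<^bsub>C\<^esub> x'" "x \<in> carrier C" "x' \<in> carrier C" "z \<in> carrier C" for x x' z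
    using lres_antitone[OF R, of x x' z] rres_antitone[OF R, of x x' z] that by (simp_all add: selR)
  have anti': "lres S x' z \<sqsubseteq>\<^bsub>D\<^esub> lres S x z" "rres S z x' \<sqsubseteq>\<^bsub>D\<^esub> rres S z x"
    if "x \<sqsubseteq>\<^bsub>D\<^esub> x'" "x \<in> carrier D" "x' \<in> carrier D" "z \<in> carrier D" for x x' z
    using lres_antitone[OF S, of x x' z] rres_antitone[OF S, of x x' z] that by (simp_all add: selS)
  have bf_l: "(\<forall>x\<in>carrier C. \<forall>z\<in>carrier C. f (lres R x z) \<sqsubseteq>\<^bsub>D\<^esub> lres S (f x) (f z)) \<and>
      (\<forall>y\<in>carrier D. \<forall>z\<in>carrier C. \<exists>x\<in>carrier C. y \<sqsubseteq>\<^bsub>D\<^esub> f x \<and> lres S y (f z) = f (lres R x z)) \<longleftrightarrow>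
    (\<forall>y\<in>carrier D. \<forall>z\<in>carrier C. f (lres R (g y) z) = lres S y (f z))"
    by (rule back_forth_iff[OF clC clD f g adj lR(1) lS(1) anti(1) anti'(1)])
  \<comment> \<open>The operations \<open>h\<close> and \<open>k\<close> are now right residuals
    with the divisor as first argument.\<close>
  have bf_r: "(\<forall>x\<in>carrier C. \<forall>z\<in>carrier C. f (rres R z x) \<sqsubseteq>\<^bsub>D\<^esub> rres S (f z) (f x)) \<and>
      (\<forall>y\<in>carrier D. \<forall>z\<in>carrier C. \<exists>x\<in>carrier C. y \<sqsubseteq>\<^bsub>D\<^esub> f x \<and> rres S (f z) y = f (rres R z x)) \<longleftrightarrow>
    (\<forall>y\<in>carrier D. \<forall>z\<in>carrier C. f (rres R z (g y)) = rres S (f z) y)"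
    by (rule back_forth_iff[OF clC clD f g adj lR(2) lS(2) anti(2) anti'(2)])
  let ?P = "\<forall>x\<in>carrier C. \<forall>a\<in>carrier D. \<forall>b\<in>carrier D.
    (g a, g b) \<in> tcomult C x \<longleftrightarrow> (a, b) \<in> tcomult D (f x)"
  let ?U = "\<forall>x\<in>carrier C. res_unit R \<sqsubseteq>\<^bsub>C\<^esub> x \<longleftrightarrow> res_unit S \<sqsubseteq>\<^bsub>D\<^esub> f x"
  have Pl: "(\<forall>y\<in>carrier D. \<forall>z\<in>carrier C. f (lres R (g y) z) = lres S y (f z)) \<longleftrightarrow> ?P"
    using lres_eq by (simp cong: ball_cong) blast
  have Pr: "(\<forall>y\<in>carrier D. \<forall>z\<in>carrier C. f (rres R z (g y)) = rres S (f z) y) \<longleftrightarrow> ?P"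
  proof -
    have "?P \<longleftrightarrow> (\<forall>b\<in>carrier D. \<forall>x\<in>carrier C. \<forall>a\<in>carrier D.
        (g a, g b) \<in> tcomult C x \<longleftrightarrow> (a, b) \<in> tcomult D (f x))" by blast
    then show ?thesis using rres_eq by simp
  qed
  have "pure_morphism C D f \<longleftrightarrow> ?P \<and> ?U"
    using box_map_comult_iff[OF C D f g adj] representsD(6)[OF CR] representsD(6)[OF DS] f True
    by (simp add: pure_morphism_def)
  also have "\<dots> \<longleftrightarrow> ((\<forall>y\<in>carrier D. \<forall>z\<in>carrier C. f (lres R (g y) z) = lres S y (f z)) \<and>
      (\<forall>y\<in>carrier D. \<forall>z\<in>carrier C. f (rres R z (g y)) = rres S (f z) y)) \<and> ?U"
    unfolding Pl Pr by simp
  also have "\<dots> \<longleftrightarrow> res_morphism R S f"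
    unfolding bf_l[symmetric] bf_r[symmetric] res_morphism_def
      acdl_hom_cong_order[OF selR selS] selR selS
    using True by (simp only: ball_conj_distrib simp_thms) blast
  finally show ?thesis .
next
  case False
  then show ?thesis
    using acdl_hom_cong_order[OF representsD(1-3)[OF CR] representsD(1-3)[OF DS]]
    by (simp add: pure_morphism_def res_morphism_def)
qed

lemma sup_pres_mono:
  assumes f: "sup_pres L M f" "f \<in> carrier L \<rightarrow> carrier M"
    and xy: "x \<sqsubseteq>\<^bsub>L\<^esub> y" "x \<in> carrier L" "y \<in> carrier L"
  shows "f x \<sqsubseteq>\<^bsub>M\<^esub> f y"
proof -
  have L: "complete_lattice L" and M: "complete_lattice M" using f(1) by (simp_all add: sup_pres_def)
  have "f (\<Squnion>\<^bsub>L\<^esub>{x, y}) = \<Squnion>\<^bsub>M\<^esub>{f x, f y}" using f(1) xy by (simp add: sup_pres_def)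
  moreover have "{f x, f y} \<subseteq> carrier M" using f(2) xy by auto
  ultimately show ?thesis
    using complete_lattice_sup_upper[OF M, of "{f x, f y}" "f x"] complete_lattice_sup_pair[OF L xy]
    by simp
qed

text \<open>The inequality of tensor elements is tested on the pairs \<open>(a, b)\<close> of
  \<open>tcomult C z\<close>, that is, on the \<open>b\<close> below \<open>lres R a z\<close>. As
  \<open>\<rho>\<close> is monotone, the largest such \<open>b\<close> suffices. In the same way the
  inequality of counits is tested at the unit, the least element at which the first counit
  holds.\<close>

lemma corel_morphism_iff_corel_res_morphism:
  assumes C: "V_coalgebra C" and R: "residuation_acdl R" "prime_unital R" and CR: "represents C R"
    and D: "V_coalgebra D" and S: "residuation_acdl S" and DS: "represents D S"
  shows "corel_morphism C D \<rho> \<longleftrightarrow> corel_res_morphism R S \<rho>"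
proof (cases "\<rho> \<in> carrier C \<rightarrow>\<^sub>E carrier D \<and> sup_pres C D \<rho>")
  case True
  note selR = representsD(1-3)[OF CR] and selS = representsD(1-3)[OF DS]
  note clC = V_coalgebra_complete[OF C] and clD = V_coalgebra_complete[OF D]
  interpret D: complete_lattice D by (rule clD)
  have \<rho>: "\<rho> x \<in> carrier D" if "x \<in> carrier C" for x using True that by auto
  have mono: "\<rho> x \<sqsubseteq>\<^bsub>D\<^esub> \<rho> y" if "x \<sqsubseteq>\<^bsub>C\<^esub> y" "x \<in> carrier C" "y \<in> carrier C" for x y
    using sup_pres_mono[OF _ _ that, of D \<rho>] True by auto
  have lR: "lres R a z \<in> carrier C" if "a \<in> carrier C" "z \<in> carrier C" for a z
    using lres_closed[OF R(1), of a z] that by (simp add: selR)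
  have lS: "lres S a z \<in> carrier D" if "a \<in> carrier D" "z \<in> carrier D" for a z
    using lres_closed[OF S, of a z] that by (simp add: selS)
  have eC: "res_unit R \<in> carrier C"
    using prime_unital_res_unit[OF R] selR by (simp add: is_prime_unit_def completely_join_prime_def)
  have eD: "res_unit S \<sqsubseteq>\<^bsub>D\<^esub> y' " if "res_unit S \<sqsubseteq>\<^bsub>D\<^esub> y" "y \<sqsubseteq>\<^bsub>D\<^esub> y'" "y \<in> carrier D" "y' \<in> carrier D" for y y'
  proof -
    \<comment> \<open>The order is a relation on the carrier, so whatever lies below
      \<open>y\<close> belongs to the carrier.\<close>
    have "res_unit S \<in> carrier D"
      using S that(1) selS by (simp add: residuation_acdl_def order_on_carrier_def)
    then show ?thesis using D.le_trans[OF that(1,2)] that by simp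
  qed
  have tens: "tensor_map D D \<rho> \<rho> (tcomult C z) \<sqsubseteq>\<^bsub>tensor D D\<^esub> tcomult D (\<rho> z) \<longleftrightarrow>
      (\<forall>x\<in>carrier C. \<rho> (lres R x z) \<sqsubseteq>\<^bsub>D\<^esub> lres S (\<rho> x) (\<rho> z))" if z: "z \<in> carrier C" for z
  proof -
    have T: "a \<in> carrier C \<and> b \<in> carrier C" if "(a, b) \<in> tcomult C z" for a b
      using tensor_subset[OF tcomult_closed[OF C z]] that by auto
    have \<rho>T: "\<rho> a \<in> carrier D \<and> \<rho> b \<in> carrier D" if "(a, b) \<in> tcomult C z" for a b
      using T[OF that] \<rho> by simp
    have "tensor_map D D \<rho> \<rho> (tcomult C z) \<sqsubseteq>\<^bsub>tensor D D\<^esub> tcomult D (\<rho> z) \<longleftrightarrow>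
        (\<forall>(a, b)\<in>tcomult C z. (\<rho> a, \<rho> b) \<in> tcomult D (\<rho> z))"
      using tensor_map_le_iff[OF clD clD, of "tcomult C z" \<rho> \<rho>, OF \<rho>T tcomult_closed[OF D \<rho>[OF z]]] by simp
    also have "\<dots> \<longleftrightarrow> (\<forall>a\<in>carrier C. \<forall>b\<in>carrier C.
        (a, b) \<in> tcomult C z \<longrightarrow> (\<rho> a, \<rho> b) \<in> tcomult D (\<rho> z))" using T by blast
    also have "\<dots> \<longleftrightarrow> (\<forall>a\<in>carrier C. \<forall>b\<in>carrier C. b \<sqsubseteq>\<^bsub>C\<^esub> lres R a z \<longrightarrow> \<rho> b \<sqsubseteq>\<^bsub>D\<^esub> lres S (\<rho> a) (\<rho> z))"
      using \<rho> z by (simp add: representsD(4)[OF CR] representsD(4)[OF DS])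
    also have "\<dots> \<longleftrightarrow> (\<forall>a\<in>carrier C. \<rho> (lres R a z) \<sqsubseteq>\<^bsub>D\<^esub> lres S (\<rho> a) (\<rho> z))"
    proof (intro ball_cong refl iffI ballI impI)
      fix a assume a: "a \<in> carrier C"
      show "\<rho> (lres R a z) \<sqsubseteq>\<^bsub>D\<^esub> lres S (\<rho> a) (\<rho> z)"
        if "\<forall>b\<in>carrier C. b \<sqsubseteq>\<^bsub>C\<^esub> lres R a z \<longrightarrow> \<rho> b \<sqsubseteq>\<^bsub>D\<^esub> lres S (\<rho> a) (\<rho> z)"
        using that lR[OF a z] complete_lattice_refl[OF clC lR[OF a z]] by simp
      fix b assume b: "b \<in> carrier C" "b \<sqsubseteq>\<^bsub>C\<^esub> lres R a z"
      show "\<rho> b \<sqsubseteq>\<^bsub>D\<^esub> lres S (\<rho> a) (\<rho> z)" if "\<rho> (lres R a z) \<sqsubseteq>\<^bsub>D\<^esub> lres S (\<rho> a) (\<rho> z)"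
        using D.le_trans[OF mono[OF b(2,1) lR[OF a z]] that \<rho>[OF b(1)] \<rho>[OF lR[OF a z]]
          lS[OF \<rho>[OF a] \<rho>[OF z]]] .
    qed
    finally show ?thesis .
  qed
  have "(\<forall>x\<in>carrier C. counit C x \<sqsubseteq>\<^bsub>two\<^esub> counit D (\<rho> x)) \<longleftrightarrow>
      (\<forall>x\<in>carrier C. res_unit R \<sqsubseteq>\<^bsub>C\<^esub> x \<longrightarrow> res_unit S \<sqsubseteq>\<^bsub>D\<^esub> \<rho> x)"
    using \<rho> by (simp add: representsD(6)[OF CR] representsD(6)[OF DS])
  also have "\<dots> \<longleftrightarrow> res_unit S \<sqsubseteq>\<^bsub>D\<^esub> \<rho> (res_unit R)"
  proof (intro iffI ballI impI)
    show "res_unit S \<sqsubseteq>\<^bsub>D\<^esub> \<rho> (res_unit R)"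
      if "\<forall>x\<in>carrier C. res_unit R \<sqsubseteq>\<^bsub>C\<^esub> x \<longrightarrow> res_unit S \<sqsubseteq>\<^bsub>D\<^esub> \<rho> x"
      using that eC complete_lattice_refl[OF clC eC] by simp
    fix x assume x: "x \<in> carrier C" "res_unit R \<sqsubseteq>\<^bsub>C\<^esub> x"
    show "res_unit S \<sqsubseteq>\<^bsub>D\<^esub> \<rho> x" if "res_unit S \<sqsubseteq>\<^bsub>D\<^esub> \<rho> (res_unit R)"
      using eD[OF that mono[OF x(2) eC x(1)]] \<rho> eC x by simp
  qed
  finally have counit: "(\<forall>x\<in>carrier C. counit C x \<sqsubseteq>\<^bsub>two\<^esub> counit D (\<rho> x)) \<longleftrightarrow>
      res_unit S \<sqsubseteq>\<^bsub>D\<^esub> \<rho> (res_unit R)" .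
  have top: "\<top>\<^bsub>R\<^esub> = \<top>\<^bsub>C\<^esub>" "\<top>\<^bsub>S\<^esub> = \<top>\<^bsub>D\<^esub>" by (simp_all add: top_def greatest_def selR selS)
  have tens': "(\<forall>z\<in>carrier C. tensor_map D D \<rho> \<rho> (tcomult C z) \<sqsubseteq>\<^bsub>tensor D D\<^esub> tcomult D (\<rho> z)) \<longleftrightarrow>
      (\<forall>x\<in>carrier C. \<forall>z\<in>carrier C. \<rho> (lres R x z) \<sqsubseteq>\<^bsub>D\<^esub> lres S (\<rho> x) (\<rho> z))"
    using tens by blast
  show ?thesis
    unfolding corel_morphism_def corel_res_morphism_def counit tens'
      sup_pres_cong_order[OF selR selS] selR selS top ..
next
  case False
  then show ?thesis
    unfolding corel_morphism_def corel_res_morphism_def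
      sup_pres_cong_order[OF representsD(1-3)[OF CR] representsD(1-3)[OF DS]]
      representsD(1)[OF CR] representsD(1)[OF DS] by blast
qed

section \<open>Comonoids and derivations\<close>

lemma eq_by_primes:
  assumes L: "prime_generated L" and x: "x \<in> carrier L" and y: "y \<in> carrier L"
    and primes: "\<And>q. completely_join_prime L q \<Longrightarrow> q \<sqsubseteq>\<^bsub>L\<^esub> x \<longleftrightarrow> q \<sqsubseteq>\<^bsub>L\<^esub> y"
  shows "x = y"
proof -
  interpret L: complete_lattice L using L by (simp add: prime_generated_def)
  have "x \<sqsubseteq>\<^bsub>L\<^esub> y" "y \<sqsubseteq>\<^bsub>L\<^esub> x" using L x y primes unfolding prime_generated_def by blast+
  then show ?thesis using x y by (rule L.le_antisym)
qed

text \<open>A completely join-prime is below a join iff it is below a member, so at primes the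
  preservation of joins becomes an existence statement.\<close>

lemma sup_pres_prime_iff:
  assumes L: "complete_lattice L" and M: "prime_generated M"
    and f: "\<And>x. x \<in> carrier L \<Longrightarrow> f x \<in> carrier M"
  shows "sup_pres L M f \<longleftrightarrow> (\<forall>Z\<subseteq>carrier L. \<forall>q. completely_join_prime M q \<longrightarrow>
    (q \<sqsubseteq>\<^bsub>M\<^esub> f (\<Squnion>\<^bsub>L\<^esub>Z) \<longleftrightarrow> (\<exists>z\<in>Z. q \<sqsubseteq>\<^bsub>M\<^esub> f z)))"
proof -
  have clM: "complete_lattice M" using M by (simp add: prime_generated_def)
  have "f (\<Squnion>\<^bsub>L\<^esub>Z) = \<Squnion>\<^bsub>M\<^esub>(f ` Z) \<longleftrightarrow> (\<forall>q. completely_join_prime M q \<longrightarrow>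
      (q \<sqsubseteq>\<^bsub>M\<^esub> f (\<Squnion>\<^bsub>L\<^esub>Z) \<longleftrightarrow> (\<exists>z\<in>Z. q \<sqsubseteq>\<^bsub>M\<^esub> f z)))" if Z: "Z \<subseteq> carrier L" for Z
  proof -
    have img: "f ` Z \<subseteq> carrier M" using f Z by blast
    have "f (\<Squnion>\<^bsub>L\<^esub>Z) = \<Squnion>\<^bsub>M\<^esub>(f ` Z) \<longleftrightarrow>
        (\<forall>q. completely_join_prime M q \<longrightarrow> (q \<sqsubseteq>\<^bsub>M\<^esub> f (\<Squnion>\<^bsub>L\<^esub>Z) \<longleftrightarrow> q \<sqsubseteq>\<^bsub>M\<^esub> \<Squnion>\<^bsub>M\<^esub>(f ` Z)))"
      using eq_by_primes[OF M f[OF complete_lattice_sup_closed[OF L Z]]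
        complete_lattice_sup_closed[OF clM img]] by auto
    then show ?thesis using completely_join_prime_le_sup_iff[OF clM _ img] by simp
  qed
  then show ?thesis using L clM by (simp add: sup_pres_def)
qed

text \<open>In effect \<open>p \<otimes> q\<close> is completely join-prime in the tensor product:
  the copolar of the pair of partners \<open>(m, n)\<close> is the largest tensor element that omits
  \<open>(p, q)\<close>.\<close>

lemma prime_pair_in_tensor_sup_iff:
  assumes D: "complete_lattice D" and E: "complete_lattice E"
    and p: "completely_join_prime D p" and q: "completely_join_prime E q"
    and \<U>: "\<U> \<subseteq> carrier (tensor D E)"
  shows "(p, q) \<in> \<Squnion>\<^bsub>tensor D E\<^esub>\<U> \<longleftrightarrow> (\<exists>U\<in>\<U>. (p, q) \<in> U)"
proof
  have T: "complete_lattice (tensor D E)" using D E by (rule complete_lattice_tensor)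
  have pq: "p \<in> carrier D" "q \<in> carrier E" using p q by (simp_all add: completely_join_prime_def)
  show "(p, q) \<in> \<Squnion>\<^bsub>tensor D E\<^esub>\<U>" if "\<exists>U\<in>\<U>. (p, q) \<in> U"
    using that complete_lattice_sup_upper[OF T \<U>] by auto
  obtain m where m: "m \<in> carrier D" "\<And>x. x \<in> carrier D \<Longrightarrow> p \<sqsubseteq>\<^bsub>D\<^esub> x \<longleftrightarrow> \<not> x \<sqsubseteq>\<^bsub>D\<^esub> m"
    using completely_join_prime_complement[OF D p] by blast
  obtain n where n: "n \<in> carrier E" "\<And>x. x \<in> carrier E \<Longrightarrow> q \<sqsubseteq>\<^bsub>E\<^esub> x \<longleftrightarrow> \<not> x \<sqsubseteq>\<^bsub>E\<^esub> n"
    using completely_join_prime_complement[OF E q] by blast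
  let ?V = "copolar D E {(m, n)}"
  have V: "?V \<in> carrier (tensor D E)" using copolar_in_tensor[OF D E] m(1) n(1) by simp
  have pqV: "(p, q) \<notin> ?V"
    using m(2)[OF pq(1)] n(2)[OF pq(2)] complete_lattice_refl[OF D pq(1)]
      complete_lattice_refl[OF E pq(2)] by (simp add: copolar_def)
  assume "(p, q) \<in> \<Squnion>\<^bsub>tensor D E\<^esub>\<U>"
  then have "\<not> \<Squnion>\<^bsub>tensor D E\<^esub>\<U> \<subseteq> ?V" using pqV by blast
  then obtain U where U: "U \<in> \<U>" "\<not> U \<subseteq> ?V" using sup_le_iff[OF T \<U> V] by auto
  then obtain a b where ab: "(a, b) \<in> U" "(a, b) \<notin> ?V" by auto
  note UT = subsetD[OF \<U> U(1)]
  have "a \<in> carrier D" "b \<in> carrier E" using tensor_subset[OF UT] ab(1) by auto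
  then have "p \<sqsubseteq>\<^bsub>D\<^esub> a" "q \<sqsubseteq>\<^bsub>E\<^esub> b" using ab(2) m(2) n(2) by (auto simp: copolar_def)
  then have "(p, q) \<in> U" by (rule tensor_downward[OF D E UT ab(1) _ _ pq])
  then show "\<exists>U\<in>\<U>. (p, q) \<in> U" using U(1) by blast
qed

lemma tensor_eq_by_primes:
  assumes D: "prime_generated D" and E: "prime_generated E"
    and U: "U \<in> carrier (tensor D E)" and V: "V \<in> carrier (tensor D E)"
    and primes: "\<And>p q. completely_join_prime D p \<Longrightarrow> completely_join_prime E q \<Longrightarrow>
      (p, q) \<in> U \<longleftrightarrow> (p, q) \<in> V"
  shows "U = V"
proof -
  have cD: "complete_lattice D" and cE: "complete_lattice E"
    using D E by (simp_all add: prime_generated_def)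
  have "U' \<subseteq> V'" if U': "U' \<in> carrier (tensor D E)" and V': "V' \<in> carrier (tensor D E)"
    and primes: "\<And>p q. completely_join_prime D p \<Longrightarrow> completely_join_prime E q \<Longrightarrow>
      (p, q) \<in> U' \<Longrightarrow> (p, q) \<in> V'" for U' V'
  proof (rule subrelI, rule ccontr)
    fix a b assume ab: "(a, b) \<in> U'" "(a, b) \<notin> V'"
    have c: "a \<in> carrier D" "b \<in> carrier E" using tensor_subset[OF U'] ab(1) by auto
    obtain p q where p: "completely_join_prime D p" "p \<in> carrier D" "p \<sqsubseteq>\<^bsub>D\<^esub> a"
      and q: "completely_join_prime E q" "q \<in> carrier E" "q \<sqsubseteq>\<^bsub>E\<^esub> b" "(p, q) \<notin> V'"
      using tensor_prime_witness[OF D E V' c ab(2)] by blast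
    have "(p, q) \<in> U'" by (rule tensor_downward[OF cD cE U' ab(1) p(3) q(3) p(2) q(2)])
    then show False using primes[OF p(1) q(1)] q(4) by simp
  qed
  from this[OF U V] this[OF V U] primes show ?thesis by blast
qed

lemma sup_pres_tcomult_iff:
  assumes C: "V_coalgebra C"
  shows "sup_pres C (tensor C C) (tcomult C) \<longleftrightarrow>
    (\<forall>Z\<subseteq>carrier C. \<forall>p q. completely_join_prime C p \<longrightarrow> completely_join_prime C q \<longrightarrow>
      ((p, q) \<in> tcomult C (\<Squnion>\<^bsub>C\<^esub>Z) \<longleftrightarrow> (\<exists>z\<in>Z. (p, q) \<in> tcomult C z)))"
proof -
  note cl = V_coalgebra_complete[OF C] and pg = V_coalgebra_prime_generated[OF C]
  have T: "complete_lattice (tensor C C)" using cl cl by (rule complete_lattice_tensor)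
  have "tcomult C (\<Squnion>\<^bsub>C\<^esub>Z) = \<Squnion>\<^bsub>tensor C C\<^esub>(tcomult C ` Z) \<longleftrightarrow>
      (\<forall>p q. completely_join_prime C p \<longrightarrow> completely_join_prime C q \<longrightarrow>
        ((p, q) \<in> tcomult C (\<Squnion>\<^bsub>C\<^esub>Z) \<longleftrightarrow> (\<exists>z\<in>Z. (p, q) \<in> tcomult C z)))"
    if Z: "Z \<subseteq> carrier C" for Z
  proof -
    have img: "tcomult C ` Z \<subseteq> carrier (tensor C C)" using tcomult_closed[OF C] Z by blast
    note sc = tcomult_closed[OF C complete_lattice_sup_closed[OF cl Z]]
    have "tcomult C (\<Squnion>\<^bsub>C\<^esub>Z) = \<Squnion>\<^bsub>tensor C C\<^esub>(tcomult C ` Z) \<longleftrightarrow>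
      (\<forall>p q. completely_join_prime C p \<longrightarrow> completely_join_prime C q \<longrightarrow>
        ((p, q) \<in> tcomult C (\<Squnion>\<^bsub>C\<^esub>Z) \<longleftrightarrow> (p, q) \<in> \<Squnion>\<^bsub>tensor C C\<^esub>(tcomult C ` Z)))"
      using tensor_eq_by_primes[OF pg pg sc complete_lattice_sup_closed[OF T img]] by auto
    then show ?thesis using prime_pair_in_tensor_sup_iff[OF cl cl _ _ img] by simp
  qed
  then show ?thesis using cl T by (simp add: sup_pres_def)
qed

text \<open>At a pair of primes \<open>(p, q)\<close> the preservation of joins by
  \<open>tcomult\<close> is that of left division by \<open>p\<close> tested at \<open>q\<close>,
  and equally that of right division by \<open>q\<close> tested at \<open>p\<close>. The two halves
  of purity are one condition quantified over prime pairs.\<close>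

lemma res_pure_iff:
  assumes C: "V_coalgebra C" and R: "residuation_acdl R" and CR: "represents C R"
  shows "res_pure R \<longleftrightarrow> sup_pres C (tensor C C) (tcomult C)"
proof -
  note cl = V_coalgebra_complete[OF C] and pg = V_coalgebra_prime_generated[OF C]
  note selR = representsD(1-3)[OF CR]
  have lR: "lres R a z \<in> carrier C" "rres R z a \<in> carrier C" if "a \<in> carrier C" "z \<in> carrier C" for a z
    using lres_closed[OF R, of a z] rres_closed[OF R, of a z] that by (simp_all add: selR)
  have "sup_pres R R (\<lambda>z. lres R p z) \<longleftrightarrow> (\<forall>Z\<subseteq>carrier C. \<forall>q. completely_join_prime C q \<longrightarrow>
      ((p, q) \<in> tcomult C (\<Squnion>\<^bsub>C\<^esub>Z) \<longleftrightarrow> (\<exists>z\<in>Z. (p, q) \<in> tcomult C z)))" (is ?l)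
    and "sup_pres R R (\<lambda>z. rres R z p) \<longleftrightarrow> (\<forall>Z\<subseteq>carrier C. \<forall>q. completely_join_prime C q \<longrightarrow>
      ((q, p) \<in> tcomult C (\<Squnion>\<^bsub>C\<^esub>Z) \<longleftrightarrow> (\<exists>z\<in>Z. (q, p) \<in> tcomult C z)))" (is ?r)
    if "completely_join_prime C p" for p
  proof -
    have p: "p \<in> carrier C" using that by (simp add: completely_join_prime_def)
    have q: "q \<in> carrier C" if "completely_join_prime C q" for q
      using that by (simp add: completely_join_prime_def)
    have l: "q \<sqsubseteq>\<^bsub>C\<^esub> lres R p z \<longleftrightarrow> (p, q) \<in> tcomult C z"
      and r: "q \<sqsubseteq>\<^bsub>C\<^esub> rres R z p \<longleftrightarrow> (q, p) \<in> tcomult C z"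
      if "completely_join_prime C q" "z \<in> carrier C" for q z
      using representsD(4)[OF CR p q[OF that(1)] that(2)] representsD(5)[OF CR q[OF that(1)] p that(2)]
      by simp_all
    have lZ: "(q \<sqsubseteq>\<^bsub>C\<^esub> lres R p (\<Squnion>\<^bsub>C\<^esub>Z) \<longleftrightarrow> (\<exists>z\<in>Z. q \<sqsubseteq>\<^bsub>C\<^esub> lres R p z)) \<longleftrightarrow>
        ((p, q) \<in> tcomult C (\<Squnion>\<^bsub>C\<^esub>Z) \<longleftrightarrow> (\<exists>z\<in>Z. (p, q) \<in> tcomult C z))"
      and rZ: "(q \<sqsubseteq>\<^bsub>C\<^esub> rres R (\<Squnion>\<^bsub>C\<^esub>Z) p \<longleftrightarrow> (\<exists>z\<in>Z. q \<sqsubseteq>\<^bsub>C\<^esub> rres R z p)) \<longleftrightarrow>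
        ((q, p) \<in> tcomult C (\<Squnion>\<^bsub>C\<^esub>Z) \<longleftrightarrow> (\<exists>z\<in>Z. (q, p) \<in> tcomult C z))"
      if Z: "Z \<subseteq> carrier C" and qp: "completely_join_prime C q" for Z q
    proof -
      have ZC: "z \<in> carrier C" if "z \<in> Z" for z using that Z by blast
      show "(q \<sqsubseteq>\<^bsub>C\<^esub> lres R p (\<Squnion>\<^bsub>C\<^esub>Z) \<longleftrightarrow> (\<exists>z\<in>Z. q \<sqsubseteq>\<^bsub>C\<^esub> lres R p z)) \<longleftrightarrow>
        ((p, q) \<in> tcomult C (\<Squnion>\<^bsub>C\<^esub>Z) \<longleftrightarrow> (\<exists>z\<in>Z. (p, q) \<in> tcomult C z))"
        using l[OF qp complete_lattice_sup_closed[OF cl Z]] l[OF qp ZC] by (simp cong: bex_cong)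
      show "(q \<sqsubseteq>\<^bsub>C\<^esub> rres R (\<Squnion>\<^bsub>C\<^esub>Z) p \<longleftrightarrow> (\<exists>z\<in>Z. q \<sqsubseteq>\<^bsub>C\<^esub> rres R z p)) \<longleftrightarrow>
        ((q, p) \<in> tcomult C (\<Squnion>\<^bsub>C\<^esub>Z) \<longleftrightarrow> (\<exists>z\<in>Z. (q, p) \<in> tcomult C z))"
        using r[OF qp complete_lattice_sup_closed[OF cl Z]] r[OF qp ZC] by (simp cong: bex_cong)
    qed
    show ?l
      unfolding sup_pres_cong_order[OF selR selR]
      using sup_pres_prime_iff[OF cl pg, of "\<lambda>z. lres R p z"] lR(1)[OF p] lZ by simp
    show ?r
      unfolding sup_pres_cong_order[OF selR selR]
      using sup_pres_prime_iff[OF cl pg, of "\<lambda>z. rres R z p"] lR(2)[OF p] rZ by simp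
  qed
  then have "res_pure R \<longleftrightarrow> (\<forall>p. completely_join_prime C p \<longrightarrow>
      (\<forall>Z\<subseteq>carrier C. \<forall>q. completely_join_prime C q \<longrightarrow>
        ((p, q) \<in> tcomult C (\<Squnion>\<^bsub>C\<^esub>Z) \<longleftrightarrow> (\<exists>z\<in>Z. (p, q) \<in> tcomult C z))) \<and>
      (\<forall>Z\<subseteq>carrier C. \<forall>q. completely_join_prime C q \<longrightarrow>
        ((q, p) \<in> tcomult C (\<Squnion>\<^bsub>C\<^esub>Z) \<longleftrightarrow> (\<exists>z\<in>Z. (q, p) \<in> tcomult C z))))"
    unfolding res_pure_def completely_join_prime_cong_order[OF selR] by simp
  then show ?thesis unfolding sup_pres_tcomult_iff[OF C] by blast
qed

section \<open>Iterated tensor products and coassociativity\<close>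

lemma tensor_lift_le_iff:
  assumes L: "complete_lattice L" and h: "\<And>a b. (a, b) \<in> U \<Longrightarrow> h a b \<in> carrier L"
  shows tensor_lift_closed: "tensor_lift L h U \<in> carrier L"
    and "s \<in> carrier L \<Longrightarrow> tensor_lift L h U \<sqsubseteq>\<^bsub>L\<^esub> s \<longleftrightarrow> (\<forall>(a, b)\<in>U. h a b \<sqsubseteq>\<^bsub>L\<^esub> s)"
proof -
  have sub: "{h a b |a b. (a, b) \<in> U} \<subseteq> carrier L" using h by blast
  show "tensor_lift L h U \<in> carrier L"
    unfolding tensor_lift_def by (rule complete_lattice_sup_closed[OF L sub])
  show "tensor_lift L h U \<sqsubseteq>\<^bsub>L\<^esub> s \<longleftrightarrow> (\<forall>(a, b)\<in>U. h a b \<sqsubseteq>\<^bsub>L\<^esub> s)" if "s \<in> carrier L"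
    unfolding tensor_lift_def sup_le_iff[OF L sub that] by blast
qed

lemma pure_tensor_sup:
  assumes D: "complete_lattice D" and E: "complete_lattice E"
  shows "A \<subseteq> carrier D \<Longrightarrow> e \<in> carrier E \<Longrightarrow>
      pure_tensor D E (\<Squnion>\<^bsub>D\<^esub>A) e = \<Squnion>\<^bsub>tensor D E\<^esub>((\<lambda>a. pure_tensor D E a e) ` A)"
    and "d \<in> carrier D \<Longrightarrow> B \<subseteq> carrier E \<Longrightarrow>
      pure_tensor D E d (\<Squnion>\<^bsub>E\<^esub>B) = \<Squnion>\<^bsub>tensor D E\<^esub>(pure_tensor D E d ` B)"
  using bi_sup_pres_pure_tensor[OF D E] by (simp_all add: bi_sup_pres_def sup_pres_def)

text \<open>Pure tensors preserve joins in each variable, so fixing one of the three variables in an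
  element of the iterated product leaves a tensor element in the other two.\<close>

lemma
  assumes L: "complete_lattice L" and Y: "Y \<in> carrier (tensor L (tensor L L))"
  shows tensor_slice_left: "a \<in> carrier L \<Longrightarrow>
      {(b, c). b \<in> carrier L \<and> c \<in> carrier L \<and> (a, pure_tensor L L b c) \<in> Y} \<in> carrier (tensor L L)"
      (is "_ \<Longrightarrow> ?L a \<in> _")
    and tensor_slice_right: "c \<in> carrier L \<Longrightarrow>
      {(a, b). a \<in> carrier L \<and> b \<in> carrier L \<and> (a, pure_tensor L L b c) \<in> Y} \<in> carrier (tensor L L)"
      (is "_ \<Longrightarrow> ?R c \<in> _")
proof -
  have pure_left: "(a, pure_tensor L L (\<Squnion>\<^bsub>L\<^esub>B) c) \<in> Y \<longleftrightarrow> (\<forall>b\<in>B. (a, pure_tensor L L b c) \<in> Y)"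
    if "a \<in> carrier L" "B \<subseteq> carrier L" "c \<in> carrier L" for a B c
  proof -
    have "(\<lambda>b. pure_tensor L L b c) ` B \<subseteq> carrier (tensor L L)"
      using that pure_tensor_closed[OF L L] by blast
    then show ?thesis
      using tensor_sup_right[OF Y that(1)] pure_tensor_sup(1)[OF L L that(2,3)] by simp
  qed
  have pure_right: "(a, pure_tensor L L b (\<Squnion>\<^bsub>L\<^esub>A)) \<in> Y \<longleftrightarrow> (\<forall>c\<in>A. (a, pure_tensor L L b c) \<in> Y)"
    if "a \<in> carrier L" "b \<in> carrier L" "A \<subseteq> carrier L" for a b A
  proof -
    have "pure_tensor L L b ` A \<subseteq> carrier (tensor L L)"
      using that pure_tensor_closed[OF L L] by blast
    then show ?thesis
      using tensor_sup_right[OF Y that(1)] pure_tensor_sup(2)[OF L L that(2,3)] by simp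
  qed
  note sc = complete_lattice_sup_closed[OF L]
  show "?L a \<in> carrier (tensor L L)" if a: "a \<in> carrier L"
  proof -
    have "?L a \<subseteq> carrier L \<times> carrier L" by auto
    moreover have "(\<Squnion>\<^bsub>L\<^esub>B, c) \<in> ?L a \<longleftrightarrow> (\<forall>b\<in>B. (b, c) \<in> ?L a)"
      if "B \<subseteq> carrier L" "c \<in> carrier L" for B c
      using pure_left[OF a that] that sc[OF that(1)] by (simp add: subset_iff)
    moreover have "(b, \<Squnion>\<^bsub>L\<^esub>A) \<in> ?L a \<longleftrightarrow> (\<forall>c\<in>A. (b, c) \<in> ?L a)"
      if "b \<in> carrier L" "A \<subseteq> carrier L" for b A
      using pure_right[OF a that] that sc[OF that(2)] by (simp add: subset_iff)
    ultimately show ?thesis by (subst tensor_def) simp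
  qed
  show "?R c \<in> carrier (tensor L L)" if c: "c \<in> carrier L"
  proof -
    have "?R c \<subseteq> carrier L \<times> carrier L" by auto
    moreover have "(\<Squnion>\<^bsub>L\<^esub>A, b) \<in> ?R c \<longleftrightarrow> (\<forall>a\<in>A. (a, b) \<in> ?R c)"
      if "A \<subseteq> carrier L" "b \<in> carrier L" for A b
      using tensor_sup_left[OF Y that(1) pure_tensor_closed[OF L L that(2) c]] that sc[OF that(1)]
      by (simp add: subset_iff)
    moreover have "(a, \<Squnion>\<^bsub>L\<^esub>B) \<in> ?R c \<longleftrightarrow> (\<forall>b\<in>B. (a, b) \<in> ?R c)"
      if "a \<in> carrier L" "B \<subseteq> carrier L" for a B
      using pure_left[OF that c] that sc[OF that(2)] by (simp add: subset_iff)
    ultimately show ?thesis by (subst tensor_def) simp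
  qed
qed

text \<open>The set produced by \<open>tensor_map\<close> contains more than the generating pairs
  \<open>(f d, c)\<close>. Upper bounds can still be tested on generators because the lifted map
  \<open>h\<close> respects joins in both variables, a fact encoded by \<open>K\<close> being a
  tensor element.\<close>

lemma
  assumes L: "complete_lattice L" and V: "V \<subseteq> carrier L \<times> carrier L"
    and f: "\<And>d. d \<in> carrier L \<Longrightarrow> f d \<in> carrier (tensor L L)"
  shows tensor_assoc_tensor_map_closed:
      "tensor_assoc L L L (tensor_map (tensor L L) L f id V) \<in> carrier (tensor L (tensor L L))"
    and tensor_assoc_tensor_map_le_iff: "Y \<in> carrier (tensor L (tensor L L)) \<Longrightarrow>
      tensor_assoc L L L (tensor_map (tensor L L) L f id V) \<subseteq> Y \<longleftrightarrow>
      (\<forall>(d, c)\<in>V. \<forall>(a, b)\<in>f d. (a, pure_tensor L L b c) \<in> Y)"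
proof -
  let ?M = "tensor L L" let ?N = "tensor L ?M"
  have M: "complete_lattice ?M" using L L by (rule complete_lattice_tensor)
  have N: "complete_lattice ?N" using L M by (rule complete_lattice_tensor)
  define X where "X = tensor_map ?M L f id V"
  define h where "h W c = tensor_lift ?N (\<lambda>a b. pure_tensor L ?M a (pure_tensor L L b c)) W" for W c
  have mem: "a \<in> carrier L \<and> b \<in> carrier L" if "(a, b) \<in> W" "W \<in> carrier ?M" for a b W
    using tensor_subset[OF that(2)] that(1) by auto
  have pc: "pure_tensor L ?M a (pure_tensor L L b c) \<in> carrier ?N"
    if "(a, b) \<in> W" "W \<in> carrier ?M" "c \<in> carrier L" for a b c W
    using mem[OF that(1,2)] pure_tensor_closed[OF L M] pure_tensor_closed[OF L L] that(3) by simp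
  have hc: "h W c \<in> carrier ?N" if "W \<in> carrier ?M" "c \<in> carrier L" for W c
    unfolding h_def by (rule tensor_lift_closed[OF N]) (rule pc[OF _ that])
  have assoc: "tensor_assoc L L L X = tensor_lift ?N h X"
    by (simp add: tensor_assoc_def Let_def h_def[abs_def])
  have fV: "f d \<in> carrier ?M \<and> id c \<in> carrier L" if "(d, c) \<in> V" for d c using f V that by auto
  have XT: "X \<in> carrier (tensor ?M L)"
    unfolding X_def by (rule tensor_map_closed[OF M L]) (rule fV)
  have hX: "h W c \<in> carrier ?N" if "(W, c) \<in> X" for W c
    using tensor_subset[OF XT] that hc by auto
  show "tensor_assoc L L L (tensor_map ?M L f id V) \<in> carrier ?N"
    unfolding X_def[symmetric] assoc by (rule tensor_lift_closed[OF N]) (rule hX)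
  assume Y: "Y \<in> carrier ?N"
  \<comment> \<open>For \<open>c\<close> in the carrier this is the largest \<open>W\<close> with
    \<open>h W c \<subseteq> Y\<close>.\<close>
  define slice where "slice c = {(a, b). a \<in> carrier L \<and> b \<in> carrier L \<and> (a, pure_tensor L L b c) \<in> Y}" for c
  have slice: "slice c \<in> carrier ?M" if "c \<in> carrier L" for c
    unfolding slice_def by (rule tensor_slice_right[OF L Y that])
  have h_le: "h W c \<subseteq> Y \<longleftrightarrow> W \<subseteq> slice c" if W: "W \<in> carrier ?M" and c: "c \<in> carrier L" for W c
  proof -
    have "h W c \<subseteq> Y \<longleftrightarrow> (\<forall>(a, b)\<in>W. pure_tensor L ?M a (pure_tensor L L b c) \<subseteq> Y)"
      using tensor_lift_le_iff(2)[OF N, of W "\<lambda>a b. pure_tensor L ?M a (pure_tensor L L b c)", OF pc[OF _ W c] Y]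
      by (simp add: h_def)
    also have "\<dots> \<longleftrightarrow> (\<forall>(a, b)\<in>W. (a, pure_tensor L L b c) \<in> Y)"
    proof -
      have "pure_tensor L ?M a (pure_tensor L L b c) \<subseteq> Y \<longleftrightarrow> (a, pure_tensor L L b c) \<in> Y"
        if "(a, b) \<in> W" for a b
        using mem[OF that W] c pure_tensor_closed[OF L L] by (intro pure_tensor_le_iff[OF L M _ _ Y]) auto
      then have "(case z of (a, b) \<Rightarrow> pure_tensor L ?M a (pure_tensor L L b c) \<subseteq> Y) \<longleftrightarrow>
          (case z of (a, b) \<Rightarrow> (a, pure_tensor L L b c) \<in> Y)" if "z \<in> W" for z
        using that by (cases z) simp
      then show ?thesis by simp
    qed
    also have "\<dots> \<longleftrightarrow> W \<subseteq> slice c" using mem[OF _ W] unfolding slice_def by blast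
    finally show ?thesis .
  qed
  define K where "K = {(W, c). W \<in> carrier ?M \<and> c \<in> carrier L \<and> W \<subseteq> slice c}"
  have slice_sup: "W \<subseteq> slice (\<Squnion>\<^bsub>L\<^esub>A) \<longleftrightarrow> (\<forall>c\<in>A. W \<subseteq> slice c)"
    if W: "W \<in> carrier ?M" and A: "A \<subseteq> carrier L" for W A
  proof -
    have "(a, b) \<in> slice (\<Squnion>\<^bsub>L\<^esub>A) \<longleftrightarrow> (\<forall>c\<in>A. (a, b) \<in> slice c)"
      if ab: "a \<in> carrier L" "b \<in> carrier L" for a b
    proof -
      \<comment> \<open>Joins in the last variable are handled by the other kind of slice, with
        \<open>a\<close> fixed instead of \<open>c\<close>.\<close>
      have "(b, \<Squnion>\<^bsub>L\<^esub>A) \<in> {(b, c). b \<in> carrier L \<and> c \<in> carrier L \<and> (a, pure_tensor L L b c) \<in> Y} \<longleftrightarrow>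
          (\<forall>c\<in>A. (b, c) \<in> {(b, c). b \<in> carrier L \<and> c \<in> carrier L \<and> (a, pure_tensor L L b c) \<in> Y})"
        by (rule tensor_sup_right[OF tensor_slice_left[OF L Y ab(1)] ab(2) A])
      then show ?thesis
        using ab A complete_lattice_sup_closed[OF L A] by (simp add: slice_def subset_iff)
    qed
    then show ?thesis using mem[OF _ W] by (meson subrelI subsetD)
  qed
  have K: "K \<in> carrier (tensor ?M L)"
  proof -
    have "K \<subseteq> carrier ?M \<times> carrier L" by (auto simp: K_def)
    moreover have "(\<Squnion>\<^bsub>?M\<^esub>\<W>, c) \<in> K \<longleftrightarrow> (\<forall>W\<in>\<W>. (W, c) \<in> K)"
      if \<W>: "\<W> \<subseteq> carrier ?M" and c: "c \<in> carrier L" for \<W> c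
      using sup_le_iff[OF M \<W> slice[OF c]] complete_lattice_sup_closed[OF M \<W>] \<W> c
      by (simp add: K_def subset_iff[of \<W>])
    moreover have "(W, \<Squnion>\<^bsub>L\<^esub>A) \<in> K \<longleftrightarrow> (\<forall>c\<in>A. (W, c) \<in> K)"
      if W: "W \<in> carrier ?M" and A: "A \<subseteq> carrier L" for W A
      using slice_sup[OF W A] complete_lattice_sup_closed[OF L A] W A
      by (simp add: K_def subset_iff[of A])
    ultimately show ?thesis by (subst tensor_def) simp
  qed
  have "tensor_assoc L L L X \<subseteq> Y \<longleftrightarrow> (\<forall>(W, c)\<in>X. h W c \<subseteq> Y)"
    using tensor_lift_le_iff(2)[OF N, of X h, OF hX Y] by (simp add: assoc)
  also have "\<dots> \<longleftrightarrow> X \<subseteq> K"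
  proof -
    have "h W c \<subseteq> Y \<longleftrightarrow> (W, c) \<in> K" if "(W, c) \<in> X" for W c
      using tensor_subset[OF XT] that h_le[of W c] by (auto simp: K_def)
    then have "(case z of (W, c) \<Rightarrow> h W c \<subseteq> Y) \<longleftrightarrow> z \<in> K" if "z \<in> X" for z
      using that by (cases z) simp
    then show ?thesis by (simp add: subset_eq[of X])
  qed
  also have "\<dots> \<longleftrightarrow> (\<forall>(d, c)\<in>V. (f d, id c) \<in> K)"
    unfolding X_def using tensor_map_le_iff[OF M L, of V f id, OF fV K] .
  also have "\<dots> \<longleftrightarrow> (\<forall>(d, c)\<in>V. \<forall>(a, b)\<in>f d. (a, pure_tensor L L b c) \<in> Y)"
  proof -
    have "(f d, id c) \<in> K \<longleftrightarrow> (\<forall>(a, b)\<in>f d. (a, pure_tensor L L b c) \<in> Y)" if "(d, c) \<in> V" for d c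
    proof -
      have "(f d, id c) \<in> K \<longleftrightarrow> f d \<subseteq> slice c" using fV[OF that] by (simp add: K_def)
      also have "\<dots> \<longleftrightarrow> (\<forall>(a, b)\<in>f d. (a, pure_tensor L L b c) \<in> Y)"
        using mem[of _ _ "f d"] fV[OF that] unfolding slice_def by blast
      finally show ?thesis .
    qed
    then show ?thesis by blast
  qed
  finally show "tensor_assoc L L L (tensor_map ?M L f id V) \<subseteq> Y \<longleftrightarrow>
      (\<forall>(d, c)\<in>V. \<forall>(a, b)\<in>f d. (a, pure_tensor L L b c) \<in> Y)" unfolding X_def .
qed

text \<open>
  For the order dual \<open>L\<close> of \<open>C\<close>, \<open>triple L p q r\<close> is the copy of \<open>p \<otimes> (q \<otimes> r)\<close> in
  \<open>C \<boxtimes> (C \<boxtimes> C)\<close>. An element is above it iff, as a set, it is contained in it.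
\<close>

definition triple :: "('a, 'z) gorder_scheme \<Rightarrow> 'a \<Rightarrow> 'a \<Rightarrow> 'a \<Rightarrow> ('a \<times> ('a \<times> 'a) set) set" where
  "triple L p q r = copolar L (tensor L L) {(p, copolar L L {(q, r)})}"

lemma mem_copolar_singleton:
  "(a, b) \<in> copolar D E {(d, e)} \<longleftrightarrow> a \<in> carrier D \<and> b \<in> carrier E \<and> (a \<sqsubseteq>\<^bsub>D\<^esub> d \<or> b \<sqsubseteq>\<^bsub>E\<^esub> e)"
  by (simp add: copolar_def)

lemma triple_closed:
  assumes L: "complete_lattice L" and pqr: "p \<in> carrier L" "q \<in> carrier L" "r \<in> carrier L"
  shows "triple L p q r \<in> carrier (tensor L (tensor L L))"
proof -
  have "copolar L L {(q, r)} \<in> carrier (tensor L L)"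
    using copolar_in_tensor[OF L L] pqr by simp
  then show ?thesis
    unfolding triple_def using copolar_in_tensor[OF L complete_lattice_tensor[OF L L]] pqr by simp
qed

text \<open>Primes \<open>p'\<close>, \<open>q'\<close>, \<open>r'\<close> are found one variable at
  a time such that \<open>p' \<otimes> (q' \<otimes> r')\<close> is not below \<open>Y\<close>. With
  their partners \<open>p\<close>, \<open>q\<close>, \<open>r\<close>, the set
  \<open>triple L p q r\<close> is large enough to contain \<open>Y\<close> and still omits
  \<open>(a, W)\<close>.\<close>

lemma triple_separates:
  assumes L: "prime_generated L" and Y: "Y \<in> carrier (tensor L (tensor L L))"
    and a: "a \<in> carrier L" and W: "W \<in> carrier (tensor L L)" and aW: "(a, W) \<notin> Y"
  shows "\<exists>p\<in>carrier L. \<exists>q\<in>carrier L. \<exists>r\<in>carrier L. Y \<subseteq> triple L p q r \<and> (a, W) \<notin> triple L p q r"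
proof -
  have cl: "complete_lattice L" using L by (simp add: prime_generated_def)
  have M: "complete_lattice (tensor L L)" using cl cl by (rule complete_lattice_tensor)
  obtain p' where p': "completely_join_prime L p'" "p' \<in> carrier L" "p' \<sqsubseteq>\<^bsub>L\<^esub> a" "(p', W) \<notin> Y"
    by (rule tensor_prime_witness_left[OF L Y a W aW])
  define U where "U = {(b, c). b \<in> carrier L \<and> c \<in> carrier L \<and> (p', pure_tensor L L b c) \<in> Y}"
  have U: "U \<in> carrier (tensor L L)" unfolding U_def by (rule tensor_slice_left[OF cl Y p'(2)])
  have WL: "b \<in> carrier L \<and> c \<in> carrier L" if "(b, c) \<in> W" for b c
    using tensor_subset[OF W] that by auto
  \<comment> \<open>Otherwise \<open>Y\<close> would contain \<open>p'\<close> paired with each pure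
    tensor below \<open>W\<close>, hence with their join \<open>W\<close>.\<close>
  have "\<not> W \<subseteq> U"
  proof
    assume "W \<subseteq> U"
    then have "\<forall>V\<in>{pure_tensor L L b c |b c. (b, c) \<in> W}. (p', V) \<in> Y" by (auto simp: U_def)
    moreover have "{pure_tensor L L b c |b c. (b, c) \<in> W} \<subseteq> carrier (tensor L L)"
      using WL pure_tensor_closed[OF cl cl] by blast
    ultimately have "(p', \<Squnion>\<^bsub>tensor L L\<^esub>{pure_tensor L L b c |b c. (b, c) \<in> W}) \<in> Y"
      using tensor_sup_right[OF Y p'(2)] by simp
    then show False using tensor_eq_sup_pure[OF cl cl W] p'(4) by simp
  qed
  then obtain b c where bc: "(b, c) \<in> W" "(b, c) \<notin> U" by auto
  obtain q' r' where q': "completely_join_prime L q'" "q' \<in> carrier L" "q' \<sqsubseteq>\<^bsub>L\<^esub> b"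
    and r': "completely_join_prime L r'" "r' \<in> carrier L" "r' \<sqsubseteq>\<^bsub>L\<^esub> c" "(q', r') \<notin> U"
    using tensor_prime_witness[OF L L U _ _ bc(2)] WL[OF bc(1)] by blast
  have qrW: "(q', r') \<in> W" by (rule tensor_downward[OF cl cl W bc(1) q'(3) r'(3) q'(2) r'(2)])
  obtain p where p: "p \<in> carrier L" "\<And>x. x \<in> carrier L \<Longrightarrow> p' \<sqsubseteq>\<^bsub>L\<^esub> x \<longleftrightarrow> \<not> x \<sqsubseteq>\<^bsub>L\<^esub> p"
    using completely_join_prime_complement[OF cl p'(1)] by blast
  obtain q where q: "q \<in> carrier L" "\<And>x. x \<in> carrier L \<Longrightarrow> q' \<sqsubseteq>\<^bsub>L\<^esub> x \<longleftrightarrow> \<not> x \<sqsubseteq>\<^bsub>L\<^esub> q"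
    using completely_join_prime_complement[OF cl q'(1)] by blast
  obtain r where r: "r \<in> carrier L" "\<And>x. x \<in> carrier L \<Longrightarrow> r' \<sqsubseteq>\<^bsub>L\<^esub> x \<longleftrightarrow> \<not> x \<sqsubseteq>\<^bsub>L\<^esub> r"
    using completely_join_prime_complement[OF cl r'(1)] by blast
  let ?K = "copolar L L {(q, r)}"
  have ap: "\<not> a \<sqsubseteq>\<^bsub>L\<^esub> p" using p(2)[OF a] p'(3) by simp
  have "(q', r') \<notin> ?K"
    using q(2)[OF q'(2)] r(2)[OF r'(2)] complete_lattice_refl[OF cl q'(2)]
      complete_lattice_refl[OF cl r'(2)] by (simp add: mem_copolar_singleton)
  then have "\<not> W \<subseteq> ?K" using qrW by (metis subsetD)
  then have not: "(a, W) \<notin> triple L p q r"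
    using ap by (simp only: triple_def mem_copolar_singleton le_tensor) simp
  \<comment> \<open>A pair of \<open>Y\<close> outside the triple has components above
    \<open>p'\<close> and \<open>q' \<otimes> r'\<close>, which would put \<open>(q', r')\<close>
    into \<open>U\<close>.\<close>
  have "(a', W') \<in> triple L p q r" if aW': "(a', W') \<in> Y" for a' W'
  proof (rule ccontr)
    have a': "a' \<in> carrier L" and W': "W' \<in> carrier (tensor L L)"
      using tensor_subset[OF Y] aW' by auto
    assume "(a', W') \<notin> triple L p q r"
    then have *: "\<not> a' \<sqsubseteq>\<^bsub>L\<^esub> p" "\<not> W' \<subseteq> ?K"
      using a' W' by (simp_all only: triple_def mem_copolar_singleton le_tensor) simp_all
    then have pa: "p' \<sqsubseteq>\<^bsub>L\<^esub> a'" using p(2)[OF a'] by simp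
    obtain x y where xy: "(x, y) \<in> W'" "(x, y) \<notin> ?K" using *(2) by (meson subrelI)
    have xyL: "x \<in> carrier L" "y \<in> carrier L" using tensor_subset[OF W'] xy(1) by auto
    have "q' \<sqsubseteq>\<^bsub>L\<^esub> x" "r' \<sqsubseteq>\<^bsub>L\<^esub> y"
      using xy(2) xyL q(2)[OF xyL(1)] r(2)[OF xyL(2)] by (simp_all add: mem_copolar_singleton)
    then have "(q', r') \<in> W'" by (rule tensor_downward[OF cl cl W' xy(1) _ _ q'(2) r'(2)])
    then have "pure_tensor L L q' r' \<sqsubseteq>\<^bsub>tensor L L\<^esub> W'"
      using pure_tensor_le_iff[OF cl cl q'(2) r'(2) W'] by simp
    then have "(p', pure_tensor L L q' r') \<in> Y"
      by (rule tensor_downward[OF cl M Y aW' pa _ p'(2) pure_tensor_closed[OF cl cl q'(2) r'(2)]])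
    then show False using r'(4) q'(2) r'(2) by (simp add: U_def)
  qed
  then have "Y \<subseteq> triple L p q r" by (rule subrelI)
  with not p(1) q(1) r(1) show ?thesis by blast
qed

text \<open>By separation an element of the iterated product is determined by the triples that
  contain it.\<close>

lemma eq_by_triples:
  assumes L: "prime_generated L" and Y: "Y \<in> carrier (tensor L (tensor L L))"
    and Y': "Y' \<in> carrier (tensor L (tensor L L))"
  shows "Y = Y' \<longleftrightarrow> (\<forall>p\<in>carrier L. \<forall>q\<in>carrier L. \<forall>r\<in>carrier L.
    Y \<subseteq> triple L p q r \<longleftrightarrow> Y' \<subseteq> triple L p q r)"
proof
  have sub: "Z \<subseteq> Z'" if Z: "Z \<in> carrier (tensor L (tensor L L))"
    and Z': "Z' \<in> carrier (tensor L (tensor L L))"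
    and le: "\<forall>p\<in>carrier L. \<forall>q\<in>carrier L. \<forall>r\<in>carrier L. Z' \<subseteq> triple L p q r \<longrightarrow> Z \<subseteq> triple L p q r"
    for Z Z'
  proof (rule subrelI, rule ccontr)
    fix a W assume aW: "(a, W) \<in> Z" "(a, W) \<notin> Z'"
    have "a \<in> carrier L" "W \<in> carrier (tensor L L)" using tensor_subset[OF Z] aW(1) by auto
    from triple_separates[OF L Z' this aW(2)] le aW(1) show False by blast
  qed
  assume "\<forall>p\<in>carrier L. \<forall>q\<in>carrier L. \<forall>r\<in>carrier L.
    Y \<subseteq> triple L p q r \<longleftrightarrow> Y' \<subseteq> triple L p q r"
  then show "Y = Y'" using sub[OF Y Y'] sub[OF Y' Y] by blast
qed simp

text \<open>The value at \<open>a \<otimes> b\<close> of the left adjoint of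
  \<open>tcomult C\<close>.\<close>

definition cmult :: "'a coalgebra \<Rightarrow> 'a \<Rightarrow> 'a \<Rightarrow> 'a" where
  "cmult C a b = \<Sqinter>\<^bsub>C\<^esub>{z \<in> carrier C. (a, b) \<in> tcomult C z}"

text \<open>As \<open>tcomult\<close> preserves meets, the meet that defines the product belongs to
  the set over which it is taken.\<close>

lemma
  assumes C: "V_coalgebra C" and a: "a \<in> carrier C" and b: "b \<in> carrier C"
  shows cmult_closed: "cmult C a b \<in> carrier C"
    and cmult_le_iff: "z \<in> carrier C \<Longrightarrow> cmult C a b \<sqsubseteq>\<^bsub>C\<^esub> z \<longleftrightarrow> (a, b) \<in> tcomult C z"
proof -
  note cl = V_coalgebra_complete[OF C]
  let ?A = "{z \<in> carrier C. (a, b) \<in> tcomult C z}"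
  have A: "?A \<subseteq> carrier C" by blast
  show c: "cmult C a b \<in> carrier C" unfolding cmult_def by (rule complete_lattice_inf_closed[OF cl A])
  have mem: "(a, b) \<in> tcomult C (cmult C a b)" using tcomult_inf[OF C A a b] by (simp add: cmult_def)
  show "cmult C a b \<sqsubseteq>\<^bsub>C\<^esub> z \<longleftrightarrow> (a, b) \<in> tcomult C z" if z: "z \<in> carrier C"
  proof
    assume "(a, b) \<in> tcomult C z"
    then have "z \<in> ?A" using z by simp
    then show "cmult C a b \<sqsubseteq>\<^bsub>C\<^esub> z"
      using le_inf_iff[OF cl A c] complete_lattice_refl[OF cl c] unfolding cmult_def by simp
  next
    assume le: "cmult C a b \<sqsubseteq>\<^bsub>C\<^esub> z"
    have "\<Sqinter>\<^bsub>C\<^esub>{z, cmult C a b} = cmult C a b" by (rule complete_lattice_inf_pair[OF cl le c z])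
    then show "(a, b) \<in> tcomult C z" using tcomult_inf[OF C _ a b, of "{z, cmult C a b}"] mem z c by simp
  qed
qed

text \<open>Each composite is tested by containment in triples. For the first one, every
  \<open>(d, c)\<close> of \<open>comult C x\<close> must have \<open>p \<otimes> q\<close> below
  \<open>tcomult C d\<close> or \<open>r\<close> below \<open>c\<close>. The adjoint
  \<open>cmult\<close> turns the first alternative into \<open>cmult C p q\<close> being below
  \<open>d\<close>, and the whole into a membership in \<open>tcomult C x\<close>. The second
  composite is treated in the same way.\<close>

lemma coassociative_iff:
  assumes C: "V_coalgebra C"
  shows "coassociative C \<longleftrightarrow> (\<forall>x\<in>carrier C. \<forall>p\<in>carrier C. \<forall>q\<in>carrier C. \<forall>r\<in>carrier C.
    (cmult C p q, r) \<in> tcomult C x \<longleftrightarrow> (p, cmult C q r) \<in> tcomult C x)"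
proof -
  \<comment> \<open>In the dual the box is a tensor product, so the results on iterated products
    apply; inequalities of \<open>?L\<close> are those of \<open>C\<close> reversed.\<close>
  let ?L = "inv_gorder C"
  let ?M = "tensor ?L ?L"
  have pg: "prime_generated ?L" using prime_generated_dual[OF V_coalgebra_prime_generated[OF C]] .
  have L: "complete_lattice ?L" using V_coalgebra_complete[OF C] by (simp add: complete_lattice_dual_iff)
  have M: "complete_lattice ?M" using L L by (rule complete_lattice_tensor)
  have cc: "comult C d \<in> carrier ?M" if "d \<in> carrier ?L" for d
    using comult_closed[OF C, of d] that by (simp add: carrier_box)
  have tc: "(p, q) \<in> tcomult C d \<longleftrightarrow> (\<forall>(a, b)\<in>comult C d. p \<sqsubseteq>\<^bsub>C\<^esub> a \<or> q \<sqsubseteq>\<^bsub>C\<^esub> b)"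
    if "d \<in> carrier C" "p \<in> carrier C" "q \<in> carrier C" for p q d
    using that by (simp add: tcomult_eq[OF C] copolar_def)
  have "box_assoc C C C (box_map (box C C) C (comult C) id (comult C x)) =
      box_map C (box C C) id (comult C) (comult C x) \<longleftrightarrow>
    (\<forall>p\<in>carrier C. \<forall>q\<in>carrier C. \<forall>r\<in>carrier C.
      (cmult C p q, r) \<in> tcomult C x \<longleftrightarrow> (p, cmult C q r) \<in> tcomult C x)"
    if x: "x \<in> carrier C" for x
  proof -
    let ?V = "comult C x"
    let ?Y = "tensor_assoc ?L ?L ?L (tensor_map ?M ?L (comult C) id ?V)"
    let ?Z = "tensor_map ?L ?M id (comult C) ?V"
    have VL: "?V \<subseteq> carrier ?L \<times> carrier ?L" using tensor_subset[OF cc] x by simp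
    have V: "d \<in> carrier C \<and> e \<in> carrier C" if "(d, e) \<in> ?V" for d e using VL that by auto
    have idV: "id d \<in> carrier ?L \<and> comult C e \<in> carrier ?M" if "(d, e) \<in> ?V" for d e
      using V[OF that] cc by simp
    have Y: "?Y \<in> carrier (tensor ?L ?M)" by (rule tensor_assoc_tensor_map_closed[OF L VL cc])
    have Z: "?Z \<in> carrier (tensor ?L ?M)" by (rule tensor_map_closed[OF L M]) (rule idV)
    have Y_le: "?Y \<subseteq> triple ?L p q r \<longleftrightarrow> (cmult C p q, r) \<in> tcomult C x"
      and Z_le: "?Z \<subseteq> triple ?L p q r \<longleftrightarrow> (p, cmult C q r) \<in> tcomult C x"
      if pqr: "p \<in> carrier C" "q \<in> carrier C" "r \<in> carrier C" for p q r
    proof -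
      have T: "triple ?L p q r \<in> carrier (tensor ?L ?M)" using triple_closed[OF L] pqr by simp
      have K: "copolar ?L ?L {(q, r)} \<in> carrier ?M" using copolar_in_tensor[OF L L] pqr by simp
      have pure_mem: "(a, pure_tensor ?L ?L b c) \<in> triple ?L p q r \<longleftrightarrow>
          p \<sqsubseteq>\<^bsub>C\<^esub> a \<or> q \<sqsubseteq>\<^bsub>C\<^esub> b \<or> r \<sqsubseteq>\<^bsub>C\<^esub> c"
        if abc: "a \<in> carrier C" "b \<in> carrier C" "c \<in> carrier C" for a b c
      proof -
        have bc: "b \<in> carrier ?L" "c \<in> carrier ?L" using abc by simp_all
        show ?thesis
          unfolding triple_def mem_copolar_singleton le_tensor
            pure_tensor_le_iff[OF L L bc K]
          using abc pure_tensor_closed[OF L L bc] by simp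
      qed
      have "?Y \<subseteq> triple ?L p q r \<longleftrightarrow>
          (\<forall>(d, c)\<in>?V. \<forall>(a, b)\<in>comult C d. (a, pure_tensor ?L ?L b c) \<in> triple ?L p q r)"
        by (rule tensor_assoc_tensor_map_le_iff[OF L VL cc T])
      also have "\<dots> \<longleftrightarrow> (\<forall>(d, c)\<in>?V. cmult C p q \<sqsubseteq>\<^bsub>C\<^esub> d \<or> r \<sqsubseteq>\<^bsub>C\<^esub> c)"
      proof -
        have "(\<forall>(a, b)\<in>comult C d. (a, pure_tensor ?L ?L b c) \<in> triple ?L p q r) \<longleftrightarrow>
            cmult C p q \<sqsubseteq>\<^bsub>C\<^esub> d \<or> r \<sqsubseteq>\<^bsub>C\<^esub> c" if dc: "(d, c) \<in> ?V" for d c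
        proof -
          have d: "d \<in> carrier C" and c: "c \<in> carrier C" using V[OF dc] by simp_all
          have ab: "a \<in> carrier C \<and> b \<in> carrier C" if "(a, b) \<in> comult C d" for a b
            using tensor_subset[OF cc[of d]] d that by auto
          have "(a, pure_tensor ?L ?L b c) \<in> triple ?L p q r \<longleftrightarrow> p \<sqsubseteq>\<^bsub>C\<^esub> a \<or> q \<sqsubseteq>\<^bsub>C\<^esub> b \<or> r \<sqsubseteq>\<^bsub>C\<^esub> c"
            if "(a, b) \<in> comult C d" for a b using pure_mem[of a b c] ab[OF that] c by simp
          then have "(\<forall>(a, b)\<in>comult C d. (a, pure_tensor ?L ?L b c) \<in> triple ?L p q r) \<longleftrightarrow>
              (\<forall>(a, b)\<in>comult C d. p \<sqsubseteq>\<^bsub>C\<^esub> a \<or> q \<sqsubseteq>\<^bsub>C\<^esub> b \<or> r \<sqsubseteq>\<^bsub>C\<^esub> c)" by blast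
          \<comment> \<open>The alternative with \<open>r\<close> and \<open>c\<close> is
            independent of \<open>(a, b)\<close> and leaves the quantifier.\<close>
          also have "\<dots> \<longleftrightarrow> (p, q) \<in> tcomult C d \<or> r \<sqsubseteq>\<^bsub>C\<^esub> c" unfolding tc[OF d pqr(1,2)] by blast
          finally show ?thesis unfolding cmult_le_iff[OF C pqr(1,2) d] .
        qed
        then show ?thesis by blast
      qed
      also have "\<dots> \<longleftrightarrow> (cmult C p q, r) \<in> tcomult C x"
        unfolding tc[OF x cmult_closed[OF C pqr(1,2)] pqr(3)] ..
      finally show "?Y \<subseteq> triple ?L p q r \<longleftrightarrow> (cmult C p q, r) \<in> tcomult C x" .
      have "?Z \<subseteq> triple ?L p q r \<longleftrightarrow> (\<forall>(d, e)\<in>?V. (id d, comult C e) \<in> triple ?L p q r)"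
        using tensor_map_le_iff[OF L M, of ?V id "comult C", OF idV T] .
      also have "\<dots> \<longleftrightarrow> (\<forall>(d, e)\<in>?V. p \<sqsubseteq>\<^bsub>C\<^esub> d \<or> cmult C q r \<sqsubseteq>\<^bsub>C\<^esub> e)"
      proof -
        have "(id d, comult C e) \<in> triple ?L p q r \<longleftrightarrow> p \<sqsubseteq>\<^bsub>C\<^esub> d \<or> cmult C q r \<sqsubseteq>\<^bsub>C\<^esub> e"
          if de: "(d, e) \<in> ?V" for d e
        proof -
          have d: "d \<in> carrier C" and e: "e \<in> carrier C" using V[OF de] by simp_all
          have ce: "comult C e \<in> carrier ?M" using cc e by simp
          \<comment> \<open>In terms of \<open>C\<close>, containment in this singleton copolar says
            that each \<open>(a, b)\<close> of \<open>comult C e\<close> has \<open>q\<close> below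
            \<open>a\<close> or \<open>r\<close> below \<open>b\<close>.\<close>
          have "comult C e \<subseteq> copolar ?L ?L {(q, r)} \<longleftrightarrow> (q, r) \<in> tcomult C e"
            unfolding tc[OF e pqr(2,3)] using tensor_subset[OF ce]
            by (auto simp: polar_def)
          then show ?thesis
            unfolding triple_def mem_copolar_singleton le_tensor cmult_le_iff[OF C pqr(2,3) e]
            using d ce by simp
        qed
        then show ?thesis by blast
      qed
      also have "\<dots> \<longleftrightarrow> (p, cmult C q r) \<in> tcomult C x"
        unfolding tc[OF x pqr(1) cmult_closed[OF C pqr(2,3)]] ..
      finally show "?Z \<subseteq> triple ?L p q r \<longleftrightarrow> (p, cmult C q r) \<in> tcomult C x" .
    qed
    have "box_assoc C C C (box_map (box C C) C (comult C) id ?V) = ?Y"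
      by (simp only: box_assoc_def box_map_def inv_gorder_box)
    moreover have "box_map C (box C C) id (comult C) ?V = ?Z"
      by (simp only: box_map_def inv_gorder_box)
    ultimately show ?thesis
      using eq_by_triples[OF pg Y Z] Y_le Z_le by simp
  qed
  then show ?thesis by (simp add: coassociative_def)
qed

text \<open>Moving the products across the residuals turns the two memberships into \<open>q\<close>
  being a lower bound of \<open>lres R p (rres R x r)\<close> and of
  \<open>rres R (lres R p x) r\<close>. Letting the middle factor \<open>q\<close> vary compares
  these elements.\<close>

lemma res_associative_iff:
  assumes C: "V_coalgebra C" and R: "residuation_acdl R" and CR: "represents C R"
  shows "res_associative R \<longleftrightarrow> coassociative C"
proof -
  note cl = V_coalgebra_complete[OF C] and selR = representsD(1-3)[OF CR]
  have lR: "lres R a z \<in> carrier C" "rres R z a \<in> carrier C" if "a \<in> carrier C" "z \<in> carrier C" for a z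
    using lres_closed[OF R, of a z] rres_closed[OF R, of a z] that by (simp_all add: selR)
  have l: "(cmult C p q, r) \<in> tcomult C x \<longleftrightarrow> q \<sqsubseteq>\<^bsub>C\<^esub> lres R p (rres R x r)"
    and r: "(p, cmult C q r) \<in> tcomult C x \<longleftrightarrow> q \<sqsubseteq>\<^bsub>C\<^esub> rres R (lres R p x) r"
    if "x \<in> carrier C" "p \<in> carrier C" "q \<in> carrier C" "r \<in> carrier C" for x p q r
    using that lR cmult_closed[OF C] cmult_le_iff[OF C]
    by (simp_all add: representsD(4)[OF CR, of p] representsD(5)[OF CR, of _ r])
  have "lres R p (rres R x r) = rres R (lres R p x) r \<longleftrightarrow>
      (\<forall>q\<in>carrier C. (cmult C p q, r) \<in> tcomult C x \<longleftrightarrow> (p, cmult C q r) \<in> tcomult C x)"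
    if "x \<in> carrier C" "p \<in> carrier C" "r \<in> carrier C" for x p r
  proof -
    note c = lR(1)[OF that(2) lR(2)[OF that(3,1)]] lR(2)[OF that(3) lR(1)[OF that(2,1)]]
    show ?thesis using eq_by_lower_bounds[OF cl c] l[OF that(1,2) _ that(3)] r[OF that(1,2) _ that(3)]
      by auto
  qed
  then show ?thesis
    unfolding res_associative_def coassociative_iff[OF C] selR by (simp cong: ball_cong) blast
qed

lemma comonoid_iff_derivation_acdl:
  assumes "V_coalgebra C" "prime_counital C" "residuation_acdl R" "prime_unital R" "represents C R"
  shows "comonoid C \<longleftrightarrow> derivation_acdl R"
  using assms res_pure_iff[OF assms(1,3,5)] res_associative_iff[OF assms(1,3,5)]
  by (auto simp: comonoid_def derivation_acdl_def)

section \<open>Isomorphisms of categories\<close>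

text \<open>With functors that are the identity on maps it suffices to match objects, hom-sets and
  operations. The category laws of \<open>\<C>\<close> are inherited from \<open>\<D>\<close>, so
  they are checked directly only for residuations.\<close>

lemma isomorphic_categories_concrete:
  assumes \<D>: "is_category \<D>"
    and F: "\<And>A. A \<in> Obj \<C> \<Longrightarrow> F A \<in> Obj \<D>" and G: "\<And>X. X \<in> Obj \<D> \<Longrightarrow> G X \<in> Obj \<C>"
    and GF: "\<And>A. A \<in> Obj \<C> \<Longrightarrow> G (F A) = A" and FG: "\<And>X. X \<in> Obj \<D> \<Longrightarrow> F (G X) = X"
    and Hom: "\<And>A B. A \<in> Obj \<C> \<Longrightarrow> B \<in> Obj \<C> \<Longrightarrow> Hom \<C> A B = Hom \<D> (F A) (F B)"
    and Ident: "\<And>A. A \<in> Obj \<C> \<Longrightarrow> Ident \<C> A = Ident \<D> (F A)"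
    and Comp: "\<And>A B C. A \<in> Obj \<C> \<Longrightarrow> B \<in> Obj \<C> \<Longrightarrow> C \<in> Obj \<C> \<Longrightarrow>
      Comp \<C> A B C = Comp \<D> (F A) (F B) (F C)"
  shows "isomorphic_categories \<C> \<D>"
proof -
  have "is_category \<C>"
    using \<D> unfolding is_category_def by (simp add: F Hom Ident Comp cong: ball_cong)
  moreover have "is_functor \<C> \<D> F (\<lambda>_ _ f. f)"
    unfolding is_functor_def by (simp add: F Hom Ident Comp cong: ball_cong)
  moreover have "is_functor \<D> \<C> G (\<lambda>_ _ f. f)"
    unfolding is_functor_def by (simp add: G FG Hom Ident Comp cong: ball_cong)
  ultimately show ?thesis
    unfolding isomorphic_categories_def using \<D> GF FG
    by (intro conjI exI[of _ F] exI[of _ G] exI[of _ "\<lambda>_ _ f. f"]) simp_all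
qed

section \<open>The categories of residuation ACDLs\<close>

lemma
  assumes R: "complete_lattice R"
  shows sup_pres_restrict_id: "sup_pres R R (restrict id (carrier R))"
    and inf_pres_restrict_id: "inf_pres R R (restrict id (carrier R))"
proof -
  have "restrict id (carrier R) ` A = A" if "A \<subseteq> carrier R" for A using that by force
  then show "sup_pres R R (restrict id (carrier R))" "inf_pres R R (restrict id (carrier R))"
    using R complete_lattice_sup_closed[OF R] complete_lattice_inf_closed[OF R]
    by (simp_all add: sup_pres_def inf_pres_def)
qed

lemma
  assumes f: "f \<in> carrier R \<rightarrow>\<^sub>E carrier S"
  shows sup_pres_compose: "sup_pres R S f \<Longrightarrow> sup_pres S T g \<Longrightarrow> sup_pres R T (compose (carrier R) g f)"
    and inf_pres_compose: "inf_pres R S f \<Longrightarrow> inf_pres S T g \<Longrightarrow> inf_pres R T (compose (carrier R) g f)"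
proof -
  have img: "compose (carrier R) g f ` A = g ` f ` A" "f ` A \<subseteq> carrier S" if "A \<subseteq> carrier R" for A
    using that f by (force simp: compose_def)+
  show "sup_pres R T (compose (carrier R) g f)" if "sup_pres R S f" "sup_pres S T g"
    using that img complete_lattice_sup_closed[of R] by (simp add: sup_pres_def compose_def)
  show "inf_pres R T (compose (carrier R) g f)" if "inf_pres R S f" "inf_pres S T g"
    using that img complete_lattice_inf_closed[of R] by (simp add: inf_pres_def compose_def)
qed

lemma compose_PiE: "f \<in> A \<rightarrow>\<^sub>E B \<Longrightarrow> g \<in> B \<rightarrow>\<^sub>E C \<Longrightarrow> compose A g f \<in> A \<rightarrow>\<^sub>E C"
  by (auto simp: compose_def)

lemma res_morphism_id:
  assumes R: "residuation_acdl R"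
  shows "res_morphism R R (restrict id (carrier R))"
proof -
  note cl = residuation_complete[OF R]
  have refl: "x \<sqsubseteq>\<^bsub>R\<^esub> x" if "x \<in> carrier R" for x using complete_lattice_refl[OF cl that] .
  have "restrict id (carrier R) \<in> acdl_hom R R"
    by (simp add: acdl_hom_def sup_pres_restrict_id[OF cl] inf_pres_restrict_id[OF cl] del: restrict_apply)
  then show ?thesis
    using refl lres_closed[OF R] rres_closed[OF R] unfolding res_morphism_def
    by (auto intro!: bexI)
qed

lemma res_morphism_compose:
  assumes R: "residuation_acdl R" and S: "residuation_acdl S" and T: "residuation_acdl T"
    and f: "res_morphism R S f" and g: "res_morphism S T g"
  shows "res_morphism R T (compose (carrier R) g f)"
proof -
  interpret T: complete_lattice T using residuation_complete[OF T] .
  have fh: "f \<in> carrier R \<rightarrow>\<^sub>E carrier S" "sup_pres R S f" "inf_pres R S f"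
    and gh: "g \<in> carrier S \<rightarrow>\<^sub>E carrier T" "sup_pres S T g" "inf_pres S T g"
    using f g by (simp_all add: res_morphism_def acdl_hom_def)
  have fc: "f x \<in> carrier S" if "x \<in> carrier R" for x using fh(1) that by auto
  have gc: "g x \<in> carrier T" if "x \<in> carrier S" for x using gh(1) that by auto
  have g_mono: "g x \<sqsubseteq>\<^bsub>T\<^esub> g y" if "x \<sqsubseteq>\<^bsub>S\<^esub> y" "x \<in> carrier S" "y \<in> carrier S" for x y
    using sup_pres_mono[OF gh(2) _ that] gh(1) by auto
  have comp: "compose (carrier R) g f x = g (f x)" if "x \<in> carrier R" for x
    using that by (simp add: compose_def)
  have forth_f: "f (lres R x z) \<sqsubseteq>\<^bsub>S\<^esub> lres S (f x) (f z)" "f (rres R z x) \<sqsubseteq>\<^bsub>S\<^esub> rres S (f z) (f x)"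
    if "x \<in> carrier R" "z \<in> carrier R" for x z using f that by (simp_all add: res_morphism_def)
  have forth_g: "g (lres S x z) \<sqsubseteq>\<^bsub>T\<^esub> lres T (g x) (g z)" "g (rres S z x) \<sqsubseteq>\<^bsub>T\<^esub> rres T (g z) (g x)"
    if "x \<in> carrier S" "z \<in> carrier S" for x z using g that by (simp_all add: res_morphism_def)
  have back_f: "\<exists>x\<in>carrier R. y \<sqsubseteq>\<^bsub>S\<^esub> f x \<and> lres S y (f z) = f (lres R x z)"
    "\<exists>x\<in>carrier R. y \<sqsubseteq>\<^bsub>S\<^esub> f x \<and> rres S (f z) y = f (rres R z x)"
    if "y \<in> carrier S" "z \<in> carrier R" for y z using f that by (simp_all add: res_morphism_def)
  have back_g: "\<exists>x\<in>carrier S. y \<sqsubseteq>\<^bsub>T\<^esub> g x \<and> lres T y (g z) = g (lres S x z)"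
    "\<exists>x\<in>carrier S. y \<sqsubseteq>\<^bsub>T\<^esub> g x \<and> rres T (g z) y = g (rres S z x)"
    if "y \<in> carrier T" "z \<in> carrier S" for y z using g that by (simp_all add: res_morphism_def)
  note closed = lres_closed[OF R] rres_closed[OF R] lres_closed[OF S] rres_closed[OF S]
    lres_closed[OF T] rres_closed[OF T] fc gc
  show ?thesis
    unfolding res_morphism_def
  proof (intro conjI ballI)
    show "compose (carrier R) g f \<in> acdl_hom R T"
      using compose_PiE[OF fh(1) gh(1)] sup_pres_compose[OF fh(1,2) gh(2)]
        inf_pres_compose[OF fh(1,3) gh(3)] by (simp add: acdl_hom_def)
    fix x z assume x: "x \<in> carrier R" and z: "z \<in> carrier R"
    have "g (f (lres R x z)) \<sqsubseteq>\<^bsub>T\<^esub> lres T (g (f x)) (g (f z))"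
      by (rule T.le_trans[OF g_mono[OF forth_f(1)[OF x z]] forth_g(1)[OF fc[OF x] fc[OF z]]])
        (use x z closed in simp_all)
    then show "compose (carrier R) g f (lres R x z) \<sqsubseteq>\<^bsub>T\<^esub>
        lres T (compose (carrier R) g f x) (compose (carrier R) g f z)"
      using x z closed by (simp add: comp)
    have "g (f (rres R z x)) \<sqsubseteq>\<^bsub>T\<^esub> rres T (g (f z)) (g (f x))"
      by (rule T.le_trans[OF g_mono[OF forth_f(2)[OF x z]] forth_g(2)[OF fc[OF x] fc[OF z]]])
        (use x z closed in simp_all)
    then show "compose (carrier R) g f (rres R z x) \<sqsubseteq>\<^bsub>T\<^esub>
        rres T (compose (carrier R) g f z) (compose (carrier R) g f x)"
      using x z closed by (simp add: comp)
  next
    fix y z assume y: "y \<in> carrier T" and z: "z \<in> carrier R"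
    \<comment> \<open>Back composes from the outside in: the witness \<open>w\<close> that
      \<open>g\<close> supplies for \<open>y\<close> is the element for which \<open>f\<close>
      supplies \<open>x\<close>.\<close>
    obtain w where w: "w \<in> carrier S" "y \<sqsubseteq>\<^bsub>T\<^esub> g w" "lres T y (g (f z)) = g (lres S w (f z))"
      using back_g(1)[OF y fc[OF z]] by auto
    obtain x where x: "x \<in> carrier R" "w \<sqsubseteq>\<^bsub>S\<^esub> f x" "lres S w (f z) = f (lres R x z)"
      using back_f(1)[OF w(1) z] by auto
    have "y \<sqsubseteq>\<^bsub>T\<^esub> g (f x)"
      by (rule T.le_trans[OF w(2) g_mono[OF x(2)]]) (use y w(1) x(1) closed in simp_all)
    then show "\<exists>x\<in>carrier R. y \<sqsubseteq>\<^bsub>T\<^esub> compose (carrier R) g f x \<and>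
        lres T y (compose (carrier R) g f z) = compose (carrier R) g f (lres R x z)"
      using w x z closed by (intro bexI[of _ x]) (simp_all add: comp)
  next
    fix y z assume y: "y \<in> carrier T" and z: "z \<in> carrier R"
    obtain w where w: "w \<in> carrier S" "y \<sqsubseteq>\<^bsub>T\<^esub> g w" "rres T (g (f z)) y = g (rres S (f z) w)"
      using back_g(2)[OF y fc[OF z]] by auto
    obtain x where x: "x \<in> carrier R" "w \<sqsubseteq>\<^bsub>S\<^esub> f x" "rres S (f z) w = f (rres R z x)"
      using back_f(2)[OF w(1) z] by auto
    have "y \<sqsubseteq>\<^bsub>T\<^esub> g (f x)"
      by (rule T.le_trans[OF w(2) g_mono[OF x(2)]]) (use y w(1) x(1) closed in simp_all)
    then show "\<exists>x\<in>carrier R. y \<sqsubseteq>\<^bsub>T\<^esub> compose (carrier R) g f x \<and>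
        rres T (compose (carrier R) g f z) y = compose (carrier R) g f (rres R z x)"
      using w x z closed by (intro bexI[of _ x]) (simp_all add: comp)
  next
    fix x assume x: "x \<in> carrier R"
    have "res_unit R \<sqsubseteq>\<^bsub>R\<^esub> x \<longleftrightarrow> res_unit S \<sqsubseteq>\<^bsub>S\<^esub> f x" using f x by (simp add: res_morphism_def)
    also have "\<dots> \<longleftrightarrow> res_unit T \<sqsubseteq>\<^bsub>T\<^esub> g (f x)" using g fc[OF x] by (simp add: res_morphism_def)
    finally show "res_unit R \<sqsubseteq>\<^bsub>R\<^esub> x \<longleftrightarrow> res_unit T \<sqsubseteq>\<^bsub>T\<^esub> compose (carrier R) g f x"
      using x by (simp add: comp)
  qed
qed

lemma derivation_acdlD:
  "derivation_acdl R \<Longrightarrow> residuation_acdl R" "derivation_acdl R \<Longrightarrow> prime_unital R"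
  by (simp_all add: derivation_acdl_def)

lemma res_unit_closed:
  "residuation_acdl R \<Longrightarrow> prime_unital R \<Longrightarrow> res_unit R \<in> carrier R"
  using prime_unital_res_unit[of R] by (simp add: is_prime_unit_def completely_join_prime_def)

lemma corel_res_morphism_id:
  assumes R: "residuation_acdl R" "prime_unital R"
  shows "corel_res_morphism R R (restrict id (carrier R))"
proof -
  note cl = residuation_complete[OF R(1)]
  show ?thesis
    unfolding corel_res_morphism_def
    using sup_pres_restrict_id[OF cl] complete_lattice_refl[OF cl] complete_lattice_top(1)[OF cl]
      lres_closed[OF R(1)] res_unit_closed[OF R] by auto
qed

lemma corel_res_morphism_compose:
  assumes R: "residuation_acdl R" "prime_unital R" and S: "residuation_acdl S" "prime_unital S"
    and T: "residuation_acdl T" "prime_unital T"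
    and f: "corel_res_morphism R S f" and g: "corel_res_morphism S T g"
  shows "corel_res_morphism R T (compose (carrier R) g f)"
proof -
  interpret T: complete_lattice T using residuation_complete[OF T(1)] .
  have fh: "f \<in> carrier R \<rightarrow>\<^sub>E carrier S" "sup_pres R S f"
    and gh: "g \<in> carrier S \<rightarrow>\<^sub>E carrier T" "sup_pres S T g"
    using f g by (simp_all add: corel_res_morphism_def)
  have fc: "f x \<in> carrier S" if "x \<in> carrier R" for x using fh(1) that by auto
  have gc: "g x \<in> carrier T" if "x \<in> carrier S" for x using gh(1) that by auto
  have g_mono: "g x \<sqsubseteq>\<^bsub>T\<^esub> g y" if "x \<sqsubseteq>\<^bsub>S\<^esub> y" "x \<in> carrier S" "y \<in> carrier S" for x y
    using sup_pres_mono[OF gh(2) _ that] gh(1) by auto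
  have comp: "compose (carrier R) g f x = g (f x)" if "x \<in> carrier R" for x
    using that by (simp add: compose_def)
  have f_lres: "f (lres R x z) \<sqsubseteq>\<^bsub>S\<^esub> lres S (f x) (f z)" if "x \<in> carrier R" "z \<in> carrier R" for x z
    using f that by (simp add: corel_res_morphism_def)
  have g_lres: "g (lres S x z) \<sqsubseteq>\<^bsub>T\<^esub> lres T (g x) (g z)" if "x \<in> carrier S" "z \<in> carrier S" for x z
    using g that by (simp add: corel_res_morphism_def)
  have unit: "res_unit S \<sqsubseteq>\<^bsub>S\<^esub> f (res_unit R)" "res_unit T \<sqsubseteq>\<^bsub>T\<^esub> g (res_unit S)"
    and top: "f \<top>\<^bsub>R\<^esub> = \<top>\<^bsub>S\<^esub>" "g \<top>\<^bsub>S\<^esub> = \<top>\<^bsub>T\<^esub>"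
    using f g by (simp_all add: corel_res_morphism_def)
  note closed = lres_closed[OF R(1)] lres_closed[OF S(1)] lres_closed[OF T(1)] fc gc
    res_unit_closed[OF R] res_unit_closed[OF S] res_unit_closed[OF T]
    complete_lattice_top(1)[OF residuation_complete[OF R(1)]]
  show ?thesis
    unfolding corel_res_morphism_def
  proof (intro conjI ballI)
    show "compose (carrier R) g f \<in> carrier R \<rightarrow>\<^sub>E carrier T" by (rule compose_PiE[OF fh(1) gh(1)])
    show "sup_pres R T (compose (carrier R) g f)" by (rule sup_pres_compose[OF fh gh(2)])
    show "compose (carrier R) g f \<top>\<^bsub>R\<^esub> = \<top>\<^bsub>T\<^esub>" using closed top by (simp add: comp)
    fix x z assume x: "x \<in> carrier R" and z: "z \<in> carrier R"
    have "g (f (lres R x z)) \<sqsubseteq>\<^bsub>T\<^esub> lres T (g (f x)) (g (f z))"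
      by (rule T.le_trans[OF g_mono[OF f_lres[OF x z]] g_lres[OF fc[OF x] fc[OF z]]])
        (use x z closed in simp_all)
    then show "compose (carrier R) g f (lres R x z) \<sqsubseteq>\<^bsub>T\<^esub>
        lres T (compose (carrier R) g f x) (compose (carrier R) g f z)"
      using x z closed by (simp add: comp)
  next
    have "res_unit T \<sqsubseteq>\<^bsub>T\<^esub> g (f (res_unit R))"
      by (rule T.le_trans[OF unit(2) g_mono[OF unit(1)]]) (use closed in simp_all)
    then show "res_unit T \<sqsubseteq>\<^bsub>T\<^esub> compose (carrier R) g f (res_unit R)"
      using closed by (simp add: comp)
  qed
qed

text \<open>Since morphisms are extensional on the carrier, the unit and associativity laws are
  equalities of functions; what depends on the kind of morphism is closure under identities and
  composition.\<close>

lemma is_category_concrete: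
  assumes id: "\<And>R. R \<in> Obj \<C> \<Longrightarrow> restrict id (carrier R) \<in> Hom \<C> R R"
    and comp: "\<And>R S T f g. R \<in> Obj \<C> \<Longrightarrow> S \<in> Obj \<C> \<Longrightarrow> T \<in> Obj \<C> \<Longrightarrow> f \<in> Hom \<C> R S \<Longrightarrow>
      g \<in> Hom \<C> S T \<Longrightarrow> compose (carrier R) g f \<in> Hom \<C> R T"
    and PiE: "\<And>R S f. R \<in> Obj \<C> \<Longrightarrow> S \<in> Obj \<C> \<Longrightarrow> f \<in> Hom \<C> R S \<Longrightarrow> f \<in> carrier R \<rightarrow>\<^sub>E carrier S"
    and Ident: "Ident \<C> = (\<lambda>R. restrict id (carrier R))"
    and Comp: "Comp \<C> = (\<lambda>R S T g f. compose (carrier R) g f)"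
  shows "is_category \<C>"
  unfolding is_category_def Ident Comp
proof (intro conjI ballI)
  fix R S f assume f: "R \<in> Obj \<C>" "S \<in> Obj \<C>" "f \<in> Hom \<C> R S"
  have fm: "f x \<in> carrier S" if "x \<in> carrier R" for x using PiE[OF f] that by (rule PiE_mem)
  have fe: "f x = undefined" if "x \<notin> carrier R" for x using PiE[OF f] that by (rule PiE_arb)
  show "compose (carrier R) f (restrict id (carrier R)) = f"
    "compose (carrier R) (restrict id (carrier S)) f = f"
    using fm fe by (simp_all add: compose_def fun_eq_iff restrict_def)
  fix T W g h assume "T \<in> Obj \<C>" "W \<in> Obj \<C>" "g \<in> Hom \<C> S T" "h \<in> Hom \<C> T W"
  show "compose (carrier R) h (compose (carrier R) g f) = compose (carrier R) (compose (carrier S) h g) f"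
    using fm by (simp add: compose_def fun_eq_iff restrict_def)
qed (rule id comp; assumption)+

lemma is_category_ResACDL: "is_category ResACDL"
proof (rule is_category_concrete)
  fix R S T :: "'a residuation" and f g
  assume "R \<in> Obj ResACDL"
  then have R: "residuation_acdl R" by (simp add: ResACDL_def)
  then show "restrict id (carrier R) \<in> Hom ResACDL R R"
    using res_morphism_id by (simp add: ResACDL_def del: restrict_apply)
  assume "S \<in> Obj ResACDL" and f: "f \<in> Hom ResACDL R S"
  then have S: "residuation_acdl S" by (simp add: ResACDL_def)
  show "f \<in> carrier R \<rightarrow>\<^sub>E carrier S" using f by (simp add: ResACDL_def res_morphism_def acdl_hom_def)
  assume "T \<in> Obj ResACDL" and g: "g \<in> Hom ResACDL S T"
  then have T: "residuation_acdl T" by (simp add: ResACDL_def)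
  show "compose (carrier R) g f \<in> Hom ResACDL R T"
    using res_morphism_compose[OF R S T] f g by (simp add: ResACDL_def)
qed (simp_all add: ResACDL_def)

lemma is_category_full_subcategory: "is_category \<C> \<Longrightarrow> is_category (full_subcategory \<C> P)"
  unfolding is_category_def full_subcategory_def by simp

lemma is_category_RelDerACDL: "is_category RelDerACDL"
proof (rule is_category_concrete)
  fix R S T :: "'a residuation" and f g
  assume "R \<in> Obj RelDerACDL"
  then have R: "derivation_acdl R" by (simp add: RelDerACDL_def)
  then show "restrict id (carrier R) \<in> Hom RelDerACDL R R"
    using corel_res_morphism_id[OF derivation_acdlD] by (simp add: RelDerACDL_def del: restrict_apply)
  assume "S \<in> Obj RelDerACDL" and f: "f \<in> Hom RelDerACDL R S"
  then have S: "derivation_acdl S" by (simp add: RelDerACDL_def)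
  show "f \<in> carrier R \<rightarrow>\<^sub>E carrier S" using f by (simp add: RelDerACDL_def corel_res_morphism_def)
  assume "T \<in> Obj RelDerACDL" and g: "g \<in> Hom RelDerACDL S T"
  then have T: "derivation_acdl T" by (simp add: RelDerACDL_def)
  show "compose (carrier R) g f \<in> Hom RelDerACDL R T"
    using corel_res_morphism_compose[OF derivation_acdlD[OF R] derivation_acdlD[OF S]
      derivation_acdlD[OF T]] f g by (simp add: RelDerACDL_def)
qed (simp_all add: RelDerACDL_def)

section \<open>Inverse constructions and the three isomorphisms\<close>

lemma coalgebra_of_residuation_of:
  assumes C: "V_coalgebra C" "prime_counital C"
  shows "coalgebra_of (residuation_of C) = C"
  by (rule represents_coalgebra_unique[OF coalgebra_of[OF residuation_of(1,2)[OF C]] C residuation_of(3)[OF C]])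

text \<open>The given residuation and the reconstructed one represent the same coalgebra.\<close>

lemma residuation_of_coalgebra_of:
  assumes R: "residuation_acdl R" "prime_unital R"
  shows "residuation_of (coalgebra_of R) = R"
  by (rule represents_residuation_unique[OF residuation_of(1)[OF coalgebra_of(1,2)[OF R]]
    residuation_of(3)[OF coalgebra_of(1,2)[OF R]] R(1) coalgebra_of(3)[OF R]])

lemma carrier_residuation_of: "carrier (residuation_of C) = carrier C"
  by (simp add: residuation_of_def)

lemma comonoid_residuation_of_iff:
  "V_coalgebra C \<Longrightarrow> prime_counital C \<Longrightarrow> derivation_acdl (residuation_of C) \<longleftrightarrow> comonoid C"
  using comonoid_iff_derivation_acdl[of C "residuation_of C"] residuation_of[of C] by blast

lemma comonoid_coalgebra_of:
  assumes R: "derivation_acdl R"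
  shows "comonoid (coalgebra_of R)"
  using comonoid_iff_derivation_acdl[OF coalgebra_of(1,2)[OF derivation_acdlD[OF R]]
    derivation_acdlD[OF R] coalgebra_of(3)[OF derivation_acdlD[OF R]]] R by simp

lemma comonoidD: "comonoid C \<Longrightarrow> V_coalgebra C" "comonoid C \<Longrightarrow> prime_counital C"
  by (simp_all add: comonoid_def)

lemma pure_morphism_residuation_of:
  assumes C: "V_coalgebra C" "prime_counital C" and D: "V_coalgebra D" "prime_counital D"
  shows "pure_morphism C D = res_morphism (residuation_of C) (residuation_of D)"
  by (rule ext, rule pure_morphism_iff_res_morphism[OF C(1) residuation_of(1,3)[OF C] D(1) residuation_of(1,3)[OF D]])

lemma corel_morphism_residuation_of:
  assumes C: "V_coalgebra C" "prime_counital C" and D: "V_coalgebra D" "prime_counital D"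
  shows "corel_morphism C D = corel_res_morphism (residuation_of C) (residuation_of D)"
  by (rule ext, rule corel_morphism_iff_corel_res_morphism[OF C(1) residuation_of[OF C] D(1) residuation_of(1,3)[OF D]])

theorem theorem5p22:
  shows "isomorphic_categories (Coalg :: ('a coalgebra, 'a \<Rightarrow> 'a) category)
           (ResACDL :: ('a residuation, 'a \<Rightarrow> 'a) category) \<and>
         isomorphic_categories (Comon :: ('a coalgebra, 'a \<Rightarrow> 'a) category)
           (DerACDL :: ('a residuation, 'a \<Rightarrow> 'a) category) \<and>
         isomorphic_categories (RelComon :: ('a coalgebra, 'a \<Rightarrow> 'a) category)
           (RelDerACDL :: ('a residuation, 'a \<Rightarrow> 'a) category)"
proof (intro conjI)
  show "isomorphic_categories (Coalg :: ('a coalgebra, 'a \<Rightarrow> 'a) category)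
      (ResACDL :: ('a residuation, 'a \<Rightarrow> 'a) category)"
    by (rule isomorphic_categories_concrete[OF is_category_ResACDL, of _ residuation_of coalgebra_of])
      (simp_all add: Coalg_def ResACDL_def residuation_of coalgebra_of coalgebra_of_residuation_of
        residuation_of_coalgebra_of pure_morphism_residuation_of carrier_residuation_of)
  show "isomorphic_categories (Comon :: ('a coalgebra, 'a \<Rightarrow> 'a) category)
      (DerACDL :: ('a residuation, 'a \<Rightarrow> 'a) category)"
    \<comment> \<open>The object maps restrict to the full subcategories because comonoids
      correspond exactly to derivation ACDLs.\<close>
    unfolding Comon_def DerACDL_def
    by (rule isomorphic_categories_concrete[OF is_category_full_subcategory[OF is_category_ResACDL],
          where F = residuation_of and G = coalgebra_of])
      (simp_all add: full_subcategory_def Coalg_def ResACDL_def residuation_of coalgebra_of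
        coalgebra_of_residuation_of residuation_of_coalgebra_of pure_morphism_residuation_of
        carrier_residuation_of comonoid_residuation_of_iff comonoid_coalgebra_of)
  show "isomorphic_categories (RelComon :: ('a coalgebra, 'a \<Rightarrow> 'a) category)
      (RelDerACDL :: ('a residuation, 'a \<Rightarrow> 'a) category)"
    by (rule isomorphic_categories_concrete[OF is_category_RelDerACDL, of _ residuation_of coalgebra_of])
      (simp_all add: RelComon_def RelDerACDL_def comonoidD derivation_acdlD
        coalgebra_of_residuation_of residuation_of_coalgebra_of corel_morphism_residuation_of
        carrier_residuation_of comonoid_residuation_of_iff comonoid_coalgebra_of)
qed

end
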